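(* In the general hidden Markov model setting described in the context, let $\theta_0\in\Theta$ and suppose the observations are those of the stationary hidden Markov model with law $\mathbb P_{\theta_0}$; let $l\ge1$ be a fixed integer. Assume that $\rho_{\theta_0}>1$ and that assumptions C1 and C2 are satisfied, together with either assumption C3 or assumption C3bis (see context), and let $\epsilon_n$ be the sequence given by C3 (respectively C3bis). Then $$\mathbb P^\Pi\left[\theta:\ \|f_{l,\theta}-f_{l,\theta_0}\|_1\,\frac{\rho_\theta-1}{2R_\theta+\rho_\theta-1}\ge\epsilon_n\ \Big|\ Y_{1:n}\right]=o_{\mathbb P_{\theta_0}}(1).$$
   Context: **Model.** $\mathcal X,\mathcal Y$ are Polish spaces with Borel $\sigma$-fields, $\nu$ is a given measure on $\mathcal Y$, $\Theta$ is a subset of a Euclidean space. For each $\theta\in\Theta$, $Q_\theta$ is a Markov kernel on $\mathcal X$ admitting a (not necessarily unique) stationary distribution $\mu_\theta$, and $g_\theta(\cdot|x)$, $x\in\mathcal X$, are probability densities on $\mathcal Y$ w.r.t. $\nu$. $\mathbb P_\theta$ is the law of the stationary hidden Markov model $(X_j,Y_j)_{j\ge1}$: $(X_j)$ is a Markov chain with kernel $Q_\theta$ and initial law $\mu_\theta$, and conditionally on $(X_j)$ the $Y_j$ are independent with densities $g_\theta(\cdot|X_j)$. Write $Y_{1:n}=(Y_1,\dots,Y_n)$. The density of $Y_{1:n}$ under $\mathbb P_\theta$ w.r.t. $\nu^{\otimes n}$ is $$f_{n,\theta}(y_1,\dots,y_n)=\int_{\mathcal X^n}\mu_\theta(dx_1)\prod_{i=1}^{n-1}Q_\theta(x_i,dx_{i+1})\prod_{i=1}^ng_\theta(y_i|x_i),$$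 and $f_{l,\theta}$ is this function with $n=l$. Let $d_l(\theta,\theta')=\|f_{l,\theta}-f_{l,\theta'}\|_1=\int_{\mathcal Y^l}|f_{l,\theta}-f_{l,\theta'}|\,d\nu^{\otimes l}$. For each $\theta\in\Theta$, $\rho_\theta\ge1$ and $0<R_\theta\le2$ are real numbers such that for any integer $m$ and any $x\in\mathcal X$, $\|Q_\theta^m(x,\cdot)-\mu_\theta\|_{TV}\le R_\theta\rho_\theta^{-m}$, where $\|\cdot\|_{TV}$ is the total variation norm (so that probability measures differ by at most $2$). **Prior and posterior.** $\Pi_\Theta$ is a prior probability on $\Theta$, $\pi_{\mathcal X}$ a probability on $\mathcal X$ (prior on the unobserved initial state), $\Pi=\Pi_\Theta\otimes\pi_{\mathcal X}$. The log-likelihood starting from $x\in\mathcal X$ is $\ell_n(\theta,x)=\log\int_{\mathcal X^n}\prod_{i=0}^{n-1}Q_\theta(x_i,dx_{i+1})\prod_{i=1}^ng_\theta(Y_i|x_i)$ with $x_0=x$. The posterior is $$\mathbb P^\Pi(A\mid Y_{1:n})=\frac{\int_{A\times\mathcal X}e^{\ell_n(\theta,x)}\Pi_\Theta(d\theta)\pi_{\mathcal X}(dx)}{\int_{\Theta\times\mathcal X}e^{\ell_n(\theta,x)}\Pi_\Theta(d\theta)\pi_{\mathcal X}(dx)},\qquad A\subset\Theta\text{ Borel}.$$ **Notation.** $a_n\gtrsim b_n$ means $a_n\ge c\,b_n$ for some constant $c>0$. $o_{\mathbb P_{\theta_0}}(1)$ denotes convergence to $0$ in $\mathbb P_{\theta_0}$-probability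 as $n\to\infty$. For $\mathcal F\subset\Theta$, $N(\delta,\mathcal F,d_l(\cdot,\cdot))$ is the smallest number of $\theta_j\in\mathcal F$ such that for all $\theta\in\mathcal F$ there exists a $\theta_j$ with $d_l(\theta_j,\theta)\le\delta$. $x_0$ is a fixed point of $\mathcal X$. **Assumptions.** C1: there exists $A>0$ such that for any $(x_0,x_1)\in\mathcal X^2$, $\mathbb P_{\theta_0}$-almost surely, for all $n\in\mathbb N$, $|\ell_n(\theta_0,x_0)-\ell_n(\theta_0,x_1)|\le A$; and there exist $S_n\subset\Theta\times\mathcal X$, $C_n>0$ and a sequence $\tilde\epsilon_n>0$ going to $0$ with $n\tilde\epsilon_n^2\to+\infty$ such that $$\sup_{(\theta,x)\in S_n}\mathbb P_{\theta_0}\bigl[\ell_n(\theta,x)-\ell_n(\theta_0,x_0)\le-n\tilde\epsilon_n^2\bigr]=o(1),\qquad\Pi[S_n]\gtrsim e^{-C_nn\tilde\epsilon_n^2}.$$ C2: there exists a sequence $(\mathcal F_n)_{n\ge1}$ of subsets of $\Theta$ such that $\Pi_\Theta(\mathcal F_n^c)=o(e^{-n\tilde\epsilon_n^2(1+C_n)})$. C3: there exists a sequence $\epsilon_n\ge\tilde\epsilon_n$ going to $0$ such that $(n\tilde\epsilon_n^2(1+C_n))/(n\epsilon_n^2)$ goes to $0$ and $$N\Bigl(\frac{\epsilon_n}{12},\mathcal F_n,d_l(\cdot,\cdot)\Bigr)\le\exp\left\{\frac{n\epsilon_n^2(\rho_{\theta_0}-1)^2}{16\,l\,(2R_{\theta_0}+\rho_{\theta_0}-1)^2}\right\}.$$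 C3bis: there exists a sequence $\epsilon_n\ge\tilde\epsilon_n$ going to $0$ such that $$\sum_{m\ge1}\frac{\Pi_\Theta(A_{n,m}(\epsilon_n))}{\Pi(S_n)}\exp\left\{-\frac{nm^2\epsilon_n^2}{32\,l}\right\}=o(e^{-n\tilde\epsilon_n^2})$$ and, for all $m\ge1$, $$N\Bigl(\frac{m\epsilon_n}{12},A_{n,m}(\epsilon_n),d_l(\cdot,\cdot)\Bigr)\le\exp\left\{\frac{nm^2\epsilon_n^2(\rho_{\theta_0}-1)^2}{16\,l\,(2R_{\theta_0}+\rho_{\theta_0}-1)^2}\right\},$$ where $$A_{n,m}(\epsilon)=\mathcal F_n\cap\left\{\theta:\ m\epsilon\le\|f_{l,\theta}-f_{l,\theta_0}\|_1\frac{\rho_\theta-1}{2R_\theta+\rho_\theta-1}\le(m+1)\epsilon\right\}.$$ *)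

theory Defs
  imports "HOL-Probability.Probability" "HOL-Library.Landau_Symbols"
begin

subsection \<open>Markov kernels and total variation\<close>

primrec kernel_pow :: "('x::polish_space \<Rightarrow> 'x measure) \<Rightarrow> nat \<Rightarrow> 'x \<Rightarrow> 'x measure" where
  "kernel_pow K 0 = return borel"
| "kernel_pow K (Suc m) = (\<lambda>x. kernel_pow K m x \<bind> K)"

text \<open>Total variation norm of the signed measure \<open>M - N\<close>, dual to the sup norm on measurable
  functions; two probability measures are at distance at most 2.\<close>

definition tv_dist :: "'x measure \<Rightarrow> 'x measure \<Rightarrow> real" where
  "tv_dist M N = (SUP h\<in>{h \<in> borel_measurable M. \<forall>x. \<bar>h x\<bar> \<le> 1}.
     \<bar>(\<integral>x. h x \<partial>M) - (\<integral>x. h x \<partial>N)\<bar>)"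

text \<open>Law of the Markov chain with initial law \<open>m\<close> and kernel \<open>K\<close>, by the Ionescu-Tulcea
  theorem. Coordinates are numbered from 0, so \<open>X\<^sub>j\<close> is coordinate \<open>j - 1\<close>.\<close>

definition chain_step :: "'x measure \<Rightarrow> ('x \<Rightarrow> 'x measure) \<Rightarrow> nat \<Rightarrow> (nat \<Rightarrow> 'x) \<Rightarrow> 'x measure" where
  "chain_step m K i h = (if i = 0 then m else K (h (i - 1)))"

definition markov_chain_law ::
    "'x::polish_space measure \<Rightarrow> ('x \<Rightarrow> 'x measure) \<Rightarrow> (nat \<Rightarrow> 'x) measure" where
  "markov_chain_law m K =
     projective_family.lim UNIV (Ionescu_Tulcea.CI (chain_step m K) (\<lambda>_. borel)) (\<lambda>_. borel)"

subsection \<open>Hidden Markov models\<close>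

text \<open>\<open>hmm_lik K g n m y\<close> is the integral of
  \<open>m(dx\<^sub>1) K(x\<^sub>1,dx\<^sub>2) \<dots> K(x\<^sub>n\<^sub>-\<^sub>1,dx\<^sub>n) g(y\<^sub>1|x\<^sub>1) \<dots> g(y\<^sub>n|x\<^sub>n)\<close> over the hidden path, with the observation
  \<open>y\<^sub>j\<close> stored at index \<open>j - 1\<close>. The initial law \<open>m\<close> of \<open>X\<^sub>1\<close> is the stationary law in the density
  of the observations, and \<open>K x\<close> in the likelihood of the chain started at \<open>X\<^sub>0 = x\<close>.\<close>

primrec hmm_lik :: "('x \<Rightarrow> 'x measure) \<Rightarrow> ('x \<Rightarrow> 'y \<Rightarrow> real) \<Rightarrow> nat \<Rightarrow> 'x measure \<Rightarrow> (nat \<Rightarrow> 'y) \<Rightarrow> ennreal"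
where
  "hmm_lik K g 0 m y = 1"
| "hmm_lik K g (Suc n) m y =
     (\<integral>\<^sup>+x. ennreal (g x (y 0)) * hmm_lik K g n (K x) (\<lambda>i. y (Suc i)) \<partial>m)"

record ('a, 'x, 'y) hmm =
  Par :: "'a set"
  Ker :: "'a \<Rightarrow> 'x \<Rightarrow> 'x measure"
  Stat :: "'a \<Rightarrow> 'x measure"
  Ref :: "'y measure"
  Emi :: "'a \<Rightarrow> 'x \<Rightarrow> 'y \<Rightarrow> real"
  Rho :: "'a \<Rightarrow> real"
  Rad :: "'a \<Rightarrow> real"
  Prior :: "'a measure"
  Init :: "'x measure"

definition emission_law :: "('a, 'x, 'y) hmm \<Rightarrow> 'a \<Rightarrow> 'x \<Rightarrow> 'y measure" where
  "emission_law H \<theta> x = density (Ref H) (\<lambda>y. ennreal (Emi H \<theta> x y))"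

text \<open>Law of \<open>((X\<^sub>j)\<^sub>j, (Y\<^sub>j)\<^sub>j)\<close>: the hidden chain is stationary and, given it, the observations are
  independent.\<close>

definition hmm_law ::
    "('a, 'x::polish_space, 'y::polish_space) hmm \<Rightarrow> 'a \<Rightarrow> ((nat \<Rightarrow> 'x) \<times> (nat \<Rightarrow> 'y)) measure" where
  "hmm_law H \<theta> = markov_chain_law (Stat H \<theta>) (Ker H \<theta>) \<bind>
     (\<lambda>x. distr (PiM UNIV (\<lambda>j. emission_law H \<theta> (x j)))
        (PiM UNIV (\<lambda>_. borel) \<Otimes>\<^sub>M PiM UNIV (\<lambda>_. borel)) (\<lambda>y. (x, y)))"

definition obs_density :: "('a, 'x, 'y) hmm \<Rightarrow> nat \<Rightarrow> 'a \<Rightarrow> (nat \<Rightarrow> 'y) \<Rightarrow> real" where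
  "obs_density H n \<theta> y = enn2real (hmm_lik (Ker H \<theta>) (Emi H \<theta>) n (Stat H \<theta>) y)"

definition dens_dist :: "('a, 'x, 'y) hmm \<Rightarrow> nat \<Rightarrow> 'a \<Rightarrow> 'a \<Rightarrow> real" where
  "dens_dist H l \<theta> \<theta>' =
     (\<integral>y. \<bar>obs_density H l \<theta> y - obs_density H l \<theta>' y\<bar> \<partial>PiM {..<l} (\<lambda>_. Ref H))"

definition weighted_dist :: "('a, 'x, 'y) hmm \<Rightarrow> nat \<Rightarrow> 'a \<Rightarrow> 'a \<Rightarrow> real" where
  "weighted_dist H l \<theta>0 \<theta> =
     dens_dist H l \<theta> \<theta>0 * ((Rho H \<theta> - 1) / (2 * Rad H \<theta> + Rho H \<theta> - 1))"

text \<open>The likelihood \<open>cond_lik\<close> is the exponential of the log-likelihood, which is \<open>-\<infinity>\<close> where the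
  likelihood vanishes.\<close>

definition cond_lik :: "('a, 'x, 'y) hmm \<Rightarrow> nat \<Rightarrow> 'a \<Rightarrow> 'x \<Rightarrow> (nat \<Rightarrow> 'y) \<Rightarrow> ennreal" where
  "cond_lik H n \<theta> x y = hmm_lik (Ker H \<theta>) (Emi H \<theta>) n (Ker H \<theta> x) y"

definition cond_loglik :: "('a, 'x, 'y) hmm \<Rightarrow> nat \<Rightarrow> 'a \<Rightarrow> 'x \<Rightarrow> (nat \<Rightarrow> 'y) \<Rightarrow> ereal" where
  "cond_loglik H n \<theta> x y =
     (if cond_lik H n \<theta> x y = 0 then -\<infinity>
      else if cond_lik H n \<theta> x y = \<infinity> then \<infinity>
      else ereal (ln (enn2real (cond_lik H n \<theta> x y))))"

abbreviation full_prior :: "('a, 'x, 'y) hmm \<Rightarrow> ('a \<times> 'x) measure" where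
  "full_prior H \<equiv> Prior H \<Otimes>\<^sub>M Init H"

text \<open>The integrals are extended reals, so the degenerate ratios \<open>0/0\<close> and \<open>\<infinity>/\<infinity>\<close> are 0. The event
  that this occurs at time \<open>n\<close> has vanishing probability under \<open>cond_C1\<close> below.\<close>

definition posterior :: "('a, 'x, 'y) hmm \<Rightarrow> nat \<Rightarrow> (nat \<Rightarrow> 'y) \<Rightarrow> 'a set \<Rightarrow> real" where
  "posterior H n y A = enn2real
     ((\<integral>\<^sup>+z\<in>A \<times> UNIV. cond_lik H n (fst z) (snd z) y \<partial>full_prior H) /
      (\<integral>\<^sup>+z. cond_lik H n (fst z) (snd z) y \<partial>full_prior H))"

text \<open>The measurability of the likelihood in all its arguments is what makes the posterior
  well defined.\<close>

locale hmm_setting =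
  fixes H :: "('a::euclidean_space, 'x::polish_space, 'y::polish_space) hmm"
  assumes sigma_finite_Ref: "sigma_finite_measure (Ref H)"
    and sets_Ref: "sets (Ref H) = sets borel"
    and kernel: "\<And>\<theta>. \<theta> \<in> Par H \<Longrightarrow> Ker H \<theta> \<in> borel \<rightarrow>\<^sub>M prob_algebra borel"
    and stat_prob: "\<And>\<theta>. \<theta> \<in> Par H \<Longrightarrow> Stat H \<theta> \<in> space (prob_algebra borel)"
    and stationary: "\<And>\<theta>. \<theta> \<in> Par H \<Longrightarrow> Stat H \<theta> \<bind> Ker H \<theta> = Stat H \<theta>"
    and emission_measurable:
      "\<And>\<theta>. \<theta> \<in> Par H \<Longrightarrow> (\<lambda>(x, y). Emi H \<theta> x y) \<in> borel_measurable (borel \<Otimes>\<^sub>M borel)"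
    and emission_nonneg: "\<And>\<theta> x y. \<theta> \<in> Par H \<Longrightarrow> 0 \<le> Emi H \<theta> x y"
    and emission_density: "\<And>\<theta> x. \<theta> \<in> Par H \<Longrightarrow> (\<integral>\<^sup>+y. ennreal (Emi H \<theta> x y) \<partial>Ref H) = 1"
    and Rho_ge_1: "\<And>\<theta>. \<theta> \<in> Par H \<Longrightarrow> 1 \<le> Rho H \<theta>"
    and Rad_bounds: "\<And>\<theta>. \<theta> \<in> Par H \<Longrightarrow> 0 < Rad H \<theta> \<and> Rad H \<theta> \<le> 2"
    and mixing: "\<And>\<theta> m x. \<theta> \<in> Par H \<Longrightarrow> 1 \<le> m \<Longrightarrow>
      tv_dist (kernel_pow (Ker H \<theta>) m x) (Stat H \<theta>) \<le> Rad H \<theta> / Rho H \<theta> ^ m"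
    and prior_prob: "prob_space (Prior H)"
    and sets_Prior: "sets (Prior H) = sets (restrict_space borel (Par H))"
    and init_prob: "prob_space (Init H)"
    and sets_Init: "sets (Init H) = sets borel"
    and likelihood_measurable:
      "\<And>n. (\<lambda>(\<theta>, x, y). cond_lik H n \<theta> x y)
        \<in> borel_measurable (Prior H \<Otimes>\<^sub>M borel \<Otimes>\<^sub>M PiM UNIV (\<lambda>_. borel))"

subsection \<open>Assumptions on prior and model\<close>

text \<open>Smallest number of centres in \<open>F\<close>, infinite if no finite set of centres suffices.\<close>

definition covering_number :: "('a \<Rightarrow> 'a \<Rightarrow> real) \<Rightarrow> real \<Rightarrow> 'a set \<Rightarrow> enat" where
  "covering_number d \<delta> F =
     Inf {enat (card T) | T. finite T \<and> T \<subseteq> F \<and> (\<forall>\<theta>\<in>F. \<exists>t\<in>T. d t \<theta> \<le> \<delta>)}"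

text \<open>In the conditions below \<open>r n\<close> stands for \<open>\<epsilon>\<close>-tilde, and sequences are indexed by \<open>n \<ge> 1\<close>.\<close>

definition cond_C1 ::
    "('a, 'x::polish_space, 'y::polish_space) hmm \<Rightarrow> 'a \<Rightarrow> 'x \<Rightarrow> (nat \<Rightarrow> ('a \<times> 'x) set) \<Rightarrow>
     (nat \<Rightarrow> real) \<Rightarrow> (nat \<Rightarrow> real) \<Rightarrow> bool" where
  "cond_C1 H \<theta>0 x0 S C r \<longleftrightarrow>
     (\<exists>A>0. \<forall>x x'. AE \<omega> in hmm_law H \<theta>0. \<forall>n.
        \<bar>cond_loglik H n \<theta>0 x (snd \<omega>) - cond_loglik H n \<theta>0 x' (snd \<omega>)\<bar> \<le> ereal A) \<and>
     (\<forall>n\<ge>1. S n \<in> sets (full_prior H)) \<and> (\<forall>n\<ge>1. 0 < C n) \<and> (\<forall>n\<ge>1. 0 < r n) \<and>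
     r \<longlonglongrightarrow> 0 \<and> filterlim (\<lambda>n. real n * (r n)\<^sup>2) at_top sequentially \<and>
     (\<lambda>n. SUP (\<theta>, x)\<in>S n. \<P>(\<omega> in hmm_law H \<theta>0.
        cond_loglik H n \<theta> x (snd \<omega>) - cond_loglik H n \<theta>0 x0 (snd \<omega>)
          \<le> ereal (- (real n * (r n)\<^sup>2)))) \<longlonglongrightarrow> 0 \<and>
     (\<exists>c>0. \<forall>n\<ge>1. measure (full_prior H) (S n) \<ge> c * exp (- (C n * real n * (r n)\<^sup>2)))"

definition cond_C2 ::
    "('a, 'x, 'y) hmm \<Rightarrow> (nat \<Rightarrow> 'a set) \<Rightarrow> (nat \<Rightarrow> real) \<Rightarrow> (nat \<Rightarrow> real) \<Rightarrow> bool" where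
  "cond_C2 H F C r \<longleftrightarrow>
     (\<forall>n\<ge>1. F n \<in> sets (Prior H)) \<and>
     (\<lambda>n. measure (Prior H) (Par H - F n)) \<in> o(\<lambda>n. exp (- (real n * (r n)\<^sup>2 * (1 + C n))))"

definition cond_C3 ::
    "('a, 'x, 'y) hmm \<Rightarrow> 'a \<Rightarrow> nat \<Rightarrow> (nat \<Rightarrow> 'a set) \<Rightarrow> (nat \<Rightarrow> real) \<Rightarrow> (nat \<Rightarrow> real) \<Rightarrow>
     (nat \<Rightarrow> real) \<Rightarrow> bool" where
  "cond_C3 H \<theta>0 l F C r \<epsilon> \<longleftrightarrow>
     (\<forall>n\<ge>1. r n \<le> \<epsilon> n) \<and> \<epsilon> \<longlonglongrightarrow> 0 \<and>
     (\<lambda>n. (real n * (r n)\<^sup>2 * (1 + C n)) / (real n * (\<epsilon> n)\<^sup>2)) \<longlonglongrightarrow> 0 \<and>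
     (\<forall>n\<ge>1. ereal_of_enat (covering_number (dens_dist H l) (\<epsilon> n / 12) (F n)) \<le>
        ereal (exp ((real n * (\<epsilon> n)\<^sup>2 * (Rho H \<theta>0 - 1)\<^sup>2) /
          (16 * real l * (2 * Rad H \<theta>0 + Rho H \<theta>0 - 1)\<^sup>2))))"

definition shell ::
    "('a, 'x, 'y) hmm \<Rightarrow> 'a \<Rightarrow> nat \<Rightarrow> (nat \<Rightarrow> 'a set) \<Rightarrow> nat \<Rightarrow> nat \<Rightarrow> real \<Rightarrow> 'a set" where
  "shell H \<theta>0 l F n m e = F n \<inter>
     {\<theta>. real m * e \<le> weighted_dist H l \<theta>0 \<theta> \<and> weighted_dist H l \<theta>0 \<theta> \<le> (real m + 1) * e}"

text \<open>The sum over \<open>m \<ge> 1\<close> is indexed by \<open>m = Suc k\<close>.\<close>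

definition cond_C3bis ::
    "('a, 'x, 'y) hmm \<Rightarrow> 'a \<Rightarrow> nat \<Rightarrow> (nat \<Rightarrow> ('a \<times> 'x) set) \<Rightarrow> (nat \<Rightarrow> 'a set) \<Rightarrow>
     (nat \<Rightarrow> real) \<Rightarrow> (nat \<Rightarrow> real) \<Rightarrow> bool" where
  "cond_C3bis H \<theta>0 l S F r \<epsilon> \<longleftrightarrow>
     (\<forall>n\<ge>1. r n \<le> \<epsilon> n) \<and> \<epsilon> \<longlonglongrightarrow> 0 \<and>
     (\<lambda>n. \<Sum>k. measure (Prior H) (shell H \<theta>0 l F n (Suc k) (\<epsilon> n)) / measure (full_prior H) (S n) *
        exp (- (real n * (real (Suc k))\<^sup>2 * (\<epsilon> n)\<^sup>2 / (32 * real l))))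
       \<in> o(\<lambda>n. exp (- (real n * (r n)\<^sup>2))) \<and>
     (\<forall>n\<ge>1. \<forall>m\<ge>1.
        ereal_of_enat (covering_number (dens_dist H l) (real m * \<epsilon> n / 12)
          (shell H \<theta>0 l F n m (\<epsilon> n))) \<le>
        ereal (exp ((real n * (real m)\<^sup>2 * (\<epsilon> n)\<^sup>2 * (Rho H \<theta>0 - 1)\<^sup>2) /
          (16 * real l * (2 * Rad H \<theta>0 + Rho H \<theta>0 - 1)\<^sup>2))))"

definition tendsto_0_in_prob :: "'b measure \<Rightarrow> (nat \<Rightarrow> 'b \<Rightarrow> real) \<Rightarrow> bool" where
  "tendsto_0_in_prob P Z \<longleftrightarrow> (\<forall>e>0. (\<lambda>n. \<P>(\<omega> in P. e < \<bar>Z n \<omega>\<bar>)) \<longlonglongrightarrow> 0)"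

end

theory Submission
  imports Defs
begin

text \<open>
  The posterior mass of a set is a ratio of two integrals of the likelihood. Divide both by the
  likelihood \<open>L\<close> of the true parameter \<open>\<theta>\<^sub>0\<close> started at the fixed point \<open>x\<^sub>0\<close>. Condition C1 keeps the
  denominator above \<open>\<Pi>(S\<^sub>n) exp(-n r\<^sub>n\<^sup>2) / 2\<close> with probability tending to 1: the set of pairs in \<open>S\<^sub>n\<close>
  whose likelihood ratio is smaller has small expected prior mass, so Markov's inequality applies
  (\<open>prob_denominator_small\<close>).

  For the numerator, the stationary density of the observations is a mixture of likelihoods over
  starting points, hence at most \<open>exp A * L\<close> by C1. So the \<open>\<theta>\<^sub>0\<close>-expectation of the likelihood
  ratio of \<open>(\<theta>, x)\<close> on an event of the first \<open>n\<close> observations is at most \<open>exp A\<close> times the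
  probability of that event for the model \<open>\<theta>\<close> started at \<open>x\<close> (\<open>nn_integral_ratio_le\<close>). It remains to
  find tests that rarely reject \<open>\<theta>\<^sub>0\<close> but reject every distant \<open>\<theta>\<close> from every starting point with
  overwhelming probability (\<open>separating_test\<close>).

  A test looks at the disjoint blocks of length \<open>l\<close> and counts how often a block falls where a
  centre of the covering has a larger \<open>l\<close>-block density than \<open>\<theta>\<^sub>0\<close>. These counts concentrate although
  the blocks are dependent (\<open>exp_block_sum_le\<close>): Hoeffding's lemma is applied one block at a time, and
  mixing bounds by \<open>R / (\<rho> - 1)\<close> the influence of the hidden state at the end of a block on the
  expected count over all later blocks. One step therefore ranges over an interval of length at
  most \<open>1 + R / (\<rho> - 1)\<close>, which is at most \<open>1 / \<kappa>\<close> for the weight \<open>\<kappa> = (\<rho> - 1) / (2 R + \<rho> - 1)\<close>. This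
  is why distances are weighted by \<open>\<kappa>\<close>: if \<open>\<kappa> d \<ge> s\<close>, the gap between the expected frequencies under
  \<open>\<theta>\<close> and under \<open>\<theta>\<^sub>0\<close>, measured in units of the range, is of order \<open>s\<close>.

  The first error has exponent \<open>n s\<^sup>2 \<kappa>\<^sub>0\<^sup>2 / (8 l)\<close>, twice the entropy allowed to the covering; the
  second one has exponent \<open>n s\<^sup>2 / (18 l)\<close>, which beats the rate \<open>n s\<^sup>2 / (32 l)\<close> of C3bis. Under C3
  one scale \<open>s = \<epsilon>\<^sub>n\<close> suffices; under C3bis there is one test for each shell, with \<open>s = m \<epsilon>\<^sub>n\<close>, and the
  first errors form a geometric series.

  The path laws are given by the Ionescu-Tulcea construction, which extends paths at their end.
  Likelihoods and the Markov property need the opposite decomposition, by the first step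
  (\<open>nn_integral_chain_first\<close> and \<open>nn_integral_law_first\<close>).
\<close>

section \<open>Markov chains decomposed by their first step\<close>

abbreviation seqs :: "(nat \<Rightarrow> 'b::topological_space) measure" where
  "seqs \<equiv> PiM UNIV (\<lambda>_. borel)"

definition depends_below :: "nat \<Rightarrow> ((nat \<Rightarrow> 'b) \<Rightarrow> 'c) \<Rightarrow> bool" where
  "depends_below n f \<longleftrightarrow> (\<forall>x y. (\<forall>i<n. x i = y i) \<longrightarrow> f x = f y)"

lemma depends_belowD: "depends_below n f \<Longrightarrow> (\<And>i. i < n \<Longrightarrow> x i = y i) \<Longrightarrow> f x = f y"
  unfolding depends_below_def by blast

text \<open>
  A point of a product over \<open>I\<close> is undefined off \<open>I\<close>, hence is itself a sequence. So functions of
  whole sequences can be integrated against finite products without restricting their argument.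
\<close>

lemma measurable_extensional_seq:
  "(\<lambda>x. x) \<in> PiM I (\<lambda>_::nat. borel :: 'b::topological_space measure) \<rightarrow>\<^sub>M seqs"
proof (rule measurable_PiM_single')
  fix i :: nat
  show "(\<lambda>x. x i) \<in> PiM I (\<lambda>_. borel :: 'b measure) \<rightarrow>\<^sub>M borel"
  proof (cases "i \<in> I")
    case False
    then have "x i = undefined" if "x \<in> space (PiM I (\<lambda>_. borel :: 'b measure))" for x
      using that by (simp add: space_PiM PiE_iff extensional_def)
    then show ?thesis
      by (rule measurable_cong[THEN iffD2, OF _ measurable_const]) simp_all
  qed (rule measurable_component_singleton)
qed simp

lemma measurable_case_nat_seq [measurable (raw)]:
  assumes f [measurable]: "f \<in> N \<rightarrow>\<^sub>M (borel :: 'b::topological_space measure)"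
    and g [measurable]: "g \<in> N \<rightarrow>\<^sub>M seqs"
  shows "(\<lambda>z. case_nat (f z) (g z)) \<in> N \<rightarrow>\<^sub>M seqs"
proof (rule measurable_PiM_single')
  fix i :: nat
  show "(\<lambda>z. case_nat (f z) (g z) i) \<in> N \<rightarrow>\<^sub>M borel"
    by (cases i) simp_all
qed simp

lemma measurable_upd_seq [measurable (raw)]:
  assumes f [measurable]: "f \<in> N \<rightarrow>\<^sub>M (borel :: 'b::topological_space measure)"
    and g [measurable]: "g \<in> N \<rightarrow>\<^sub>M seqs"
  shows "(\<lambda>z. (g z)(i := f z)) \<in> N \<rightarrow>\<^sub>M seqs"
proof (rule measurable_PiM_single')
  fix j :: nat
  show "(\<lambda>z. ((g z)(i := f z)) j) \<in> N \<rightarrow>\<^sub>M borel"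
    by (cases "j = i") simp_all
qed simp

text \<open>
  Rectangles over finitely many coordinates form a generator that is stable under intersection, and
  their indicators are cylinder functions.
\<close>

lemma measure_eqI_cylinder:
  assumes "finite_measure M" and setsM: "sets M = sets seqs" and setsN: "sets N = sets seqs"
    and eq: "\<And>n f. f \<in> borel_measurable seqs \<Longrightarrow> depends_below n f \<Longrightarrow>
       (\<integral>\<^sup>+x. f x \<partial>M) = (\<integral>\<^sup>+x. f x \<partial>N)"
  shows "M = (N :: (nat \<Rightarrow> 'b::topological_space) measure)"
proof (rule measure_eqI_PiM_infinite[OF setsM setsN _ \<open>finite_measure M\<close>])
  fix A J assume J: "finite J" "J \<subseteq> (UNIV :: nat set)"
    and A: "\<And>i. i \<in> J \<Longrightarrow> A i \<in> sets (borel :: 'b measure)"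
  let ?E = "prod_emb UNIV (\<lambda>_. borel) J (Pi\<^sub>E J A)"
  have E: "?E \<in> sets seqs"
    using J A by (intro measurable_prod_emb sets_PiM_I_finite) auto
  obtain n where n: "J \<subseteq> {..<n}"
    using J finite_nat_iff_bounded by auto
  have "?E = {x. \<forall>i\<in>J. x i \<in> A i}"
    by (auto simp: prod_emb_def PiE_iff)
  then have "depends_below n (indicator ?E :: _ \<Rightarrow> ennreal)"
    using n unfolding depends_below_def by (auto simp: indicator_def subset_eq)
  from eq[OF _ this] E show "emeasure M ?E = emeasure N ?E"
    by (simp add: setsM setsN)
qed

locale markov_kernel =
  fixes K :: "'x::polish_space \<Rightarrow> 'x measure"
  assumes K [measurable]: "K \<in> borel \<rightarrow>\<^sub>M prob_algebra borel"
begin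

abbreviation chain :: "'x measure \<Rightarrow> (nat \<Rightarrow> 'x) measure" where
  "chain m \<equiv> markov_chain_law m K"

lemma K_prob [simp]: "K x \<in> space (prob_algebra borel)"
  by (rule measurable_space[OF K]) simp

lemma K_sets [simp]: "sets (K x) = sets borel"
  using K_prob[of x] by (simp add: space_prob_algebra)

lemma K_subprob [measurable]: "K \<in> borel \<rightarrow>\<^sub>M subprob_algebra borel"
  by (rule measurable_prob_algebraD[OF K])

context
  fixes m :: "'x measure"
  assumes m: "m \<in> space (prob_algebra borel)"
begin

lemma m_prob: "prob_space m" and m_sets [simp]: "sets m = sets borel"
  using m by (auto simp: space_prob_algebra)

lemma chain_step_measurable:
  "chain_step m K i \<in> seqs \<rightarrow>\<^sub>M prob_algebra borel"
  unfolding chain_step_def using m by (cases "i = 0") auto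

lemma ionescu_tulcea: "Ionescu_Tulcea (chain_step m K) (\<lambda>_. borel)"
proof (rule Ionescu_Tulcea.intro)
  fix i x
  show "chain_step m K i \<in> PiM {0..<i} (\<lambda>_. borel) \<rightarrow>\<^sub>M subprob_algebra borel"
    using measurable_compose[OF measurable_extensional_seq chain_step_measurable]
    by (rule measurable_prob_algebraD)
  show "prob_space (chain_step m K i x)"
    using measurable_space[OF chain_step_measurable, of x i] by (simp add: space_prob_algebra space_PiM)
qed

interpretation IT: Ionescu_Tulcea "chain_step m K" "\<lambda>_. borel"
  by (rule ionescu_tulcea)

lemma sets_chain: "sets (chain m) = sets seqs"
  unfolding markov_chain_law_def by (rule IT.PF.sets_lim)

lemma nn_integral_chain_restrict:
  assumes f: "f \<in> borel_measurable (PiM {0..<n} (\<lambda>_. borel))"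
  shows "(\<integral>\<^sup>+x. f (restrict x {0..<n}) \<partial>chain m) = (\<integral>\<^sup>+x. f x \<partial>IT.C 0 n (\<lambda>_. undefined))"
proof -
  have up_to: "IT.up_to {0..<n} = n"
    using IT.up_to[of "{0..<n}"] IT.up_to_iff_Ico[of "{0..<n}" n] by (cases n) (auto simp: subset_eq)
  have "IT.CI {0..<n} = IT.C 0 n (\<lambda>_. undefined)"
    unfolding IT.CI_def up_to using IT.distr_C[of n n "\<lambda>_. undefined" 0] by simp
  then have "distr (chain m) (PiM {0..<n} (\<lambda>_. borel)) (\<lambda>x. restrict x {0..<n}) = IT.C 0 n (\<lambda>_. undefined)"
    unfolding markov_chain_law_def by (subst IT.distr_lim) auto
  then have "(\<integral>\<^sup>+x. f x \<partial>IT.C 0 n (\<lambda>_. undefined)) =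
      (\<integral>\<^sup>+x. f x \<partial>distr (chain m) (PiM {0..<n} (\<lambda>_. borel)) (\<lambda>x. restrict x {0..<n}))"
    by simp
  also have "\<dots> = (\<integral>\<^sup>+x. f (restrict x {0..<n}) \<partial>chain m)"
    using f by (intro nn_integral_distr) (simp_all add: measurable_cong_sets[OF sets_chain refl] measurable_restrict_subset)
  finally show ?thesis ..
qed

lemma prob_space_chain: "prob_space (chain m)"
proof
  have "(\<integral>\<^sup>+x. 1 \<partial>chain m) = (\<integral>\<^sup>+x. 1 \<partial>IT.C 0 0 (\<lambda>_. undefined))"
    using nn_integral_chain_restrict[of "\<lambda>_. 1" 0] by simp
  then show "emeasure (chain m) (space (chain m)) = 1"
    using prob_space.emeasure_space_1[OF IT.prob_space_C[of "\<lambda>_. undefined" 0 0]] by simp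
qed

text \<open>
  The construction of the chain adds one coordinate at a time, so the highest coordinate can be
  integrated out first.
\<close>

lemma nn_integral_chain_last:
  assumes f [measurable]: "f \<in> borel_measurable seqs" and dep: "depends_below (Suc n) f"
  shows "(\<integral>\<^sup>+x. f x \<partial>chain m) = (\<integral>\<^sup>+x. \<integral>\<^sup>+z. f (x(n := z)) \<partial>chain_step m K n x \<partial>chain m)"
proof -
  let ?P = "\<lambda>n. PiM {0..<n} (\<lambda>_::nat. borel :: 'x measure)"
  have f': "f \<in> borel_measurable (?P k)" for k
    by (rule measurable_compose[OF measurable_extensional_seq f])
  define h where "h x = (\<integral>\<^sup>+z. f (x(n := z)) \<partial>chain_step m K n x)" for x
  have "h \<in> borel_measurable seqs"
    unfolding h_def
    by (rule nn_integral_measurable_subprob_algebra2[OF _ measurable_prob_algebraD[OF chain_step_measurable]])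
      measurable
  then have h_meas: "h \<in> borel_measurable (?P n)"
    by (rule measurable_compose[OF measurable_extensional_seq])
  have "(\<integral>\<^sup>+x. f x \<partial>chain m) = (\<integral>\<^sup>+x. f (restrict x {0..<Suc n}) \<partial>chain m)"
    by (intro nn_integral_cong depends_belowD[OF dep]) simp
  also have "\<dots> = (\<integral>\<^sup>+x. f x \<partial>IT.C 0 (Suc n) (\<lambda>_. undefined))"
    by (rule nn_integral_chain_restrict[OF f'])
  also have "\<dots> = (\<integral>\<^sup>+x. \<integral>\<^sup>+z. f z \<partial>IT.eP n x \<partial>IT.C 0 n (\<lambda>_. undefined))"
  proof -
    have "IT.eP n \<in> IT.C 0 n (\<lambda>_. undefined) \<rightarrow>\<^sub>M subprob_algebra (?P (Suc n))"
      using IT.measurable_eP[of n] by (simp add: measurable_cong_sets[OF IT.sets_C refl])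
    from nn_integral_bind[OF f' this] show ?thesis
      by simp
  qed
  also have "\<dots> = (\<integral>\<^sup>+x. h x \<partial>IT.C 0 n (\<lambda>_. undefined))"
    unfolding h_def using f'[of "Suc n"]
    by (intro nn_integral_cong IT.nn_integral_eP) (simp_all add: IT.space_C)
  also have "\<dots> = (\<integral>\<^sup>+x. h (restrict x {0..<n}) \<partial>chain m)"
    by (rule nn_integral_chain_restrict[OF h_meas, symmetric])
  also have "\<dots> = (\<integral>\<^sup>+x. h x \<partial>chain m)"
  proof (rule nn_integral_cong)
    fix x
    have "chain_step m K n (restrict x {0..<n}) = chain_step m K n x"
      by (simp add: chain_step_def)
    moreover have "f ((restrict x {0..<n})(n := z)) = f (x(n := z))" for z
      by (rule depends_belowD[OF dep]) auto
    ultimately show "h (restrict x {0..<n}) = h x"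
      by (simp add: h_def)
  qed
  finally show ?thesis
    by (simp add: h_def)
qed

end

lemma depends_below_chain_step:
  assumes "depends_below (Suc n) f"
  shows "depends_below n (\<lambda>x. \<integral>\<^sup>+z. f (x(n := z)) \<partial>chain_step m K n x)"
  unfolding depends_below_def
proof safe
  fix x y :: "nat \<Rightarrow> 'x" assume xy: "\<forall>i<n. x i = y i"
  then have "chain_step m K n x = chain_step m K n y"
    by (simp add: chain_step_def)
  moreover have "f (x(n := z)) = f (y(n := z))" for z
    using xy by (intro depends_belowD[OF assms]) (auto simp: less_Suc_eq)
  ultimately show "(\<integral>\<^sup>+z. f (x(n := z)) \<partial>chain_step m K n x) = (\<integral>\<^sup>+z. f (y(n := z)) \<partial>chain_step m K n y)"
    by simp
qed

text \<open>
  Induction on the number of coordinates. The integrand is allowed to depend on the initial law since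
  integrating out coordinate 0 produces such an integrand.
\<close>

lemma measurable_nn_integral_chain_cylinder:
  assumes f: "case_prod f \<in> borel_measurable (prob_algebra borel \<Otimes>\<^sub>M seqs)"
    and dep: "\<And>m. depends_below n (f m)"
  shows "(\<lambda>m. \<integral>\<^sup>+x. f m x \<partial>chain m) \<in> borel_measurable (prob_algebra borel)"
  using f dep
proof (induction n arbitrary: f)
  case 0
  have "(\<integral>\<^sup>+x. f m x \<partial>chain m) = f m undefined" if m: "m \<in> space (prob_algebra borel)" for m
  proof -
    interpret prob_space "chain m" by (rule prob_space_chain[OF m])
    have "(\<integral>\<^sup>+x. f m x \<partial>chain m) = (\<integral>\<^sup>+x. f m undefined \<partial>chain m)"
      by (intro nn_integral_cong depends_belowD[OF 0(2)]) simp
    then show ?thesis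
      by (simp add: emeasure_space_1)
  qed
  moreover have "(\<lambda>m. f m undefined) \<in> borel_measurable (prob_algebra borel)"
    using measurable_compose[OF _ 0(1), of "\<lambda>m. (m, undefined)"] by (simp add: space_PiM)
  ultimately show ?case
    by (subst measurable_cong[where g="\<lambda>m. f m undefined"]) simp_all
next
  case (Suc n)
  note [measurable] = Suc.prems(1)
  let ?f = "\<lambda>m x. \<integral>\<^sup>+z. f m (x(n := z)) \<partial>chain_step m K n x"
  have step: "(\<lambda>(m, x). chain_step m K n x) \<in> prob_algebra borel \<Otimes>\<^sub>M seqs \<rightarrow>\<^sub>M subprob_algebra borel"
    unfolding chain_step_def case_prod_beta
    by (rule measurable_prob_algebraD) (cases "n = 0"; simp)
  have "case_prod ?f \<in> borel_measurable (prob_algebra borel \<Otimes>\<^sub>M seqs)"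
    unfolding case_prod_beta
    by (rule nn_integral_measurable_subprob_algebra2[OF _ step[unfolded case_prod_beta]]) measurable
  then have "(\<lambda>m. \<integral>\<^sup>+x. ?f m x \<partial>chain m) \<in> borel_measurable (prob_algebra borel)"
    by (rule Suc.IH) (rule depends_below_chain_step[OF Suc.prems(2)])
  moreover have "(\<integral>\<^sup>+x. f m x \<partial>chain m) = (\<integral>\<^sup>+x. ?f m x \<partial>chain m)"
    if m: "m \<in> space (prob_algebra borel)" for m
  proof (rule nn_integral_chain_last[OF m _ Suc.prems(2)])
    show "f m \<in> borel_measurable seqs"
      using measurable_compose[OF measurable_Pair1'[OF m] Suc.prems(1)] by simp
  qed
  ultimately show ?case
    by (subst measurable_cong[where g="\<lambda>m. \<integral>\<^sup>+x. ?f m x \<partial>chain m"]) simp_all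
qed

lemma measurable_chain [measurable]: "chain \<in> prob_algebra borel \<rightarrow>\<^sub>M prob_algebra seqs"
proof (rule measurable_prob_algebra_generated[OF sets_PiM Int_stable_prod_algebra prod_algebra_sets_into_space])
  fix m :: "'x measure" assume m: "m \<in> space (prob_algebra borel)"
  show "prob_space (chain m)" "sets (chain m) = sets seqs"
    by (rule prob_space_chain[OF m] sets_chain[OF m])+
next
  fix A :: "(nat \<Rightarrow> 'x) set" assume "A \<in> prod_algebra UNIV (\<lambda>_. borel)"
  then obtain J E where A: "A = prod_emb UNIV (\<lambda>_. borel) J (Pi\<^sub>E J E)" "finite J"
      "\<And>i. i \<in> J \<Longrightarrow> E i \<in> sets borel"
    by (rule prod_algebraE) auto
  have A_sets [measurable]: "A \<in> sets seqs"
    unfolding A(1) using A(2,3) by (intro measurable_prod_emb sets_PiM_I_finite) auto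
  obtain n where n: "J \<subseteq> {..<n}"
    using A(2) finite_nat_iff_bounded by auto
  have "A = {x. \<forall>i\<in>J. x i \<in> E i}"
    by (auto simp: A(1) prod_emb_def PiE_iff)
  then have "depends_below n (indicator A :: _ \<Rightarrow> ennreal)"
    using n unfolding depends_below_def by (auto simp: indicator_def subset_eq)
  then have "(\<lambda>m. \<integral>\<^sup>+x. indicator A x \<partial>chain m) \<in> borel_measurable (prob_algebra borel)"
    by (intro measurable_nn_integral_chain_cylinder[where n=n]) measurable
  then show "(\<lambda>m. emeasure (chain m) A) \<in> borel_measurable (prob_algebra borel)"
    by (rule measurable_cong[THEN iffD1, rotated]) (simp add: sets_chain)
qed

lemma depends_below_case_nat:
  assumes "depends_below (Suc n) f"
  shows "depends_below n (\<lambda>x. f (case_nat z x))"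
  using assms unfolding depends_below_def by (auto split: nat.split)

text \<open>
  Integrating out the last coordinate commutes with splitting off the first one, which reduces the
  claim to one coordinate less. When only coordinate 0 is left, it is both first and last and is
  drawn from the initial law instead of the kernel.
\<close>

lemma nn_integral_chain_first_cylinder:
  assumes f: "f \<in> borel_measurable seqs" and dep: "depends_below n f"
    and m: "m \<in> space (prob_algebra borel)"
  shows "(\<integral>\<^sup>+x. f x \<partial>chain m) = (\<integral>\<^sup>+z. \<integral>\<^sup>+x. f (case_nat z x) \<partial>chain (K z) \<partial>m)"
  using f dep
proof (induction n arbitrary: f)
  case 0
  interpret m: prob_space m by (rule m_prob[OF m])
  have "f = (\<lambda>_. f undefined)"
    by (intro ext depends_belowD[OF 0(2)]) simp
  then obtain c where f: "f = (\<lambda>_. c)"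
    by blast
  have "emeasure (chain (K z)) (space (chain (K z))) = 1" "emeasure (chain m) (space (chain m)) = 1" for z
    using prob_space_chain[OF K_prob] prob_space_chain[OF m] by (auto dest: prob_space.emeasure_space_1)
  then show ?case
    by (simp add: f m.emeasure_space_1)
next
  case (Suc n)
  note f [measurable] = Suc.prems(1)
  note step = measurable_prob_algebraD[OF chain_step_measurable[OF m]]
  let ?f = "\<lambda>x. \<integral>\<^sup>+w. f (x(n := w)) \<partial>chain_step m K n x"
  have f': "?f \<in> borel_measurable seqs"
    by (rule nn_integral_measurable_subprob_algebra2[OF _ step]) measurable
  have upd: "f ((case_nat z x)(Suc n := w)) = f (case_nat z (x(n := w)))" for z x w n
    by (rule arg_cong[where f=f]) (auto split: nat.split)
  have "(\<integral>\<^sup>+x. f x \<partial>chain m) = (\<integral>\<^sup>+x. ?f x \<partial>chain m)"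
    by (rule nn_integral_chain_last[OF m f Suc.prems(2)])
  also have "\<dots> = (\<integral>\<^sup>+z. \<integral>\<^sup>+x. ?f (case_nat z x) \<partial>chain (K z) \<partial>m)"
    by (rule Suc.IH[OF f' depends_below_chain_step[OF Suc.prems(2)]])
  also have "\<dots> = (\<integral>\<^sup>+z. \<integral>\<^sup>+x. f (case_nat z x) \<partial>chain (K z) \<partial>m)"
  proof (cases n)
    case 0
    have *: "f (case_nat z x) = f (\<lambda>_. z)" for z x
      using Suc.prems(2) by (rule depends_belowD) (simp add: 0)
    have **: "f ((case_nat z x)(0 := w)) = f (\<lambda>_. w)" for z x w
      using Suc.prems(2) by (rule depends_belowD) (simp add: 0)
    have "emeasure (chain (K z)) (space (chain (K z))) = 1" for z
      using prob_space_chain[OF K_prob] by (auto dest: prob_space.emeasure_space_1)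
    then show ?thesis
      using m_prob[OF m] by (simp add: 0 * ** chain_step_def prob_space.emeasure_space_1)
  next
    case (Suc p)
    show ?thesis
    proof (rule nn_integral_cong)
      fix z
      have "f \<circ> case_nat z \<in> borel_measurable seqs"
        unfolding comp_def by measurable
      then have "(\<integral>\<^sup>+x. f (case_nat z x) \<partial>chain (K z)) =
          (\<integral>\<^sup>+x. \<integral>\<^sup>+w. f (case_nat z (x(p := w))) \<partial>chain_step (K z) K p x \<partial>chain (K z))"
        using nn_integral_chain_last[OF K_prob, of "f \<circ> case_nat z" p z]
          depends_below_case_nat[OF Suc.prems(2)[unfolded Suc]]
        by (simp add: comp_def)
      moreover have "chain_step m K n (case_nat z x) = chain_step (K z) K p x" for x
        by (cases p) (simp_all add: chain_step_def Suc)
      ultimately show "(\<integral>\<^sup>+x. ?f (case_nat z x) \<partial>chain (K z)) = (\<integral>\<^sup>+x. f (case_nat z x) \<partial>chain (K z))"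
        by (simp add: Suc upd)
    qed
  qed
  finally show ?case .
qed

lemma measurable_chain_kernel [measurable (raw)]:
  "f \<in> N \<rightarrow>\<^sub>M borel \<Longrightarrow> (\<lambda>z. chain (K (f z))) \<in> N \<rightarrow>\<^sub>M subprob_algebra seqs"
  by (rule measurable_prob_algebraD[OF measurable_compose[OF measurable_compose[OF _ K] measurable_chain]])

text \<open>
  The right-hand side is the integral against the law obtained by drawing the first state and
  prepending it to a chain started one step later. This law agrees with that of the chain on
  cylinder functions.
\<close>

theorem nn_integral_chain_first:
  assumes m: "m \<in> space (prob_algebra borel)" and f [measurable]: "f \<in> borel_measurable seqs"
  shows "(\<integral>\<^sup>+x. f x \<partial>chain m) = (\<integral>\<^sup>+z. \<integral>\<^sup>+x. f (case_nat z x) \<partial>chain (K z) \<partial>m)"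
proof -
  interpret m: prob_space m by (rule m_prob[OF m])
  note m_sets[OF m, simp, measurable_cong]
  define N where "N = m \<bind> (\<lambda>z. distr (chain (K z)) seqs (case_nat z))"
  have D: "(\<lambda>z. distr (chain (K z)) seqs (case_nat z)) \<in> m \<rightarrow>\<^sub>M subprob_algebra seqs"
    by (rule measurable_distr2[where M=seqs]) measurable
  have N: "(\<integral>\<^sup>+x. g x \<partial>N) = (\<integral>\<^sup>+z. \<integral>\<^sup>+x. g (case_nat z x) \<partial>chain (K z) \<partial>m)"
    if g [measurable]: "g \<in> borel_measurable seqs" for g
    unfolding N_def by (subst nn_integral_bind[OF g D], intro nn_integral_cong nn_integral_distr)
      (simp_all add: measurable_cong_sets[OF sets_chain[OF K_prob] refl])
  have "chain m = N"
  proof (rule measure_eqI_cylinder)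
    show "finite_measure (chain m)"
      using prob_space_chain[OF m] by (rule prob_space.finite_measure)
    show "sets N = sets seqs"
      unfolding N_def by (rule sets_bind[OF sets_kernel[OF D] m.not_empty])
  qed (simp_all add: sets_chain[OF m] N nn_integral_chain_first_cylinder[OF _ _ m])
  then show ?thesis
    using N[OF f] by simp
qed

end

section \<open>Hidden Markov models with an arbitrary initial law\<close>

lemma in_space_seqs [simp, measurable]: "x \<in> space seqs"
  by (simp add: space_PiM)

text \<open>
  The factors need not be equal: the emission laws along a hidden path differ from one another.
\<close>

lemma PiM_case_nat:
  fixes M :: "nat \<Rightarrow> 'b::topological_space measure"
  assumes M: "\<And>i. M i \<in> space (prob_algebra borel)"
  shows "PiM UNIV M = distr (M 0 \<Otimes>\<^sub>M PiM UNIV (\<lambda>i. M (Suc i))) seqs (\<lambda>(b, y). case_nat b y)"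
    (is "_ = distr ?P _ _")
proof (rule measure_eqI_PiM_infinite)
  have prob: "prob_space (M i)" and sets: "sets (M i) = sets borel" for i
    using M[of i] by (auto simp: space_prob_algebra)
  have space: "space (M i) = UNIV" for i
    using sets_eq_imp_space_eq[OF sets, of i] by simp
  note sets[measurable_cong, simp]
  have sets_PiM': "sets (PiM UNIV (\<lambda>i. M (f i))) = sets seqs" for f
    by (rule sets_PiM_cong) simp_all
  note sets_PiM'[measurable_cong]
  show "sets (PiM UNIV M) = sets seqs"
    using sets_PiM'[of "\<lambda>i. i"] .
  show "sets (distr ?P seqs (\<lambda>(b, y). case_nat b y)) = sets seqs"
    by simp
  show "finite_measure (PiM UNIV M)"
    using prob_space_PiM[of UNIV M] prob by (intro prob_space.finite_measure) auto
  interpret M0: prob_space "M 0" by (rule prob)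
  interpret S: prob_space "PiM UNIV (\<lambda>i. M (Suc i))"
    by (rule prob_space_PiM) (rule prob)
  fix A J assume J: "finite J" "J \<subseteq> (UNIV :: nat set)" and A: "\<And>i. i \<in> J \<Longrightarrow> A i \<in> sets (borel :: 'b measure)"
  define B where "B i = (if i \<in> J then A i else UNIV)" for i
  have B: "B i \<in> sets borel" for i
    using A by (simp add: B_def)
  obtain n where n: "J \<subseteq> {..<n}"
    using J finite_nat_iff_bounded by auto
  have cyl: "prod_emb UNIV N I (Pi\<^sub>E I C) = {x. \<forall>i\<in>I. x i \<in> C i}"
    if "\<And>i. space (N i) = UNIV" for I C and N :: "nat \<Rightarrow> 'b measure"
    using that by (auto simp: prod_emb_def PiE_iff)
  have E: "prod_emb UNIV (\<lambda>_. borel) J (Pi\<^sub>E J A) = {x. \<forall>i\<in>{..<Suc n}. x i \<in> B i}"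
    using n by (subst cyl) (auto simp: B_def subset_eq less_Suc_eq)
  have "emeasure (PiM UNIV M) {x. \<forall>i\<in>{..<Suc n}. x i \<in> B i} = (\<Prod>i<Suc n. emeasure (M i) (B i))"
  proof -
    have "emeasure (PiM UNIV M) (prod_emb UNIV M {..<Suc n} (Pi\<^sub>E {..<Suc n} B)) =
        (\<Prod>i<Suc n. emeasure (M i) (B i))"
      by (rule emeasure_PiM_emb) (simp_all add: prob B)
    then show ?thesis
      by (simp only: cyl[of M, OF space])
  qed
  also have "\<dots> = emeasure (M 0) (B 0) * (\<Prod>i<n. emeasure (M (Suc i)) (B (Suc i)))"
    by (rule prod.lessThan_Suc_shift)
  also have "(\<Prod>i<n. emeasure (M (Suc i)) (B (Suc i))) =
      emeasure (PiM UNIV (\<lambda>i. M (Suc i))) {y. \<forall>i\<in>{..<n}. y i \<in> B (Suc i)}"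
  proof -
    have "emeasure (PiM UNIV (\<lambda>i. M (Suc i))) (prod_emb UNIV (\<lambda>i. M (Suc i)) {..<n} (Pi\<^sub>E {..<n} (\<lambda>i. B (Suc i)))) =
        (\<Prod>i<n. emeasure (M (Suc i)) (B (Suc i)))"
      by (rule emeasure_PiM_emb) (simp_all add: prob B)
    then show ?thesis
      by (simp only: cyl[of "\<lambda>i. M (Suc i)", OF space])
  qed
  also have "emeasure (M 0) (B 0) * \<dots> = emeasure ?P (B 0 \<times> {y. \<forall>i\<in>{..<n}. y i \<in> B (Suc i)})"
  proof (rule S.emeasure_pair_measure_Times[symmetric])
    have "prod_emb UNIV (\<lambda>_. borel) {..<n} (Pi\<^sub>E {..<n} (\<lambda>i. B (Suc i))) \<in> sets (seqs :: (nat \<Rightarrow> 'b) measure)"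
      using B by (intro measurable_prod_emb sets_PiM_I_finite) auto
    then show "{y. \<forall>i\<in>{..<n}. y i \<in> B (Suc i)} \<in> sets (PiM UNIV (\<lambda>i. M (Suc i)))"
      by (subst (asm) cyl) (simp_all add: sets_PiM')
  qed (simp add: B)
  also have "B 0 \<times> {y. \<forall>i\<in>{..<n}. y i \<in> B (Suc i)} =
      (\<lambda>(b, y). case_nat b y) -` {x. \<forall>i\<in>{..<Suc n}. x i \<in> B i} \<inter> space ?P"
    by (auto simp: space_pair_measure space_PiM space lessThan_Suc_eq_insert_0)
  also have "emeasure ?P \<dots> = emeasure (distr ?P seqs (\<lambda>(b, y). case_nat b y)) {x. \<forall>i\<in>{..<Suc n}. x i \<in> B i}"
  proof (rule emeasure_distr[symmetric])
    show "{x. \<forall>i\<in>{..<Suc n}. x i \<in> B i} \<in> sets seqs"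
      unfolding E[symmetric] using J A by (intro measurable_prod_emb sets_PiM_I_finite) auto
  qed measurable
  finally show "emeasure (PiM UNIV M) (prod_emb UNIV (\<lambda>_. borel) J (Pi\<^sub>E J A)) =
      emeasure (distr ?P seqs (\<lambda>(b, y). case_nat b y)) (prod_emb UNIV (\<lambda>_. borel) J (Pi\<^sub>E J A))"
    unfolding E .
qed

locale hidden_markov = markov_kernel K
  for K :: "'x::polish_space \<Rightarrow> 'x measure" +
  fixes \<nu> :: "'y::polish_space measure" and g :: "'x \<Rightarrow> 'y \<Rightarrow> real"
  assumes sigma_finite_\<nu>: "sigma_finite_measure \<nu>"
    and sets_\<nu> [simp, measurable_cong]: "sets \<nu> = sets borel"
    and g [measurable]: "(\<lambda>(x, y). g x y) \<in> borel_measurable (borel \<Otimes>\<^sub>M borel)"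
    and g_density: "\<And>x. (\<integral>\<^sup>+y. ennreal (g x y) \<partial>\<nu>) = 1"
begin

sublocale \<nu>: sigma_finite_measure \<nu>
  by (rule sigma_finite_\<nu>)

definition emit :: "'x \<Rightarrow> 'y measure" where
  "emit x = density \<nu> (\<lambda>y. ennreal (g x y))"

lemma space_\<nu> [simp]: "space \<nu> = UNIV"
  using sets_eq_imp_space_eq[OF sets_\<nu>] by simp

lemma nn_integral_emit:
  "f \<in> borel_measurable borel \<Longrightarrow> (\<integral>\<^sup>+y. f y \<partial>emit x) = (\<integral>\<^sup>+y. ennreal (g x y) * f y \<partial>\<nu>)"
  unfolding emit_def by (rule nn_integral_density) measurable

lemma emit_measurable [measurable]: "emit \<in> borel \<rightarrow>\<^sub>M prob_algebra borel"
proof (rule measurable_prob_algebra_generated[where \<Omega>=UNIV and G="sets borel"])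
  show "sets borel = sigma_sets UNIV (sets (borel :: 'y measure))"
    using sets.sigma_sets_eq[of "borel :: 'y measure"] by simp
  show "Int_stable (sets (borel :: 'y measure))"
    by (rule sets.Int_stable)
  show "prob_space (emit x)" for x
    by (rule prob_spaceI) (simp add: emit_def emeasure_density g_density)
  show "sets (emit x) = sets borel" for x
    by (simp add: emit_def)
  show "(\<lambda>x. emeasure (emit x) A) \<in> borel_measurable borel" if [measurable]: "A \<in> sets borel" for A
    unfolding emit_def by (subst emeasure_density) measurable
qed simp

lemma emit_prob: "emit x \<in> space (prob_algebra borel)"
  by (rule measurable_space[OF emit_measurable]) simp

lemma sets_emit [simp, measurable_cong]: "sets (emit x) = sets borel"
  by (simp add: emit_def)

lemma prob_space_emit: "prob_space (emit x)"
  using emit_prob by (simp add: space_prob_algebra)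

definition emit_seq :: "(nat \<Rightarrow> 'x) \<Rightarrow> (nat \<Rightarrow> 'y) measure" where
  "emit_seq x = PiM UNIV (\<lambda>j. emit (x j))"

lemma sets_emit_seq [simp, measurable_cong]: "sets (emit_seq x) = sets seqs"
  unfolding emit_seq_def by (rule sets_PiM_cong) simp_all

lemma prob_space_emit_seq: "prob_space (emit_seq x)"
  unfolding emit_seq_def by (rule prob_space_PiM) (rule prob_space_emit)

lemma emit_seq_measurable [measurable]: "emit_seq \<in> seqs \<rightarrow>\<^sub>M prob_algebra seqs"
proof (rule measurable_prob_algebra_generated[OF sets_PiM Int_stable_prod_algebra prod_algebra_sets_into_space])
  fix A :: "(nat \<Rightarrow> 'y) set" assume "A \<in> prod_algebra UNIV (\<lambda>_. borel)"
  then obtain J E where A: "A = prod_emb UNIV (\<lambda>_. borel) J (Pi\<^sub>E J E)" "finite J"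
      "\<And>i. i \<in> J \<Longrightarrow> E i \<in> sets borel"
    by (rule prod_algebraE) auto
  have "A = prod_emb UNIV (\<lambda>j. emit (x j)) J (Pi\<^sub>E J E)" for x
    unfolding A(1) prod_emb_def by (simp add: sets_eq_imp_space_eq[OF sets_emit])
  moreover have "emeasure (emit_seq x) (prod_emb UNIV (\<lambda>j. emit (x j)) J (Pi\<^sub>E J E)) =
      (\<Prod>i\<in>J. emeasure (emit (x i)) (E i))" for x
    unfolding emit_seq_def by (rule emeasure_PiM_emb) (use A(2,3) in \<open>simp_all add: prob_space_emit\<close>)
  ultimately have "emeasure (emit_seq x) A = (\<Prod>i\<in>J. emeasure (emit (x i)) (E i))" for x
    by metis
  moreover have "(\<lambda>x. \<Prod>i\<in>J. emeasure (emit (x i)) (E i)) \<in> borel_measurable seqs"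
  proof (rule borel_measurable_prod_ennreal)
    fix i assume "i \<in> J"
    show "(\<lambda>x. emeasure (emit (x i)) (E i)) \<in> borel_measurable seqs"
      using measurable_emeasure_kernel[OF measurable_prob_algebraD[OF emit_measurable] A(3)[OF \<open>i \<in> J\<close>]]
      by measurable
  qed
  ultimately show "(\<lambda>x. emeasure (emit_seq x) A) \<in> borel_measurable seqs"
    by simp
qed (simp_all add: prob_space_emit_seq)

lemma emit_seq_case_nat:
  "emit_seq (case_nat a x) = distr (emit a \<Otimes>\<^sub>M emit_seq x) seqs (\<lambda>(b, y). case_nat b y)"
  unfolding emit_seq_def using PiM_case_nat[of "\<lambda>j. emit (case_nat a x j)"] emit_prob by simp

lemma nn_integral_emit_seq_case_nat:
  assumes [measurable]: "f \<in> borel_measurable seqs"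
  shows "(\<integral>\<^sup>+y. f y \<partial>emit_seq (case_nat a x)) = (\<integral>\<^sup>+b. \<integral>\<^sup>+y. f (case_nat b y) \<partial>emit_seq x \<partial>emit a)"
proof -
  interpret S: prob_space "emit_seq x" by (rule prob_space_emit_seq)
  show ?thesis
    unfolding emit_seq_case_nat
    by (simp add: nn_integral_distr S.nn_integral_fst[symmetric])
qed

abbreviation paths :: "((nat \<Rightarrow> 'x) \<times> (nat \<Rightarrow> 'y)) measure" where
  "paths \<equiv> seqs \<Otimes>\<^sub>M seqs"

definition law :: "'x measure \<Rightarrow> ((nat \<Rightarrow> 'x) \<times> (nat \<Rightarrow> 'y)) measure" where
  "law m = chain m \<bind> (\<lambda>x. distr (emit_seq x) paths (\<lambda>y. (x, y)))"

lemma attach_measurable [measurable]: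
  "(\<lambda>x. distr (emit_seq x) paths (\<lambda>y. (x, y))) \<in> seqs \<rightarrow>\<^sub>M prob_algebra paths"
  by measurable

lemma law_measurable [measurable]: "law \<in> prob_algebra borel \<rightarrow>\<^sub>M prob_algebra paths"
  unfolding law_def[abs_def] by (rule measurable_bind_prob_space[OF measurable_chain attach_measurable])

lemma law_in_prob_algebra: "m \<in> space (prob_algebra borel) \<Longrightarrow> law m \<in> space (prob_algebra paths)"
  by (rule measurable_space[OF law_measurable])

lemma prob_space_law:
  assumes "m \<in> space (prob_algebra borel)"
  shows "prob_space (law m)"
  using law_in_prob_algebra[OF assms] unfolding space_prob_algebra by blast

lemma sets_law:
  assumes "m \<in> space (prob_algebra borel)"
  shows "sets (law m) = sets paths"
  using law_in_prob_algebra[OF assms] unfolding space_prob_algebra by blast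

lemma nn_integral_law:
  assumes m: "m \<in> space (prob_algebra borel)" and f [measurable]: "f \<in> borel_measurable paths"
  shows "(\<integral>\<^sup>+\<omega>. f \<omega> \<partial>law m) = (\<integral>\<^sup>+x. \<integral>\<^sup>+y. f (x, y) \<partial>emit_seq x \<partial>chain m)"
proof -
  have "(\<lambda>x. distr (emit_seq x) paths (\<lambda>y. (x, y))) \<in> chain m \<rightarrow>\<^sub>M subprob_algebra paths"
    using measurable_prob_algebraD[OF attach_measurable]
    by (simp add: measurable_cong_sets[OF sets_chain[OF m] refl])
  then have "(\<integral>\<^sup>+\<omega>. f \<omega> \<partial>law m) =
      (\<integral>\<^sup>+x. \<integral>\<^sup>+\<omega>. f \<omega> \<partial>distr (emit_seq x) paths (\<lambda>y. (x, y)) \<partial>chain m)"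
    unfolding law_def by (rule nn_integral_bind[OF f])
  also have "\<dots> = (\<integral>\<^sup>+x. \<integral>\<^sup>+y. f (x, y) \<partial>emit_seq x \<partial>chain m)"
  proof (rule nn_integral_cong, rule nn_integral_distr)
    fix x
    show "(\<lambda>y. (x, y)) \<in> emit_seq x \<rightarrow>\<^sub>M paths"
      by (simp add: measurable_cong_sets[OF sets_emit_seq refl])
  qed (simp add: f)
  finally show ?thesis .
qed

text \<open>
  Split the hidden chain at its first step and the observations at the first factor of their
  product law; Tonelli's theorem then draws the first observation before the rest of the chain. All
  later facts about the model rest on this identity.
\<close>

theorem nn_integral_law_first:
  assumes m: "m \<in> space (prob_algebra borel)" and f [measurable]: "f \<in> borel_measurable paths"
  shows "(\<integral>\<^sup>+\<omega>. f \<omega> \<partial>law m) =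
    (\<integral>\<^sup>+z. \<integral>\<^sup>+b. ennreal (g z b) * (\<integral>\<^sup>+\<omega>. f (case_nat z (fst \<omega>), case_nat b (snd \<omega>)) \<partial>law (K z)) \<partial>\<nu> \<partial>m)"
proof -
  have es: "emit_seq \<in> seqs \<rightarrow>\<^sub>M subprob_algebra seqs"
    by (rule measurable_prob_algebraD) measurable
  have F: "(\<lambda>x. \<integral>\<^sup>+y. f (x, y) \<partial>emit_seq x) \<in> borel_measurable seqs"
    by (rule nn_integral_measurable_subprob_algebra2[OF _ es]) measurable
  have "(\<integral>\<^sup>+\<omega>. f \<omega> \<partial>law m) = (\<integral>\<^sup>+x. \<integral>\<^sup>+y. f (x, y) \<partial>emit_seq x \<partial>chain m)"
    by (rule nn_integral_law[OF m f])
  also have "\<dots> = (\<integral>\<^sup>+z. \<integral>\<^sup>+x. \<integral>\<^sup>+y. f (case_nat z x, y) \<partial>emit_seq (case_nat z x) \<partial>chain (K z) \<partial>m)"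
    by (rule nn_integral_chain_first[OF m F])
  also have "\<dots> = (\<integral>\<^sup>+z. \<integral>\<^sup>+b. ennreal (g z b) * (\<integral>\<^sup>+\<omega>. f (case_nat z (fst \<omega>), case_nat b (snd \<omega>)) \<partial>law (K z)) \<partial>\<nu> \<partial>m)"
  proof (rule nn_integral_cong)
    fix z
    note sets_chain[OF K_prob, measurable_cong, simp]
    interpret C: prob_space "chain (K z)" by (rule prob_space_chain[OF K_prob])
    interpret E: prob_space "emit z" by (rule prob_space_emit)
    interpret EC: pair_sigma_finite "emit z" "chain (K z)" ..
    have es': "(\<lambda>p. emit_seq (snd p)) \<in> emit z \<Otimes>\<^sub>M chain (K z) \<rightarrow>\<^sub>M subprob_algebra seqs"
      using measurable_compose[OF measurable_snd es] by (simp cong: measurable_cong_sets)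
    \<comment> \<open>joint measurability, as needed to interchange the first observation and the remaining chain\<close>
    have "(\<lambda>p. \<integral>\<^sup>+y. f (case_nat z (snd p), case_nat (fst p) y) \<partial>emit_seq (snd p))
        \<in> borel_measurable (emit z \<Otimes>\<^sub>M chain (K z))"
      by (rule nn_integral_measurable_subprob_algebra2[OF _ es']) measurable
    then have M: "(\<lambda>(b, x). \<integral>\<^sup>+y. f (case_nat z x, case_nat b y) \<partial>emit_seq x)
        \<in> borel_measurable (emit z \<Otimes>\<^sub>M chain (K z))"
      by (simp add: case_prod_beta)
    have "(\<integral>\<^sup>+x. \<integral>\<^sup>+y. f (case_nat z x, y) \<partial>emit_seq (case_nat z x) \<partial>chain (K z)) =
        (\<integral>\<^sup>+x. \<integral>\<^sup>+b. \<integral>\<^sup>+y. f (case_nat z x, case_nat b y) \<partial>emit_seq x \<partial>emit z \<partial>chain (K z))"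
    proof (rule nn_integral_cong, rule nn_integral_emit_seq_case_nat)
      fix x
      show "(\<lambda>y. f (case_nat z x, y)) \<in> borel_measurable seqs"
        by measurable
    qed
    also have "\<dots> = (\<integral>\<^sup>+b. \<integral>\<^sup>+x. \<integral>\<^sup>+y. f (case_nat z x, case_nat b y) \<partial>emit_seq x \<partial>chain (K z) \<partial>emit z)"
      using EC.Fubini'[OF M] by simp
    also have "\<dots> = (\<integral>\<^sup>+b. \<integral>\<^sup>+\<omega>. f (case_nat z (fst \<omega>), case_nat b (snd \<omega>)) \<partial>law (K z) \<partial>emit z)"
    proof (rule nn_integral_cong)
      fix b
      have "(\<lambda>\<omega>. f (case_nat z (fst \<omega>), case_nat b (snd \<omega>))) \<in> borel_measurable paths"
        by measurable
      from nn_integral_law[OF K_prob this]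
      show "(\<integral>\<^sup>+x. \<integral>\<^sup>+y. f (case_nat z x, case_nat b y) \<partial>emit_seq x \<partial>chain (K z)) =
          (\<integral>\<^sup>+\<omega>. f (case_nat z (fst \<omega>), case_nat b (snd \<omega>)) \<partial>law (K z))"
        by simp
    qed
    also have "\<dots> = (\<integral>\<^sup>+b. ennreal (g z b) * (\<integral>\<^sup>+\<omega>. f (case_nat z (fst \<omega>), case_nat b (snd \<omega>)) \<partial>law (K z)) \<partial>\<nu>)"
    proof (rule nn_integral_emit)
      show "(\<lambda>b. \<integral>\<^sup>+\<omega>. f (case_nat z (fst \<omega>), case_nat b (snd \<omega>)) \<partial>law (K z)) \<in> borel_measurable borel"
      proof (rule nn_integral_measurable_subprob_algebra2[where N=paths])
        show "(\<lambda>_. law (K z)) \<in> borel \<rightarrow>\<^sub>M subprob_algebra paths"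
          by (rule measurable_prob_algebraD) (simp add: law_in_prob_algebra K_prob)
      qed measurable
    qed
    finally show "(\<integral>\<^sup>+x. \<integral>\<^sup>+y. f (case_nat z x, y) \<partial>emit_seq (case_nat z x) \<partial>chain (K z)) = \<dots>" .
  qed
  finally show ?thesis .
qed

end

section \<open>Density of the observations and the Markov property\<close>

lemma measurable_reindex_seq:
  assumes f [measurable]: "f \<in> N \<rightarrow>\<^sub>M seqs"
  shows "(\<lambda>z i. f z (h i)) \<in> N \<rightarrow>\<^sub>M seqs"
  by (rule measurable_PiM_single') simp_all

lemma measurable_tl_seq [measurable (raw)]:
  "f \<in> N \<rightarrow>\<^sub>M seqs \<Longrightarrow> (\<lambda>z i. f z (Suc i)) \<in> N \<rightarrow>\<^sub>M seqs"
  by (rule measurable_reindex_seq)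

definition drop_seq :: "nat \<Rightarrow> (nat \<Rightarrow> 'b) \<Rightarrow> nat \<Rightarrow> 'b" where
  "drop_seq s y = (\<lambda>i. y (i + s))"

lemma drop_seq_0 [simp]: "drop_seq 0 y = y"
  by (simp add: drop_seq_def)

lemma drop_seq_drop_seq: "drop_seq s (drop_seq t y) = drop_seq (s + t) y"
  by (simp add: drop_seq_def ac_simps)

lemma drop_seq_Suc_case_nat [simp]: "drop_seq (Suc s) (case_nat b y) = drop_seq s y"
  by (simp add: drop_seq_def)

lemma measurable_drop_seq [measurable (raw)]:
  "f \<in> N \<rightarrow>\<^sub>M seqs \<Longrightarrow> (\<lambda>z. drop_seq s (f z)) \<in> N \<rightarrow>\<^sub>M seqs"
  unfolding drop_seq_def by (rule measurable_reindex_seq)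

lemma depends_below_case_nat_0:
  assumes "depends_below (Suc 0) u" shows "u (case_nat b y) = u (\<lambda>_. b)"
  by (rule depends_belowD[OF assms]) simp

lemma all_less_Suc_split: "(\<forall>i. i < Suc n \<longrightarrow> P i) \<longleftrightarrow> P 0 \<and> (\<forall>i<n. P (Suc i))"
  by (auto simp: less_Suc_eq_0_disj)

context hidden_markov
begin

interpretation prod_\<nu>: product_sigma_finite "\<lambda>_::nat. \<nu>"
  by unfold_locales

abbreviation obs_ref :: "nat \<Rightarrow> (nat \<Rightarrow> 'y) measure" where
  "obs_ref n \<equiv> PiM {..<n} (\<lambda>_. \<nu>)"

lemma measurable_obs_ref:
  assumes f: "f \<in> seqs \<rightarrow>\<^sub>M N"
  shows "f \<in> obs_ref n \<rightarrow>\<^sub>M N"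
proof -
  have "sets (obs_ref n) = sets (PiM {..<n} (\<lambda>_. borel))"
    by (rule sets_PiM_cong) simp_all
  moreover have "f \<in> PiM {..<n} (\<lambda>_. borel) \<rightarrow>\<^sub>M N"
    by (rule measurable_compose[OF measurable_extensional_seq f])
  ultimately show ?thesis
    by (simp cong: measurable_cong_sets)
qed

lemma measurable_snd_obs_ref: "snd \<in> N \<Otimes>\<^sub>M obs_ref n \<rightarrow>\<^sub>M seqs"
  using measurable_compose[OF measurable_snd measurable_obs_ref[OF measurable_ident]] by simp

lemma sigma_finite_obs_ref: "sigma_finite_measure (obs_ref n)"
  by (rule prod_\<nu>.sigma_finite) simp

lemma measurable_cons_obs_ref:
  "(\<lambda>(b, y). restrict (case_nat b y) {..<Suc n}) \<in> \<nu> \<Otimes>\<^sub>M obs_ref n \<rightarrow>\<^sub>M obs_ref (Suc n)"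
  unfolding case_prod_beta
proof (rule measurable_restrict)
  fix i assume "i \<in> {..<Suc n}"
  then show "(\<lambda>p. case_nat (fst p) (snd p) i) \<in> \<nu> \<Otimes>\<^sub>M obs_ref n \<rightarrow>\<^sub>M \<nu>"
    by (cases i) simp_all
qed

lemma distr_obs_ref_Suc:
  "distr (\<nu> \<Otimes>\<^sub>M obs_ref n) (obs_ref (Suc n)) (\<lambda>(b, y). restrict (case_nat b y) {..<Suc n}) = obs_ref (Suc n)"
proof (rule prod_\<nu>.PiM_eqI)
  note meas = measurable_cons_obs_ref[of n]
  interpret S: sigma_finite_measure "obs_ref n" by (rule sigma_finite_obs_ref)
  fix A assume A: "\<And>i. i \<in> {..<Suc n} \<Longrightarrow> A i \<in> sets \<nu>"
  have "emeasure (distr (\<nu> \<Otimes>\<^sub>M obs_ref n) (obs_ref (Suc n)) (\<lambda>(b, y). restrict (case_nat b y) {..<Suc n})) (Pi\<^sub>E {..<Suc n} A)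
      = emeasure (\<nu> \<Otimes>\<^sub>M obs_ref n)
          ((\<lambda>(b, y). restrict (case_nat b y) {..<Suc n}) -` Pi\<^sub>E {..<Suc n} A \<inter> space (\<nu> \<Otimes>\<^sub>M obs_ref n))"
    using A by (intro emeasure_distr[OF meas] sets_PiM_I_finite) auto
  also have "(\<lambda>(b, y). restrict (case_nat b y) {..<Suc n}) -` Pi\<^sub>E {..<Suc n} A \<inter> space (\<nu> \<Otimes>\<^sub>M obs_ref n)
      = A 0 \<times> Pi\<^sub>E {..<n} (\<lambda>i. A (Suc i))"
  proof -
    have "restrict (case_nat b y) {..<Suc n} \<in> Pi\<^sub>E {..<Suc n} A \<longleftrightarrow>
        b \<in> A 0 \<and> (\<forall>i<n. y i \<in> A (Suc i))" for b y
      unfolding restrict_PiE_iff Ball_def lessThan_iff all_less_Suc_split by simp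
    then show ?thesis
      unfolding set_eq_iff vimage_def space_pair_measure space_PiM
      by (simp add: PiE_iff) blast
  qed
  also have "emeasure (\<nu> \<Otimes>\<^sub>M obs_ref n) \<dots> = emeasure \<nu> (A 0) * emeasure (obs_ref n) (Pi\<^sub>E {..<n} (\<lambda>i. A (Suc i)))"
    using A by (intro S.emeasure_pair_measure_Times sets_PiM_I_finite) auto
  also have "emeasure (obs_ref n) (Pi\<^sub>E {..<n} (\<lambda>i. A (Suc i))) = (\<Prod>i<n. emeasure \<nu> (A (Suc i)))"
    using A by (intro prod_\<nu>.emeasure_PiM) auto
  finally show "emeasure (distr (\<nu> \<Otimes>\<^sub>M obs_ref n) (obs_ref (Suc n)) (\<lambda>(b, y). restrict (case_nat b y) {..<Suc n})) (Pi\<^sub>E {..<Suc n} A)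
      = (\<Prod>i\<in>{..<Suc n}. emeasure \<nu> (A i))"
    by (simp only: prod.lessThan_Suc_shift)
qed simp_all

text \<open>
  The recursion of \<^const>\<open>hmm_lik\<close> consumes the first observation and shifts the others, so the
  coordinate to be split off the finite product is 0, not the last one.
\<close>

lemma nn_integral_obs_ref_Suc:
  assumes f [measurable]: "f \<in> borel_measurable seqs" and dep: "depends_below (Suc n) f"
  shows "(\<integral>\<^sup>+y. f y \<partial>obs_ref (Suc n)) = (\<integral>\<^sup>+b. \<integral>\<^sup>+y. f (case_nat b y) \<partial>obs_ref n \<partial>\<nu>)"
proof -
  interpret S: sigma_finite_measure "obs_ref n" by (rule sigma_finite_obs_ref)
  note meas = measurable_cons_obs_ref[of n]
  have f': "f \<in> borel_measurable (obs_ref (Suc n))"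
    by (rule measurable_obs_ref[OF f])
  have "(\<integral>\<^sup>+y. f y \<partial>obs_ref (Suc n)) =
      (\<integral>\<^sup>+y. f y \<partial>distr (\<nu> \<Otimes>\<^sub>M obs_ref n) (obs_ref (Suc n)) (\<lambda>(b, y). restrict (case_nat b y) {..<Suc n}))"
    by (simp only: distr_obs_ref_Suc)
  also have "\<dots> = (\<integral>\<^sup>+p. f ((\<lambda>(b, y). restrict (case_nat b y) {..<Suc n}) p) \<partial>(\<nu> \<Otimes>\<^sub>M obs_ref n))"
    by (rule nn_integral_distr[OF meas]) (simp add: f')
  also have "\<dots> = (\<integral>\<^sup>+b. \<integral>\<^sup>+y. f (restrict (case_nat b y) {..<Suc n}) \<partial>obs_ref n \<partial>\<nu>)"
    using S.nn_integral_fst[OF measurable_compose[OF meas f']] by simp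
  also have "\<dots> = (\<integral>\<^sup>+b. \<integral>\<^sup>+y. f (case_nat b y) \<partial>obs_ref n \<partial>\<nu>)"
  proof (intro nn_integral_cong)
    fix b y
    show "f (restrict (case_nat b y) {..<Suc n}) = f (case_nat b y)"
      by (rule depends_belowD[OF dep]) simp
  qed
  finally show ?thesis .
qed

abbreviation lik :: "nat \<Rightarrow> 'x measure \<Rightarrow> (nat \<Rightarrow> 'y) \<Rightarrow> ennreal" where
  "lik n m y \<equiv> hmm_lik K g n m y"

lemma depends_below_lik: "depends_below n (hmm_lik K g n m)"
proof (induction n arbitrary: m)
  case (Suc n)
  show ?case
    unfolding depends_below_def
  proof safe
    fix x y :: "nat \<Rightarrow> 'y" assume "\<forall>i<Suc n. x i = y i"
    then show "hmm_lik K g (Suc n) m x = hmm_lik K g (Suc n) m y"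
      using depends_belowD[OF Suc.IH, of "\<lambda>i. x (Suc i)" "\<lambda>i. y (Suc i)"] by simp
  qed
qed (simp add: depends_below_def)

lemma lik_measurable_aux:
  "(\<lambda>p. lik n (fst p) (snd p)) \<in> borel_measurable (prob_algebra borel \<Otimes>\<^sub>M seqs)"
proof (induction n)
  case (Suc n)
  let ?N = "prob_algebra (borel :: 'x measure) \<Otimes>\<^sub>M (seqs :: (nat \<Rightarrow> 'y) measure)"
  have fst: "fst \<in> ?N \<rightarrow>\<^sub>M subprob_algebra borel"
    by (rule measurable_prob_algebraD) simp
  have "(\<lambda>q. (K (snd q), (\<lambda>i. snd (fst q) (Suc i)))) \<in> ?N \<Otimes>\<^sub>M borel \<rightarrow>\<^sub>M prob_algebra borel \<Otimes>\<^sub>M seqs"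
    by measurable
  from measurable_compose[OF this Suc.IH]
  have [measurable]: "(\<lambda>q. lik n (K (snd q)) (\<lambda>i. snd (fst q) (Suc i))) \<in> borel_measurable (?N \<Otimes>\<^sub>M borel)"
    by simp
  show ?case
    unfolding hmm_lik.simps
    by (rule nn_integral_measurable_subprob_algebra2[OF _ fst]) measurable
qed simp

lemma measurable_lik [measurable (raw)]:
  assumes m: "m \<in> N \<rightarrow>\<^sub>M prob_algebra borel" and y: "y \<in> N \<rightarrow>\<^sub>M seqs"
  shows "(\<lambda>z. lik n (m z) (y z)) \<in> borel_measurable N"
  using measurable_compose[OF measurable_Pair[OF m y] lik_measurable_aux[of n]] by simp

text \<open>
  The likelihood is the density of the first \<open>n\<close> observations: the law and the likelihood obey the
  same recursion over the first step, once the integrals over hidden states and over observations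
  are interchanged.
\<close>

lemma nn_integral_law_lik:
  assumes m: "m \<in> space (prob_algebra borel)" and f [measurable]: "f \<in> borel_measurable seqs"
    and dep: "depends_below n f"
  shows "(\<integral>\<^sup>+\<omega>. f (snd \<omega>) \<partial>law m) = (\<integral>\<^sup>+y. lik n m y * f y \<partial>obs_ref n)"
  using f dep m
proof (induction n arbitrary: f m)
  case 0
  interpret P: prob_space "law m" by (rule prob_space_law[OF 0(3)])
  have "f = (\<lambda>_. f undefined)"
    by (intro ext depends_belowD[OF 0(2)]) simp
  then obtain c where f: "f = (\<lambda>_. c)"
    by blast
  have "(\<integral>\<^sup>+\<omega>. c \<partial>law m) = c"
    using P.emeasure_space_1 by simp
  moreover have "(\<integral>\<^sup>+y. c \<partial>obs_ref 0) = c"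
    using prod_\<nu>.nn_integral_empty[of "\<lambda>_. c"] by simp
  ultimately show ?case
    by (simp only: f hmm_lik.simps mult_1_left)
next
  case (Suc n)
  note f [measurable] = Suc.prems(1) and dep = Suc.prems(2) and m = Suc.prems(3)
  note m_sets[OF m, measurable_cong, simp]
  interpret m: prob_space m by (rule m_prob[OF m])
  interpret S: sigma_finite_measure "obs_ref n" by (rule sigma_finite_obs_ref)
  interpret mS: pair_sigma_finite m "obs_ref n" ..
  interpret m\<nu>: pair_sigma_finite m \<nu> ..
  let ?h = "\<lambda>z b y. ennreal (g z b) * (lik n (K z) y * f (case_nat b y))"
  have h [measurable]: "(\<lambda>p. ?h (fst p) (fst (snd p)) (snd (snd p))) \<in> borel_measurable (m \<Otimes>\<^sub>M (\<nu> \<Otimes>\<^sub>M seqs))"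
    by measurable
  have "(\<integral>\<^sup>+\<omega>. f (snd \<omega>) \<partial>law m) =
      (\<integral>\<^sup>+z. \<integral>\<^sup>+b. ennreal (g z b) * (\<integral>\<^sup>+\<omega>. f (case_nat b (snd \<omega>)) \<partial>law (K z)) \<partial>\<nu> \<partial>m)"
    using nn_integral_law_first[OF m, of "\<lambda>\<omega>. f (snd \<omega>)"] by simp
  also have "\<dots> = (\<integral>\<^sup>+z. \<integral>\<^sup>+b. \<integral>\<^sup>+y. ?h z b y \<partial>obs_ref n \<partial>\<nu> \<partial>m)"
  proof (intro nn_integral_cong)
    fix z b
    have "(\<integral>\<^sup>+\<omega>. f (case_nat b (snd \<omega>)) \<partial>law (K z)) = (\<integral>\<^sup>+y. lik n (K z) y * f (case_nat b y) \<partial>obs_ref n)"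
      by (rule Suc.IH[OF _ depends_below_case_nat[OF dep] K_prob]) measurable
    moreover have "(\<lambda>y. lik n (K z) y * f (case_nat b y)) \<in> borel_measurable (obs_ref n)"
      by (rule measurable_obs_ref) measurable
    ultimately show "ennreal (g z b) * (\<integral>\<^sup>+\<omega>. f (case_nat b (snd \<omega>)) \<partial>law (K z)) = (\<integral>\<^sup>+y. ?h z b y \<partial>obs_ref n)"
      by (simp add: nn_integral_cmult)
  qed
  also have "\<dots> = (\<integral>\<^sup>+b. \<integral>\<^sup>+z. \<integral>\<^sup>+y. ?h z b y \<partial>obs_ref n \<partial>m \<partial>\<nu>)"
  proof (rule m\<nu>.Fubini'[symmetric])
    show "(\<lambda>(z, b). \<integral>\<^sup>+y. ?h z b y \<partial>obs_ref n) \<in> borel_measurable (m \<Otimes>\<^sub>M \<nu>)"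
    proof -
      note measurable_snd_obs_ref [measurable]
      have "(\<lambda>(p, y). ?h (fst p) (snd p) y) \<in> borel_measurable ((m \<Otimes>\<^sub>M \<nu>) \<Otimes>\<^sub>M obs_ref n)"
        by measurable
      from S.borel_measurable_nn_integral[OF this] show ?thesis
        by (simp add: case_prod_beta)
    qed
  qed
  also have "\<dots> = (\<integral>\<^sup>+b. \<integral>\<^sup>+y. \<integral>\<^sup>+z. ?h z b y \<partial>m \<partial>obs_ref n \<partial>\<nu>)"
  proof (rule nn_integral_cong, rule mS.Fubini'[symmetric])
    fix b
    note measurable_snd_obs_ref [measurable]
    show "(\<lambda>(z, y). ?h z b y) \<in> borel_measurable (m \<Otimes>\<^sub>M obs_ref n)"
      by measurable
  qed
  also have "\<dots> = (\<integral>\<^sup>+b. \<integral>\<^sup>+y. lik (Suc n) m (case_nat b y) * f (case_nat b y) \<partial>obs_ref n \<partial>\<nu>)"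
  proof (intro nn_integral_cong)
    fix b y
    have "(\<integral>\<^sup>+z. ?h z b y \<partial>m) = (\<integral>\<^sup>+z. ennreal (g z b) * lik n (K z) y * f (case_nat b y) \<partial>m)"
      by (simp add: mult.assoc)
    also have "\<dots> = (\<integral>\<^sup>+z. ennreal (g z b) * lik n (K z) y \<partial>m) * f (case_nat b y)"
      by (rule nn_integral_multc) measurable
    finally show "(\<integral>\<^sup>+z. ?h z b y \<partial>m) = lik (Suc n) m (case_nat b y) * f (case_nat b y)"
      by simp
  qed
  also have "\<dots> = (\<integral>\<^sup>+y. lik (Suc n) m y * f y \<partial>obs_ref (Suc n))"
  proof (rule nn_integral_obs_ref_Suc[symmetric])
    have [measurable]: "(\<lambda>y. lik (Suc n) m y) \<in> borel_measurable seqs"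
      by (rule measurable_lik) (use m in simp_all)
    show "(\<lambda>y. lik (Suc n) m y * f y) \<in> borel_measurable seqs"
      by measurable
    show "depends_below (Suc n) (\<lambda>y. lik (Suc n) m y * f y)"
      using depends_below_lik[of "Suc n" m] dep unfolding depends_below_def by metis
  qed
  finally show ?case .
qed

lemma measurable_nn_integral_law [measurable (raw)]:
  assumes f: "(\<lambda>(z, \<omega>). f z \<omega>) \<in> borel_measurable (N \<Otimes>\<^sub>M paths)" and m: "m \<in> N \<rightarrow>\<^sub>M prob_algebra borel"
  shows "(\<lambda>z. \<integral>\<^sup>+\<omega>. f z \<omega> \<partial>law (m z)) \<in> borel_measurable N"
  by (rule nn_integral_measurable_subprob_algebra2[OF f
        measurable_prob_algebraD[OF measurable_compose[OF m law_measurable]]])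

text \<open>
  The observations after time \<open>p\<close> form a model started one kernel step after the hidden state \<open>X\<^sub>p\<close>.
  The first-step identity carries this from \<open>p\<close> to \<open>p + 1\<close>.
\<close>

theorem nn_integral_law_markov:
  assumes m: "m \<in> space (prob_algebra borel)"
    and u [measurable]: "u \<in> borel_measurable seqs" and dep: "depends_below (Suc p) u"
    and v [measurable]: "v \<in> borel_measurable seqs"
  shows "(\<integral>\<^sup>+\<omega>. u (snd \<omega>) * v (drop_seq (Suc p) (snd \<omega>)) \<partial>law m) =
    (\<integral>\<^sup>+\<omega>. u (snd \<omega>) * (\<integral>\<^sup>+\<omega>'. v (snd \<omega>') \<partial>law (K (fst \<omega> p))) \<partial>law m)"
  using m u dep
proof (induction p arbitrary: m u)
  case 0
  note m = 0(1) and [measurable] = 0(2)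
  have v': "(\<lambda>\<omega>. v (snd \<omega>)) \<in> borel_measurable (law (K z))" for z
    by (simp add: measurable_cong_sets[OF sets_law[OF K_prob] refl])
  have P: "emeasure (law (K z)) (space (law (K z))) = 1" for z
    using prob_space_law[OF K_prob] by (rule prob_space.emeasure_space_1)
  show ?case
    by (subst (1 2) nn_integral_law_first[OF m])
      (measurable, simp add: depends_below_case_nat_0[OF 0(3)] nn_integral_cmult v' P)
next
  case (Suc p)
  note m = Suc.prems(1) and [measurable] = Suc.prems(2)
  have "(\<integral>\<^sup>+\<omega>. u (case_nat b (snd \<omega>)) * v (drop_seq (Suc p) (snd \<omega>)) \<partial>law (K z)) =
      (\<integral>\<^sup>+\<omega>. u (case_nat b (snd \<omega>)) * (\<integral>\<^sup>+\<omega>'. v (snd \<omega>') \<partial>law (K (fst \<omega> p))) \<partial>law (K z))" for z b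
    by (rule Suc.IH[OF K_prob _ depends_below_case_nat[OF Suc.prems(3)]]) measurable
  moreover have "(\<lambda>\<omega>. u (snd \<omega>) * (\<integral>\<^sup>+\<omega>'. v (snd \<omega>') \<partial>law (K (fst \<omega> (Suc p))))) \<in> borel_measurable paths"
    "(\<lambda>\<omega>. u (snd \<omega>) * v (drop_seq (Suc (Suc p)) (snd \<omega>))) \<in> borel_measurable paths"
    by measurable
  ultimately show ?case
    by (simp add: nn_integral_law_first[OF m])
qed

end

section \<open>Concentration of sums over blocks\<close>

text \<open>
  The blocks are disjoint. With overlapping windows each observation would affect \<open>l\<close> summands, which
  would cost up to a factor \<open>l\<close> in the exponents below.
\<close>

definition block_sum :: "nat \<Rightarrow> ((nat \<Rightarrow> 'b) \<Rightarrow> real) \<Rightarrow> nat \<Rightarrow> (nat \<Rightarrow> 'b) \<Rightarrow> real" where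
  "block_sum l h k y = (\<Sum>j<k. h (drop_seq (j * l) y))"

lemma measurable_block_sum [measurable]:
  assumes [measurable]: "h \<in> borel_measurable seqs"
  shows "block_sum l h k \<in> borel_measurable seqs"
  unfolding block_sum_def[abs_def] by measurable

lemma block_sum_Suc:
  "block_sum l h (Suc k) y = h y + block_sum l h k (drop_seq l y)"
  unfolding block_sum_def by (subst sum.lessThan_Suc_shift) (simp add: drop_seq_drop_seq ac_simps)

lemma depends_below_block_sum:
  assumes "depends_below l h"
  shows "depends_below (k * l) (block_sum l h k)"
  unfolding depends_below_def block_sum_def
proof safe
  fix x y :: "nat \<Rightarrow> 'a" assume xy: "\<forall>i<k * l. x i = y i"
  have "h (drop_seq (j * l) x) = h (drop_seq (j * l) y)" if j: "j < k" for j
  proof (rule depends_belowD[OF assms])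
    fix i assume "i < l"
    then have "i + j * l < Suc j * l" by simp
    also have "\<dots> \<le> k * l" using j by (intro mult_le_mono1) simp
    finally show "drop_seq (j * l) x i = drop_seq (j * l) y i"
      using xy by (simp add: drop_seq_def)
  qed
  then show "(\<Sum>j<k. h (drop_seq (j * l) x)) = (\<Sum>j<k. h (drop_seq (j * l) y))"
    by simp
qed

lemma block_sum_bounds:
  assumes "\<And>y. h y \<in> {0..1}"
  shows "block_sum l h k y \<in> {0..real k}"
  using assms sum_bounded_above[of "{..<k}" "\<lambda>j. h (drop_seq (j * l) y)" 1]
  by (auto simp: block_sum_def intro!: sum_nonneg)

context hidden_markov
begin

definition mean :: "'x measure \<Rightarrow> ((nat \<Rightarrow> 'y) \<Rightarrow> real) \<Rightarrow> real" where
  "mean m f = (\<integral>\<omega>. f (snd \<omega>) \<partial>law m)"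

lemma measurable_law_snd:
  assumes "m \<in> space (prob_algebra borel)" "f \<in> seqs \<rightarrow>\<^sub>M N"
  shows "(\<lambda>\<omega>. f (snd \<omega>)) \<in> law m \<rightarrow>\<^sub>M N"
  unfolding measurable_cong_sets[OF sets_law[OF assms(1)] refl]
  by (rule measurable_compose[OF measurable_snd assms(2)])

lemma law_event:
  assumes m: "m \<in> space (prob_algebra borel)" and E: "E \<in> sets seqs"
  shows "{\<omega> \<in> space (law m). snd \<omega> \<in> E} \<in> sets (law m)"
  using measurable_sets[OF measurable_law_snd[OF m measurable_ident] E]
  by (simp add: vimage_def Int_def conj_commute)

lemma integrable_law_snd:
  fixes f :: "(nat \<Rightarrow> 'y) \<Rightarrow> real"
  assumes m: "m \<in> space (prob_algebra borel)" and f: "f \<in> borel_measurable seqs" and B: "\<And>y. f y \<in> {0..B}"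
  shows "integrable (law m) (\<lambda>\<omega>. f (snd \<omega>))"
proof -
  interpret P: prob_space "law m" by (rule prob_space_law[OF m])
  show ?thesis
    by (rule P.integrable_const_bound[of _ B]) (use B measurable_law_snd[OF m f] in auto)
qed

lemma nn_integral_law_eq_mean:
  assumes m: "m \<in> space (prob_algebra borel)" and f: "f \<in> borel_measurable seqs" and B: "\<And>y. f y \<in> {0..B}"
  shows "(\<integral>\<^sup>+\<omega>. ennreal (f (snd \<omega>)) \<partial>law m) = ennreal (mean m f)"
  unfolding mean_def using integrable_law_snd[OF assms] B by (intro nn_integral_eq_integral) auto

lemma mean_bounds:
  assumes m: "m \<in> space (prob_algebra borel)" and f: "f \<in> borel_measurable seqs" and B: "\<And>y. f y \<in> {0..B}"
  shows "mean m f \<in> {0..B}"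
proof -
  interpret P: prob_space "law m" by (rule prob_space_law[OF m])
  have "mean m f \<le> B"
    unfolding mean_def using integrable_law_snd[OF assms] B by (intro P.integral_le_const) auto
  moreover have "0 \<le> mean m f"
    unfolding mean_def using B by (intro integral_nonneg_AE) auto
  ultimately show ?thesis by simp
qed

lemma measurable_mean:
  assumes m: "m \<in> N \<rightarrow>\<^sub>M prob_algebra borel" and f [measurable]: "f \<in> borel_measurable seqs" and B: "\<And>y. f y \<in> {0..B}"
  shows "(\<lambda>z. mean (m z) f) \<in> borel_measurable N"
proof (rule measurable_cong[THEN iffD1, rotated])
  show "(\<lambda>z. enn2real (\<integral>\<^sup>+\<omega>. ennreal (f (snd \<omega>)) \<partial>law (m z))) \<in> borel_measurable N"
    using m by measurable
  fix z assume "z \<in> space N"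
  then have mz: "m z \<in> space (prob_algebra borel)"
    by (rule measurable_space[OF m])
  show "enn2real (\<integral>\<^sup>+\<omega>. ennreal (f (snd \<omega>)) \<partial>law (m z)) = mean (m z) f"
    using mean_bounds[OF mz f B] by (simp add: nn_integral_law_eq_mean[OF mz f B])
qed

lemma mean_markov:
  assumes m: "m \<in> space (prob_algebra borel)" and f [measurable]: "f \<in> borel_measurable seqs" and B: "\<And>y. f y \<in> {0..B}"
  shows "mean m (\<lambda>y. f (drop_seq (Suc p) y)) = (\<integral>\<omega>. mean (K (fst \<omega> p)) f \<partial>law m)"
    and "integrable (law m) (\<lambda>\<omega>. mean (K (fst \<omega> p)) f)"
proof -
  interpret P: prob_space "law m" by (rule prob_space_law[OF m])
  have bounds: "mean (K z) f \<in> {0..B}" for z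
    by (rule mean_bounds[OF K_prob f B])
  have "(\<lambda>\<omega>. K (fst \<omega> p)) \<in> paths \<rightarrow>\<^sub>M prob_algebra borel"
    by measurable
  then have "(\<lambda>\<omega>. mean (K (fst \<omega> p)) f) \<in> borel_measurable paths"
    by (rule measurable_mean[OF _ f B])
  then have meas: "(\<lambda>\<omega>. mean (K (fst \<omega> p)) f) \<in> borel_measurable (law m)"
    by (simp add: measurable_cong_sets[OF sets_law[OF m] refl])
  show int: "integrable (law m) (\<lambda>\<omega>. mean (K (fst \<omega> p)) f)"
    by (rule P.integrable_const_bound[of _ B]) (use bounds meas in auto)
  have "ennreal (mean m (\<lambda>y. f (drop_seq (Suc p) y))) = (\<integral>\<^sup>+\<omega>. 1 * ennreal (f (drop_seq (Suc p) (snd \<omega>))) \<partial>law m)"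
    using nn_integral_law_eq_mean[OF m, of "\<lambda>y. f (drop_seq (Suc p) y)" B] B by simp
  also have "\<dots> = (\<integral>\<^sup>+\<omega>. 1 * (\<integral>\<^sup>+\<omega>'. ennreal (f (snd \<omega>')) \<partial>law (K (fst \<omega> p))) \<partial>law m)"
    by (rule nn_integral_law_markov[OF m]) (simp_all add: depends_below_def)
  also have "\<dots> = (\<integral>\<^sup>+\<omega>. ennreal (mean (K (fst \<omega> p)) f) \<partial>law m)"
    by (simp add: nn_integral_law_eq_mean[OF K_prob f B])
  also have "\<dots> = ennreal (\<integral>\<omega>. mean (K (fst \<omega> p)) f \<partial>law m)"
    using bounds by (intro nn_integral_eq_integral[OF int]) auto
  finally show "mean m (\<lambda>y. f (drop_seq (Suc p) y)) = (\<integral>\<omega>. mean (K (fst \<omega> p)) f \<partial>law m)"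
    using bounds mean_bounds[OF m, of "\<lambda>y. f (drop_seq (Suc p) y)" B] B
    by (subst (asm) ennreal_inj) (auto intro!: integral_nonneg_AE)
qed

text \<open>
  Induction on the number of blocks, for all initial laws at once. Given the first block and the
  hidden state at its end, the induction hypothesis replaces the remaining sum by its conditional
  mean. The first summand plus this mean ranges over an interval of length \<open>1 + 2 b\<close>, because all the
  conditional means lie within \<open>b\<close> of \<open>k q\<close>; Hoeffding's lemma bounds its exponential moment.
\<close>

theorem exp_block_sum_le:
  assumes h [measurable]: "h \<in> borel_measurable seqs" and h01: "\<And>y. h y \<in> {0..1}"
    and dep: "depends_below (Suc p) h" and s: "s > 0"
    and osc: "\<And>k x. \<bar>mean (K x) (block_sum (Suc p) h k) - real k * q\<bar> \<le> b"
    and m: "m \<in> space (prob_algebra borel)"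
  shows "(\<integral>\<^sup>+\<omega>. ennreal (exp (s * block_sum (Suc p) h k (snd \<omega>))) \<partial>law m) \<le>
    ennreal (exp (s * mean m (block_sum (Suc p) h k) + real k * s\<^sup>2 * (1 + 2 * b)\<^sup>2 / 8))"
  using m
proof (induction k arbitrary: m)
  case 0
  interpret P: prob_space "law m" by (rule prob_space_law[OF 0])
  show ?case
    using P.emeasure_space_1 by (simp add: block_sum_def mean_def)
next
  case (Suc k)
  note m = Suc.prems
  interpret P: prob_space "law m" by (rule prob_space_law[OF m])
  note T01 = block_sum_bounds[of h, OF h01]
  let ?T = "block_sum (Suc p) h"
  let ?c = "real k * s\<^sup>2 * (1 + 2 * b)\<^sup>2 / 8"
  \<comment> \<open>the conditional mean of the whole sum given the first block and the hidden state at its end\<close>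
  define W where "W \<omega> = h (snd \<omega>) + mean (K (fst \<omega> p)) (?T k)" for \<omega> :: "(nat \<Rightarrow> 'x) \<times> (nat \<Rightarrow> 'y)"
  have Kp: "(\<lambda>\<omega>. K (fst \<omega> p)) \<in> paths \<rightarrow>\<^sub>M prob_algebra borel"
    by measurable
  have [measurable]: "(\<lambda>\<omega>. mean (K (fst \<omega> p)) (?T k)) \<in> borel_measurable paths"
    by (rule measurable_mean[OF Kp _ T01]) measurable
  have "W \<in> borel_measurable paths"
    unfolding W_def[abs_def] by measurable
  then have Wm: "W \<in> borel_measurable (law m)"
    by (simp add: measurable_cong_sets[OF sets_law[OF m] refl])
  have intW: "P.expectation W = mean m (?T (Suc k))"
  proof -
    have "P.expectation W = mean m h + (\<integral>\<omega>. mean (K (fst \<omega> p)) (?T k) \<partial>law m)"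
      unfolding W_def mean_def[of m h]
      by (intro Bochner_Integration.integral_add integrable_law_snd[OF m h h01] mean_markov(2)[OF m _ T01]) measurable
    also have "(\<integral>\<omega>. mean (K (fst \<omega> p)) (?T k) \<partial>law m) = mean m (\<lambda>y. ?T k (drop_seq (Suc p) y))"
      by (intro mean_markov(1)[OF m _ T01, symmetric]) measurable
    also have "mean m h + \<dots> = mean m (?T (Suc k))"
      unfolding mean_def block_sum_Suc
      by (intro Bochner_Integration.integral_add[symmetric] integrable_law_snd[OF m _ h01]
         integrable_law_snd[OF m, of "\<lambda>y. ?T k (drop_seq (Suc p) y)", OF _ T01]) measurable
    finally show ?thesis .
  qed
  interpret I: interval_bounded_random_variable "law m" W "real k * q - b" "real k * q + b + 1"
  proof
    show "AE \<omega> in law m. W \<omega> \<in> {real k * q - b..real k * q + b + 1}"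
    proof (rule AE_I2)
      fix \<omega>
      show "W \<omega> \<in> {real k * q - b..real k * q + b + 1}"
        using h01[of "snd \<omega>"] osc[of "fst \<omega> p" k] by (auto simp: W_def abs_le_iff)
    qed
  qed (rule Wm)
  have "(\<integral>\<^sup>+\<omega>. ennreal (exp (s * ?T (Suc k) (snd \<omega>))) \<partial>law m) =
      (\<integral>\<^sup>+\<omega>. ennreal (exp (s * h (snd \<omega>))) * ennreal (exp (s * ?T k (drop_seq (Suc p) (snd \<omega>)))) \<partial>law m)"
    by (intro nn_integral_cong) (simp add: block_sum_Suc distrib_left exp_add ennreal_mult')
  also have "\<dots> = (\<integral>\<^sup>+\<omega>. ennreal (exp (s * h (snd \<omega>))) *
      (\<integral>\<^sup>+\<omega>'. ennreal (exp (s * ?T k (snd \<omega>'))) \<partial>law (K (fst \<omega> p))) \<partial>law m)"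
  proof (rule nn_integral_law_markov[OF m])
    show "depends_below (Suc p) (\<lambda>y. ennreal (exp (s * h y)))"
      using dep unfolding depends_below_def by metis
  qed measurable
  also have "\<dots> \<le> (\<integral>\<^sup>+\<omega>. ennreal (exp (s * h (snd \<omega>))) *
      ennreal (exp (s * mean (K (fst \<omega> p)) (?T k) + ?c)) \<partial>law m)"
    by (intro nn_integral_mono mult_left_mono Suc.IH K_prob) simp
  also have "\<dots> = (\<integral>\<^sup>+\<omega>. ennreal (exp (s * (W \<omega> - P.expectation W))) * ennreal (exp (s * P.expectation W + ?c)) \<partial>law m)"
    by (intro nn_integral_cong) (simp add: W_def ennreal_mult'[symmetric] exp_add[symmetric] algebra_simps)
  also have "\<dots> = (\<integral>\<^sup>+\<omega>. ennreal (exp (s * (W \<omega> - P.expectation W))) \<partial>law m) * ennreal (exp (s * P.expectation W + ?c))"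
    using Wm by (intro nn_integral_multc) measurable
  also have "\<dots> \<le> ennreal (exp (s\<^sup>2 * (1 + 2 * b)\<^sup>2 / 8)) * ennreal (exp (s * P.expectation W + ?c))"
    using I.Hoeffdings_lemma_nn_integral[OF s] by (intro mult_right_mono) (simp_all add: algebra_simps)
  also have "\<dots> = ennreal (exp (s * mean m (?T (Suc k)) + real (Suc k) * s\<^sup>2 * (1 + 2 * b)\<^sup>2 / 8))"
    by (simp add: ennreal_mult'[symmetric] exp_add[symmetric] intW) (simp add: field_simps)
  finally show ?case .
qed

lemma block_sum_upper_tail:
  assumes h [measurable]: "h \<in> borel_measurable seqs" and h01: "\<And>y. h y \<in> {0..1}"
    and dep: "depends_below (Suc p) h" and t: "t > 0"
    and osc: "\<And>k x. \<bar>mean (K x) (block_sum (Suc p) h k) - real k * q\<bar> \<le> b"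
    and m: "m \<in> space (prob_algebra borel)"
  shows "measure (law m) {\<omega> \<in> space (law m). block_sum (Suc p) h k (snd \<omega>) \<ge> mean m (block_sum (Suc p) h k) + real k * t}
    \<le> exp (- 2 * real k * t\<^sup>2 / (1 + 2 * b)\<^sup>2)"
proof -
  interpret P: prob_space "law m" by (rule prob_space_law[OF m])
  have b: "b \<ge> 0"
    using osc[of undefined 0] by (simp add: block_sum_def mean_def)
  define c where "c = 1 + 2 * b"
  have c: "c > 0" using b by (simp add: c_def)
  \<comment> \<open>the minimiser of \<open>- s * k * t + k * s\<^sup>2 * c\<^sup>2 / 8\<close>\<close>
  define s where "s = 4 * t / c\<^sup>2"
  have s: "s > 0" using t c by (simp add: s_def)
  let ?T = "block_sum (Suc p) h k"
  let ?a = "mean m ?T + real k * t"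
  have um: "(\<lambda>\<omega>. ennreal (exp (s * ?T (snd \<omega>)))) \<in> borel_measurable (law m)"
    by (rule measurable_law_snd[OF m, of "\<lambda>y. ennreal (exp (s * ?T y))"]) measurable
  have "emeasure (law m) {\<omega> \<in> space (law m). ?T (snd \<omega>) \<ge> ?a} =
      emeasure (law m) {\<omega> \<in> space (law m). 1 \<le> ennreal (exp (- s * ?a)) * ennreal (exp (s * ?T (snd \<omega>)))}"
    using s by (intro arg_cong[where f="emeasure (law m)"] Collect_cong conj_cong refl)
      (auto simp: ennreal_mult'[symmetric] exp_add[symmetric] zero_le_mult_iff simp flip: right_diff_distrib)
  also have "\<dots> \<le> ennreal (exp (- s * ?a)) * (\<integral>\<^sup>+\<omega>. ennreal (exp (s * ?T (snd \<omega>))) * indicator (space (law m)) \<omega> \<partial>law m)"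
  proof (rule nn_integral_Markov_inequality)
    show "(\<lambda>\<omega>. ennreal (exp (s * ?T (snd \<omega>))) * indicator (space (law m)) \<omega>) \<in> borel_measurable (law m)"
      by (rule measurable_cong[THEN iffD1, OF _ um]) simp
  qed simp
  also have "(\<integral>\<^sup>+\<omega>. ennreal (exp (s * ?T (snd \<omega>))) * indicator (space (law m)) \<omega> \<partial>law m) =
      (\<integral>\<^sup>+\<omega>. ennreal (exp (s * ?T (snd \<omega>))) \<partial>law m)"
    by (intro nn_integral_cong) simp
  also have "ennreal (exp (- s * ?a)) * \<dots> \<le> ennreal (exp (- s * ?a)) * ennreal (exp (s * mean m ?T + real k * s\<^sup>2 * c\<^sup>2 / 8))"
    unfolding c_def by (intro mult_left_mono exp_block_sum_le[OF h h01 dep s osc m]) simp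
  also have "\<dots> = ennreal (exp (- (s * real k * t) + real k * s\<^sup>2 * c\<^sup>2 / 8))"
    by (simp add: ennreal_mult'[symmetric] exp_add[symmetric] algebra_simps)
  also have "- (s * real k * t) + real k * s\<^sup>2 * c\<^sup>2 / 8 = - 2 * real k * t\<^sup>2 / c\<^sup>2"
    using c by (simp add: s_def field_simps power2_eq_square)
  finally show ?thesis
    by (simp add: P.emeasure_eq_measure c_def)
qed

lemma kernel_pow_measurable: "kernel_pow K s \<in> borel \<rightarrow>\<^sub>M prob_algebra borel"
  by (induction s) (simp_all add: measurable_bind_prob_space[OF _ K])

lemma kernel_pow_prob: "kernel_pow K s x \<in> space (prob_algebra borel)"
  by (rule measurable_space[OF kernel_pow_measurable]) simp

lemma kernel_pow_1: "kernel_pow K (Suc 0) x = K x"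
  by (simp add: bind_return[OF K_subprob])

lemma return_prob: "return borel (x :: 'x) \<in> space (prob_algebra borel)"
  using kernel_pow_prob[of 0 x] by simp

text \<open>
  In the first-step identity the integral over the initial law is outermost.
\<close>

lemma nn_integral_law_mixture:
  assumes m: "m \<in> space (prob_algebra borel)" and f [measurable]: "f \<in> borel_measurable seqs"
  shows "(\<integral>\<^sup>+\<omega>. f (snd \<omega>) \<partial>law m) = (\<integral>\<^sup>+z. \<integral>\<^sup>+\<omega>. f (snd \<omega>) \<partial>law (return borel z) \<partial>m)"
proof -
  let ?c = "\<lambda>z. \<integral>\<^sup>+b. ennreal (g z b) * (\<integral>\<^sup>+\<omega>. f (case_nat b (snd \<omega>)) \<partial>law (K z)) \<partial>\<nu>"
  have c: "?c \<in> borel_measurable borel"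
    by measurable
  have f': "(\<lambda>\<omega>. f (snd \<omega>)) \<in> borel_measurable paths"
    by measurable
  have "(\<integral>\<^sup>+\<omega>. f (snd \<omega>) \<partial>law (return borel z)) = ?c z" for z
    using nn_integral_law_first[OF return_prob f'] nn_integral_return[OF _ c] by simp
  then show ?thesis
    using nn_integral_law_first[OF m f'] by simp
qed

text \<open>
  Given the hidden state, the first observation has a law of total mass 1 and integrates out.
\<close>

lemma nn_integral_law_drop_Suc_0:
  assumes m: "m \<in> space (prob_algebra borel)" and f [measurable]: "f \<in> borel_measurable seqs"
  shows "(\<integral>\<^sup>+\<omega>. f (drop_seq (Suc 0) (snd \<omega>)) \<partial>law m) = (\<integral>\<^sup>+\<omega>. f (snd \<omega>) \<partial>law (m \<bind> K))"
proof -
  note m_sets[OF m, measurable_cong, simp]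
  let ?c = "\<lambda>z. \<integral>\<^sup>+\<omega>. f (snd \<omega>) \<partial>law (return borel z)"
  have c: "?c \<in> borel_measurable borel"
    by measurable
  have Km: "K \<in> m \<rightarrow>\<^sub>M subprob_algebra borel"
    by measurable
  have mK: "m \<bind> K \<in> space (prob_algebra borel)"
    by (rule measurable_space[OF measurable_bind_prob_space[OF measurable_ident K] m, simplified])
  have g': "(\<integral>\<^sup>+b. ennreal (g z b) * v \<partial>\<nu>) = v" for z v
    using g_density[of z] by (subst nn_integral_multc) simp_all
  have "(\<integral>\<^sup>+\<omega>. f (drop_seq (Suc 0) (snd \<omega>)) \<partial>law m) = (\<integral>\<^sup>+z. \<integral>\<^sup>+\<omega>. f (snd \<omega>) \<partial>law (K z) \<partial>m)"
    by (subst nn_integral_law_first[OF m]) (measurable, simp add: g')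
  also have "\<dots> = (\<integral>\<^sup>+z. \<integral>\<^sup>+w. ?c w \<partial>K z \<partial>m)"
    by (intro nn_integral_cong nn_integral_law_mixture K_prob f)
  also have "\<dots> = (\<integral>\<^sup>+w. ?c w \<partial>(m \<bind> K))"
    by (rule nn_integral_bind[OF c Km, symmetric])
  also have "\<dots> = (\<integral>\<^sup>+\<omega>. f (snd \<omega>) \<partial>law (m \<bind> K))"
    by (rule nn_integral_law_mixture[OF mK f, symmetric])
  finally show ?thesis .
qed

lemma nn_integral_law_drop:
  assumes f: "f \<in> borel_measurable seqs"
  shows "(\<integral>\<^sup>+\<omega>. f (drop_seq s (snd \<omega>)) \<partial>law (kernel_pow K j x)) = (\<integral>\<^sup>+\<omega>. f (snd \<omega>) \<partial>law (kernel_pow K (j + s) x))"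
proof (induction s arbitrary: j)
  case (Suc s)
  have fs: "(\<lambda>y. f (drop_seq s y)) \<in> borel_measurable seqs"
    using f by measurable
  have "(\<integral>\<^sup>+\<omega>. f (drop_seq (Suc s) (snd \<omega>)) \<partial>law (kernel_pow K j x)) =
      (\<integral>\<^sup>+\<omega>. f (drop_seq s (snd \<omega>)) \<partial>law (kernel_pow K (Suc j) x))"
    using nn_integral_law_drop_Suc_0[OF kernel_pow_prob fs] by (simp add: drop_seq_drop_seq)
  then show ?case
    using Suc.IH[of "Suc j"] by simp
qed simp

lemma mean_drop:
  assumes f [measurable]: "f \<in> borel_measurable seqs" and B: "\<And>y. f y \<in> {0..B}"
  shows "mean (K x) (\<lambda>y. f (drop_seq s y)) = mean (kernel_pow K (Suc s) x) f"
proof -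
  have "ennreal (mean (K x) (\<lambda>y. f (drop_seq s y))) = ennreal (mean (kernel_pow K (Suc s) x) f)"
    using nn_integral_law_drop[where f="\<lambda>y. ennreal (f y)" and s=s and j="Suc 0" and x=x]
      nn_integral_law_eq_mean[OF K_prob, of "\<lambda>y. f (drop_seq s y)" B]
      nn_integral_law_eq_mean[OF kernel_pow_prob f B] B
    unfolding kernel_pow_1 by (simp del: kernel_pow.simps)
  then show ?thesis
    using mean_bounds[OF K_prob, of "\<lambda>y. f (drop_seq s y)" B] mean_bounds[OF kernel_pow_prob f B] B
    by (subst (asm) ennreal_inj) (auto simp del: kernel_pow.simps)
qed

lemma mean_mixture:
  assumes m: "m \<in> space (prob_algebra borel)" and f [measurable]: "f \<in> borel_measurable seqs" and B: "\<And>y. f y \<in> {0..B}"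
  shows "mean m f = (\<integral>z. mean (return borel z) f \<partial>m)" and "integrable m (\<lambda>z. mean (return borel z) f)"
proof -
  interpret m: prob_space m by (rule m_prob[OF m])
  note m_sets[OF m, measurable_cong, simp]
  have bounds: "mean (return borel z) f \<in> {0..B}" for z
    by (rule mean_bounds[OF return_prob f B])
  have meas: "(\<lambda>z. mean (return borel z) f) \<in> borel_measurable m"
    by (rule measurable_mean[OF _ f B]) measurable
  show int: "integrable m (\<lambda>z. mean (return borel z) f)"
    by (rule m.integrable_const_bound[of _ B]) (use bounds meas in auto)
  have "ennreal (mean m f) = (\<integral>\<^sup>+z. ennreal (mean (return borel z) f) \<partial>m)"
    using nn_integral_law_mixture[OF m, of "\<lambda>y. ennreal (f y)"]
    by (simp add: nn_integral_law_eq_mean[OF m f B] nn_integral_law_eq_mean[OF return_prob f B])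
  also have "\<dots> = ennreal (\<integral>z. mean (return borel z) f \<partial>m)"
    using bounds by (intro nn_integral_eq_integral[OF int]) auto
  finally show "mean m f = (\<integral>z. mean (return borel z) f \<partial>m)"
    using bounds mean_bounds[OF m f B] by (subst (asm) ennreal_inj) (auto intro!: integral_nonneg_AE)
qed

lemma tv_dist_ge:
  fixes M N :: "'x measure" and h :: "'x \<Rightarrow> real"
  assumes M: "M \<in> space (prob_algebra borel)" and N: "N \<in> space (prob_algebra borel)"
    and h: "h \<in> borel_measurable borel" and h1: "\<And>x. \<bar>h x\<bar> \<le> 1"
  shows "\<bar>(\<integral>x. h x \<partial>M) - (\<integral>x. h x \<partial>N)\<bar> \<le> tv_dist M N"
proof -
  have le: "\<bar>\<integral>x. h x \<partial>P\<bar> \<le> 1"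
    if P: "P \<in> space (prob_algebra borel)" and h: "h \<in> borel_measurable borel" and h1: "\<forall>x. \<bar>h x\<bar> \<le> 1"
    for P and h :: "'x \<Rightarrow> real"
  proof -
    interpret P: prob_space P by (rule m_prob[OF P])
    have "integrable P h"
      by (rule P.integrable_const_bound[of _ 1]) (use h h1 in \<open>auto simp: measurable_cong_sets[OF m_sets[OF P] refl]\<close>)
    then have "\<bar>\<integral>x. h x \<partial>P\<bar> \<le> (\<integral>x. \<bar>h x\<bar> \<partial>P)" "(\<integral>x. \<bar>h x\<bar> \<partial>P) \<le> 1"
      using h1 by (auto intro!: P.integral_le_const)
    then show ?thesis by linarith
  qed
  show ?thesis
    unfolding tv_dist_def
  proof (rule cSUP_upper)
    show "h \<in> {h :: 'x \<Rightarrow> real. h \<in> borel_measurable M \<and> (\<forall>x. \<bar>h x\<bar> \<le> 1)}"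
      using h h1 by (simp add: measurable_cong_sets[OF m_sets[OF M] refl])
    show "bdd_above ((\<lambda>h :: 'x \<Rightarrow> real. \<bar>(\<integral>x. h x \<partial>M) - (\<integral>x. h x \<partial>N)\<bar>) ` {h \<in> borel_measurable M. \<forall>x. \<bar>h x\<bar> \<le> 1})"
    proof (rule bdd_aboveI2)
      fix h :: "'x \<Rightarrow> real" assume "h \<in> {h \<in> borel_measurable M. \<forall>x. \<bar>h x\<bar> \<le> 1}"
      then show "\<bar>(\<integral>x. h x \<partial>M) - (\<integral>x. h x \<partial>N)\<bar> \<le> 2"
        using le[OF M, of h] le[OF N, of h] by (simp add: measurable_cong_sets[OF m_sets[OF M] refl])
    qed
  qed
qed

text \<open>
  If \<open>\<phi>\<close> takes values in \<open>[0, 1]\<close>, then \<open>2 \<phi> - 1\<close> is a test function for the total variation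
  norm. This gains the factor 2.
\<close>

lemma mean_diff_le_tv_dist:
  assumes M: "M \<in> space (prob_algebra borel)" and N: "N \<in> space (prob_algebra borel)"
    and f: "f \<in> borel_measurable seqs" and f01: "\<And>y. f y \<in> {0..1}"
  shows "\<bar>mean M f - mean N f\<bar> \<le> tv_dist M N / 2"
proof -
  let ?\<phi> = "\<lambda>z. mean (return borel z) f"
  have bounds: "?\<phi> z \<in> {0..1}" for z
    by (rule mean_bounds[OF return_prob f f01])
  have \<phi>: "?\<phi> \<in> borel_measurable borel"
    by (rule measurable_mean[OF _ f f01]) measurable
  have eq: "(\<integral>z. 2 * ?\<phi> z - 1 \<partial>P) = 2 * mean P f - 1" if P: "P \<in> space (prob_algebra borel)" for P
  proof -
    interpret P: prob_space P by (rule m_prob[OF P])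
    show ?thesis
      using mean_mixture[OF P f f01] by (simp add: P.prob_space)
  qed
  have "\<bar>(\<integral>z. 2 * ?\<phi> z - 1 \<partial>M) - (\<integral>z. 2 * ?\<phi> z - 1 \<partial>N)\<bar> \<le> tv_dist M N"
    using \<phi> bounds by (intro tv_dist_ge[OF M N]) (measurable, auto simp: abs_le_iff)
  then show ?thesis
    unfolding eq[OF M] eq[OF N] by linarith
qed

text \<open>
  The block number \<open>j\<close>, counted from 0, starts \<open>j * l + 1\<close> kernel steps after \<open>x\<close>. Summing the mixing
  bounds gives a geometric series; replacing \<open>l\<close> by 1 only increases it.
\<close>

lemma mean_block_sum_near_stationary:
  assumes f [measurable]: "f \<in> borel_measurable seqs" and f01: "\<And>y. f y \<in> {0..1}"
    and \<mu>: "\<mu> \<in> space (prob_algebra borel)"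
    and mix: "\<And>j x. 1 \<le> j \<Longrightarrow> tv_dist (kernel_pow K j x) \<mu> \<le> R / \<rho> ^ j"
    and \<rho>: "\<rho> > 1" and R: "R \<ge> 0"
  shows "\<bar>mean (K x) (block_sum (Suc p) f k) - real k * mean \<mu> f\<bar> \<le> R / (2 * (\<rho> - 1))"
proof -
  have "mean (K x) (block_sum (Suc p) f k) = (\<Sum>j<k. mean (K x) (\<lambda>y. f (drop_seq (j * Suc p) y)))"
    unfolding mean_def block_sum_def
    by (rule Bochner_Integration.integral_sum)
      (rule integrable_law_snd[OF K_prob _ f01], measurable)
  also have "\<dots> = (\<Sum>j<k. mean (kernel_pow K (Suc (j * Suc p)) x) f)"
    by (simp only: mean_drop[OF f f01])
  finally have "\<bar>mean (K x) (block_sum (Suc p) f k) - real k * mean \<mu> f\<bar> =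
      \<bar>\<Sum>j<k. mean (kernel_pow K (Suc (j * Suc p)) x) f - mean \<mu> f\<bar>"
    by (simp add: sum_subtractf)
  also have "\<dots> \<le> (\<Sum>j<k. \<bar>mean (kernel_pow K (Suc (j * Suc p)) x) f - mean \<mu> f\<bar>)"
    by (rule sum_abs)
  also have "\<dots> \<le> (\<Sum>j<k. R / (2 * \<rho>) * (1 / \<rho>) ^ j)"
  proof (rule sum_mono)
    fix j
    have "\<bar>mean (kernel_pow K (Suc (j * Suc p)) x) f - mean \<mu> f\<bar> \<le> tv_dist (kernel_pow K (Suc (j * Suc p)) x) \<mu> / 2"
      by (rule mean_diff_le_tv_dist[OF kernel_pow_prob \<mu> f f01])
    also have "\<dots> \<le> R / \<rho> ^ Suc (j * Suc p) / 2"
      using mix[of "Suc (j * Suc p)" x] by simp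
    also have "\<dots> \<le> R / \<rho> ^ Suc j / 2"
      using \<rho> R by (intro divide_right_mono divide_left_mono power_increasing mult_pos_pos) auto
    also have "\<dots> = R / (2 * \<rho>) * (1 / \<rho>) ^ j"
      using \<rho> by (simp add: field_simps)
    finally show "\<bar>mean (kernel_pow K (Suc (j * Suc p)) x) f - mean \<mu> f\<bar> \<le> R / (2 * \<rho>) * (1 / \<rho>) ^ j" .
  qed
  also have "\<dots> = R / (2 * \<rho>) * (\<Sum>j<k. (1 / \<rho>) ^ j)"
    by (simp add: sum_distrib_left)
  also have "\<dots> \<le> R / (2 * \<rho>) * (1 / (1 - 1 / \<rho>))"
  proof (rule mult_left_mono)
    have "(1 - 1 / \<rho>) * (\<Sum>j<k. (1 / \<rho>) ^ j) \<le> 1"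
      using \<rho> by (simp flip: one_diff_power_eq)
    then show "(\<Sum>j<k. (1 / \<rho>) ^ j) \<le> 1 / (1 - 1 / \<rho>)"
      using \<rho> by (simp add: pos_le_divide_eq mult.commute)
  qed (use \<rho> R in simp)
  also have "\<dots> = R / (2 * (\<rho> - 1))"
    using \<rho> by (simp add: field_simps)
  finally show ?thesis .
qed

end

section \<open>Tests that separate the true parameter from distant ones\<close>

context hidden_markov
begin

lemma mean_block_sum_stationary:
  assumes f [measurable]: "f \<in> borel_measurable seqs" and f01: "\<And>y. f y \<in> {0..1}"
    and \<mu>: "\<mu> \<in> space (prob_algebra borel)" and stat: "\<mu> \<bind> K = \<mu>"
  shows "mean \<mu> (block_sum l f k) = real k * mean \<mu> f"
proof -
  have "(\<integral>\<^sup>+\<omega>. ennreal (f (drop_seq s (snd \<omega>))) \<partial>law \<mu>) = (\<integral>\<^sup>+\<omega>. ennreal (f (snd \<omega>)) \<partial>law \<mu>)" for s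
  proof (induction s)
    case (Suc s)
    have "(\<integral>\<^sup>+\<omega>. ennreal (f (drop_seq (Suc s) (snd \<omega>))) \<partial>law \<mu>) =
        (\<integral>\<^sup>+\<omega>. ennreal (f (drop_seq s (snd \<omega>))) \<partial>law \<mu>)"
      using nn_integral_law_drop_Suc_0[OF \<mu>, of "\<lambda>y. ennreal (f (drop_seq s y))"]
      by (simp add: drop_seq_drop_seq stat)
    then show ?case using Suc.IH by simp
  qed simp
  then have "ennreal (mean \<mu> (\<lambda>y. f (drop_seq s y))) = ennreal (mean \<mu> f)" for s
    using nn_integral_law_eq_mean[OF \<mu>, of "\<lambda>y. f (drop_seq s y)" 1] nn_integral_law_eq_mean[OF \<mu> f f01] f01
    by simp
  moreover have "0 \<le> mean \<mu> (\<lambda>y. f (drop_seq s y))" for s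
    using mean_bounds[OF \<mu>, of "\<lambda>y. f (drop_seq s y)" 1] f01 by simp
  ultimately have eq: "mean \<mu> (\<lambda>y. f (drop_seq s y)) = mean \<mu> f" for s
    using mean_bounds[OF \<mu> f f01] by (metis atLeastAtMost_iff ennreal_inj)
  have "mean \<mu> (block_sum l f k) = (\<Sum>j<k. mean \<mu> (\<lambda>y. f (drop_seq (j * l) y)))"
    unfolding mean_def block_sum_def
    by (rule Bochner_Integration.integral_sum)
      (rule integrable_law_snd[OF \<mu> _ f01], measurable)
  then show ?thesis
    by (simp add: eq)
qed

lemma measurable_lik_obs_ref:
  assumes "m \<in> space (prob_algebra borel)"
  shows "lik n m \<in> borel_measurable (obs_ref n)"
proof (rule measurable_obs_ref)
  show "lik n m \<in> borel_measurable seqs"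
    by (rule measurable_lik) (use assms in simp_all)
qed

lemma nn_integral_lik:
  assumes m: "m \<in> space (prob_algebra borel)"
  shows "(\<integral>\<^sup>+y. lik n m y \<partial>obs_ref n) = 1"
proof -
  interpret P: prob_space "law m" by (rule prob_space_law[OF m])
  show ?thesis
    using nn_integral_law_lik[OF m, of "\<lambda>_. 1" n] P.emeasure_space_1 by (simp add: depends_below_def)
qed

lemma AE_lik_finite:
  assumes m: "m \<in> space (prob_algebra borel)"
  shows "AE y in obs_ref n. lik n m y \<noteq> \<infinity>"
  using measurable_lik_obs_ref[OF m] nn_integral_lik[OF m] by (intro nn_integral_PInf_AE) auto

definition dens :: "nat \<Rightarrow> 'x measure \<Rightarrow> (nat \<Rightarrow> 'y) \<Rightarrow> real" where
  "dens n m y = enn2real (lik n m y)"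

lemma dens_nonneg: "dens n m y \<ge> 0"
  by (simp add: dens_def)

lemma measurable_dens:
  assumes "m \<in> space (prob_algebra borel)"
  shows "dens n m \<in> borel_measurable seqs"
proof -
  have "lik n m \<in> borel_measurable seqs"
    by (rule measurable_lik) (use assms in simp_all)
  then show ?thesis
    unfolding dens_def[abs_def] by measurable
qed

lemma depends_below_dens: "depends_below n (dens n m)"
  using depends_below_lik[of n m] unfolding depends_below_def dens_def by metis

text \<open>
  The likelihood may be infinite on a null set, where its real value is 0.
\<close>

lemma mean_eq_integral_dens:
  assumes m: "m \<in> space (prob_algebra borel)" and f [measurable]: "f \<in> borel_measurable seqs" and B: "\<And>y. f y \<in> {0..B}"
    and dep: "depends_below n f"
  shows "mean m f = (\<integral>y. dens n m y * f y \<partial>obs_ref n)"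
    and "integrable (obs_ref n) (\<lambda>y. dens n m y * f y)"
proof -
  have "ennreal (mean m f) = (\<integral>\<^sup>+y. lik n m y * ennreal (f y) \<partial>obs_ref n)"
    unfolding nn_integral_law_eq_mean[OF m f B, symmetric]
  proof (rule nn_integral_law_lik[OF m])
    show "depends_below n (\<lambda>y. ennreal (f y))"
      using dep unfolding depends_below_def by metis
  qed measurable
  also have "\<dots> = (\<integral>\<^sup>+y. ennreal (dens n m y * f y) \<partial>obs_ref n)"
  proof (rule nn_integral_cong_AE)
    show "AE y in obs_ref n. lik n m y * ennreal (f y) = ennreal (dens n m y * f y)"
      using AE_lik_finite[OF m]
      by eventually_elim (use B in \<open>simp add: dens_def ennreal_mult ennreal_enn2real less_top\<close>)
  qed
  finally have eq: "(\<integral>\<^sup>+y. ennreal (dens n m y * f y) \<partial>obs_ref n) = ennreal (mean m f)" ..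
  have [measurable]: "dens n m \<in> borel_measurable seqs"
    by (rule measurable_dens[OF m])
  have meas: "(\<lambda>y. dens n m y * f y) \<in> borel_measurable (obs_ref n)"
    by (rule measurable_obs_ref) measurable
  have nonneg: "0 \<le> dens n m y * f y" for y
    using B dens_nonneg by simp
  show int: "integrable (obs_ref n) (\<lambda>y. dens n m y * f y)"
    by (rule integrableI_nn_integral_finite[OF meas _ eq]) (simp add: nonneg)
  have "ennreal (\<integral>y. dens n m y * f y \<partial>obs_ref n) = ennreal (mean m f)"
    using nn_integral_eq_integral[OF int] nonneg eq by simp
  then show "mean m f = (\<integral>y. dens n m y * f y \<partial>obs_ref n)"
    using mean_bounds[OF m f B] nonneg by (subst (asm) ennreal_inj) (auto intro!: integral_nonneg_AE)
qed

lemma integrable_dens: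
  assumes "m \<in> space (prob_algebra borel)"
  shows "integrable (obs_ref n) (dens n m)"
  using mean_eq_integral_dens(2)[OF assms, of "\<lambda>_. 1" 1 n] by (simp add: depends_below_def)

lemma integral_dens:
  assumes m: "m \<in> space (prob_algebra borel)"
  shows "(\<integral>y. dens n m y \<partial>obs_ref n) = 1"
proof -
  interpret P: prob_space "law m" by (rule prob_space_law[OF m])
  show ?thesis
    using mean_eq_integral_dens(1)[OF m, of "\<lambda>_. 1" 1 n] P.prob_space by (simp add: depends_below_def mean_def)
qed

end

context hmm_setting
begin

abbreviation start_law :: "'a \<Rightarrow> 'x measure \<Rightarrow> ((nat \<Rightarrow> 'x) \<times> (nat \<Rightarrow> 'y)) measure" where
  "start_law \<theta> \<equiv> hidden_markov.law (Ker H \<theta>) (Ref H) (Emi H \<theta>)"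

abbreviation start_mean :: "'a \<Rightarrow> 'x measure \<Rightarrow> ((nat \<Rightarrow> 'y) \<Rightarrow> real) \<Rightarrow> real" where
  "start_mean \<theta> \<equiv> hidden_markov.mean (Ker H \<theta>) (Ref H) (Emi H \<theta>)"

abbreviation obs_mean :: "'a \<Rightarrow> ((nat \<Rightarrow> 'y) \<Rightarrow> real) \<Rightarrow> real" where
  "obs_mean \<theta> \<equiv> start_mean \<theta> (Stat H \<theta>)"

abbreviation miss_prob :: "'a \<Rightarrow> 'x \<Rightarrow> (nat \<Rightarrow> 'y) set \<Rightarrow> real" where
  "miss_prob \<theta> x R \<equiv> \<P>(\<omega> in start_law \<theta> (Ker H \<theta> x). snd \<omega> \<notin> R)"

abbreviation ref_obs :: "nat \<Rightarrow> (nat \<Rightarrow> 'y) measure" where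
  "ref_obs n \<equiv> PiM {..<n} (\<lambda>_. Ref H)"

lemma hidden_markov_H: "\<theta> \<in> Par H \<Longrightarrow> hidden_markov (Ker H \<theta>) (Ref H) (Emi H \<theta>)"
  using kernel sigma_finite_Ref sets_Ref emission_measurable emission_density
  by (intro hidden_markov.intro markov_kernel.intro hidden_markov_axioms.intro) auto

lemma hmm_law_eq_start_law:
  assumes "\<theta> \<in> Par H"
  shows "hmm_law H \<theta> = start_law \<theta> (Stat H \<theta>)"
proof -
  interpret T: hidden_markov "Ker H \<theta>" "Ref H" "Emi H \<theta>" by (rule hidden_markov_H[OF assms])
  show ?thesis
    unfolding hmm_law_def T.law_def T.emit_seq_def T.emit_def emission_law_def ..
qed

lemma
  assumes "\<theta> \<in> Par H"
  shows integrable_obs_density: "integrable (ref_obs n) (obs_density H n \<theta>)"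
    and integral_obs_density: "(\<integral>y. obs_density H n \<theta> y \<partial>ref_obs n) = 1"
    and measurable_obs_density: "obs_density H n \<theta> \<in> borel_measurable seqs"
    and depends_below_obs_density: "depends_below n (obs_density H n \<theta>)"
proof -
  interpret T: hidden_markov "Ker H \<theta>" "Ref H" "Emi H \<theta>" by (rule hidden_markov_H[OF assms])
  have "obs_density H n \<theta> = T.dens n (Stat H \<theta>)"
    unfolding obs_density_def[abs_def] T.dens_def[abs_def] ..
  with T.integrable_dens[OF stat_prob[OF assms]] T.integral_dens[OF stat_prob[OF assms]]
    T.measurable_dens[OF stat_prob[OF assms]] T.depends_below_dens
  show "integrable (ref_obs n) (obs_density H n \<theta>)" "(\<integral>y. obs_density H n \<theta> y \<partial>ref_obs n) = 1"
    "obs_density H n \<theta> \<in> borel_measurable seqs" "depends_below n (obs_density H n \<theta>)"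
    by simp_all
qed

lemma obs_mean_eq:
  assumes "\<theta> \<in> Par H" and f: "f \<in> borel_measurable seqs" and B: "\<And>y. f y \<in> {0..B}" and dep: "depends_below n f"
  shows "obs_mean \<theta> f = (\<integral>y. obs_density H n \<theta> y * f y \<partial>ref_obs n)"
    and "integrable (ref_obs n) (\<lambda>y. obs_density H n \<theta> y * f y)"
proof -
  interpret T: hidden_markov "Ker H \<theta>" "Ref H" "Emi H \<theta>" by (rule hidden_markov_H[OF assms(1)])
  have "obs_density H n \<theta> = T.dens n (Stat H \<theta>)"
    unfolding obs_density_def[abs_def] T.dens_def[abs_def] ..
  with T.mean_eq_integral_dens[OF stat_prob[OF assms(1)] f B dep]
  show "obs_mean \<theta> f = (\<integral>y. obs_density H n \<theta> y * f y \<partial>ref_obs n)"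
    "integrable (ref_obs n) (\<lambda>y. obs_density H n \<theta> y * f y)"
    by simp_all
qed

text \<open>
  Both densities have integral 1, so \<open>f\<close> may be centred at \<open>1 / 2\<close>. This halves the bound on the
  difference in general and makes it an equality when \<open>f\<close> indicates where one density is larger.
\<close>

lemma obs_mean_diff:
  assumes \<theta>: "\<theta> \<in> Par H" and \<theta>': "\<theta>' \<in> Par H" and f: "f \<in> borel_measurable seqs" and f01: "\<And>y. f y \<in> {0..1}"
    and dep: "depends_below n f"
  shows "obs_mean \<theta> f - obs_mean \<theta>' f =
      (\<integral>y. (obs_density H n \<theta> y - obs_density H n \<theta>' y) * (f y - 1 / 2) \<partial>ref_obs n)"
    and "integrable (ref_obs n) (\<lambda>y. (obs_density H n \<theta> y - obs_density H n \<theta>' y) * (f y - 1 / 2))"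
proof -
  let ?p = "obs_density H n \<theta>" and ?q = "obs_density H n \<theta>'"
  note int = obs_mean_eq(2)[OF \<theta> f f01 dep] obs_mean_eq(2)[OF \<theta>' f f01 dep]
    integrable_obs_density[OF \<theta>, of n] integrable_obs_density[OF \<theta>', of n]
  have split: "(?p y - ?q y) * (f y - 1 / 2) = ?p y * f y - ?q y * f y - (?p y - ?q y) / 2" for y
    by (simp add: field_simps)
  show "integrable (ref_obs n) (\<lambda>y. (?p y - ?q y) * (f y - 1 / 2))"
    unfolding split using int by (intro Bochner_Integration.integrable_diff integrable_divide) auto
  show "obs_mean \<theta> f - obs_mean \<theta>' f = (\<integral>y. (?p y - ?q y) * (f y - 1 / 2) \<partial>ref_obs n)"
    unfolding split using int integral_obs_density[OF \<theta>, of n] integral_obs_density[OF \<theta>', of n]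
    by (simp add: obs_mean_eq(1)[OF \<theta> f f01 dep] obs_mean_eq(1)[OF \<theta>' f f01 dep])
qed

lemma integrable_dens_dist:
  assumes \<theta>: "\<theta> \<in> Par H" and \<theta>': "\<theta>' \<in> Par H"
  shows "integrable (ref_obs n) (\<lambda>y. \<bar>obs_density H n \<theta> y - obs_density H n \<theta>' y\<bar>)"
  using integrable_obs_density[OF \<theta>, of n] integrable_obs_density[OF \<theta>', of n] by simp

lemma obs_mean_diff_le:
  assumes \<theta>: "\<theta> \<in> Par H" and \<theta>': "\<theta>' \<in> Par H" and f: "f \<in> borel_measurable seqs" and f01: "\<And>y. f y \<in> {0..1}"
    and dep: "depends_below n f"
  shows "\<bar>obs_mean \<theta> f - obs_mean \<theta>' f\<bar> \<le> dens_dist H n \<theta> \<theta>' / 2"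
proof -
  let ?p = "obs_density H n \<theta>" and ?q = "obs_density H n \<theta>'"
  have "\<bar>obs_mean \<theta> f - obs_mean \<theta>' f\<bar> \<le> (\<integral>y. \<bar>(?p y - ?q y) * (f y - 1 / 2)\<bar> \<partial>ref_obs n)"
    unfolding obs_mean_diff(1)[OF assms] by (rule integral_abs_bound)
  also have "\<dots> \<le> (\<integral>y. \<bar>?p y - ?q y\<bar> / 2 \<partial>ref_obs n)"
  proof (rule integral_mono)
    fix y
    have "\<bar>f y - 1 / 2\<bar> \<le> 1 / 2"
      using f01[of y] unfolding abs_le_iff by auto
    then show "\<bar>(?p y - ?q y) * (f y - 1 / 2)\<bar> \<le> \<bar>?p y - ?q y\<bar> / 2"
      using mult_left_mono[of "\<bar>f y - 1 / 2\<bar>" "1 / 2" "\<bar>?p y - ?q y\<bar>"] by (simp add: abs_mult)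
  qed (use obs_mean_diff(2)[OF assms] integrable_dens_dist[OF \<theta> \<theta>'] in auto)
  also have "\<dots> = dens_dist H n \<theta> \<theta>' / 2"
    by (simp add: dens_dist_def)
  finally show ?thesis .
qed

lemma dens_dist_commute: "dens_dist H n \<theta> \<theta>' = dens_dist H n \<theta>' \<theta>"
  by (simp add: dens_dist_def abs_minus_commute)

lemma dens_dist_nonneg: "dens_dist H n \<theta> \<theta>' \<ge> 0"
  by (simp add: dens_dist_def)

lemma dens_dist_triangle:
  assumes "\<theta>1 \<in> Par H" "\<theta>2 \<in> Par H" "\<theta>3 \<in> Par H"
  shows "dens_dist H n \<theta>1 \<theta>3 \<le> dens_dist H n \<theta>1 \<theta>2 + dens_dist H n \<theta>2 \<theta>3"
proof -
  let ?d = "\<lambda>\<theta> \<theta>' y. \<bar>obs_density H n \<theta> y - obs_density H n \<theta>' y\<bar>"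
  note int = integrable_dens_dist[OF assms(1,2), of n] integrable_dens_dist[OF assms(2,3), of n]
  have "dens_dist H n \<theta>1 \<theta>3 \<le> (\<integral>y. ?d \<theta>1 \<theta>2 y + ?d \<theta>2 \<theta>3 y \<partial>ref_obs n)"
    unfolding dens_dist_def
    by (intro integral_mono Bochner_Integration.integrable_add int integrable_dens_dist assms(1,3)) linarith
  also have "\<dots> = dens_dist H n \<theta>1 \<theta>2 + dens_dist H n \<theta>2 \<theta>3"
    unfolding dens_dist_def by (rule Bochner_Integration.integral_add[OF int])
  finally show ?thesis .
qed

lemma dens_dist_le_2:
  assumes \<theta>: "\<theta> \<in> Par H" and \<theta>': "\<theta>' \<in> Par H"
  shows "dens_dist H n \<theta> \<theta>' \<le> 2"
proof -
  note int = integrable_obs_density[OF \<theta>, of n] integrable_obs_density[OF \<theta>', of n]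
  have "dens_dist H n \<theta> \<theta>' \<le> (\<integral>y. obs_density H n \<theta> y + obs_density H n \<theta>' y \<partial>ref_obs n)"
    unfolding dens_dist_def
  proof (rule integral_mono)
    fix y
    have "0 \<le> obs_density H n \<theta> y" "0 \<le> obs_density H n \<theta>' y"
      by (simp_all add: obs_density_def)
    then show "\<bar>obs_density H n \<theta> y - obs_density H n \<theta>' y\<bar> \<le> obs_density H n \<theta> y + obs_density H n \<theta>' y"
      by linarith
  qed (use int in simp_all)
  also have "\<dots> = 2"
    using int by (simp add: integral_obs_density[OF \<theta>] integral_obs_density[OF \<theta>'])
  finally show ?thesis .
qed

text \<open>
  The indicator of the Scheffe set of the two densities, on which their probabilities differ most.
\<close>

definition denser :: "nat \<Rightarrow> 'a \<Rightarrow> 'a \<Rightarrow> (nat \<Rightarrow> 'y) \<Rightarrow> real" where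
  "denser n \<theta> \<theta>' = indicator {y. obs_density H n \<theta>' y < obs_density H n \<theta> y}"

lemma denser_01: "denser n \<theta> \<theta>' y \<in> {0..1}"
  by (simp add: denser_def indicator_def)

lemma measurable_denser:
  assumes "\<theta> \<in> Par H" "\<theta>' \<in> Par H"
  shows "denser n \<theta> \<theta>' \<in> borel_measurable seqs"
proof -
  note [measurable] = measurable_obs_density[OF assms(1), of n] measurable_obs_density[OF assms(2), of n]
  have "{y \<in> space seqs. obs_density H n \<theta>' y < obs_density H n \<theta> y} \<in> sets seqs"
    by measurable
  then show ?thesis
    unfolding denser_def[abs_def] by simp
qed

lemma depends_below_denser:
  assumes "\<theta> \<in> Par H" "\<theta>' \<in> Par H"
  shows "depends_below n (denser n \<theta> \<theta>')"
  using depends_below_obs_density[OF assms(1), of n] depends_below_obs_density[OF assms(2), of n]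
  unfolding depends_below_def denser_def indicator_def mem_Collect_eq by metis

lemma obs_mean_denser:
  assumes \<theta>: "\<theta> \<in> Par H" and \<theta>': "\<theta>' \<in> Par H"
  shows "obs_mean \<theta> (denser n \<theta> \<theta>') - obs_mean \<theta>' (denser n \<theta> \<theta>') = dens_dist H n \<theta> \<theta>' / 2"
proof -
  have "(obs_density H n \<theta> y - obs_density H n \<theta>' y) * (denser n \<theta> \<theta>' y - 1 / 2) =
      \<bar>obs_density H n \<theta> y - obs_density H n \<theta>' y\<bar> / 2" for y
    by (auto simp: denser_def indicator_def field_simps)
  then show ?thesis
    unfolding obs_mean_diff(1)[OF \<theta> \<theta>' measurable_denser[OF \<theta> \<theta>'] denser_01 depends_below_denser[OF \<theta> \<theta>']]
    by (simp only: dens_dist_def integral_divide_zero)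
qed

definition mix_rate :: "'a \<Rightarrow> real" where
  "mix_rate \<theta> = (Rho H \<theta> - 1) / (2 * Rad H \<theta> + Rho H \<theta> - 1)"

text \<open>
  Half of the sum over \<open>j \<ge> 1\<close> of the mixing bounds \<open>R / \<rho> ^ j\<close>: a bound for the effect of the
  starting point on the expected sum over blocks.
\<close>

definition mix_bias :: "'a \<Rightarrow> real" where
  "mix_bias \<theta> = Rad H \<theta> / (2 * (Rho H \<theta> - 1))"

lemma mix_rate_le_1: "\<theta> \<in> Par H \<Longrightarrow> mix_rate \<theta> \<le> 1"
  using Rad_bounds[of \<theta>] Rho_ge_1[of \<theta>] by (simp add: mix_rate_def)

lemma mix_rate_nonneg: "\<theta> \<in> Par H \<Longrightarrow> 0 \<le> mix_rate \<theta>"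
  using Rad_bounds[of \<theta>] Rho_ge_1[of \<theta>] by (simp add: mix_rate_def)

lemma
  assumes "\<theta> \<in> Par H" "Rho H \<theta> > 1"
  shows mix_rate_pos: "mix_rate \<theta> > 0" and mix_bias_pos: "mix_bias \<theta> > 0"
    and mix_rate_eq: "1 / mix_rate \<theta> = 1 + 4 * mix_bias \<theta>"
  using assms Rad_bounds[of \<theta>] by (auto simp: mix_rate_def mix_bias_def field_simps)

lemma block_sum_near_obs_mean:
  assumes \<theta>: "\<theta> \<in> Par H" and \<rho>: "Rho H \<theta> > 1" and f: "f \<in> borel_measurable seqs" and f01: "\<And>y. f y \<in> {0..1}"
  shows "\<bar>start_mean \<theta> (Ker H \<theta> x) (block_sum (Suc p) f k) - real k * obs_mean \<theta> f\<bar> \<le> mix_bias \<theta>"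
proof -
  interpret T: hidden_markov "Ker H \<theta>" "Ref H" "Emi H \<theta>" by (rule hidden_markov_H[OF \<theta>])
  show ?thesis
    unfolding mix_bias_def
    by (rule T.mean_block_sum_near_stationary[OF f f01 stat_prob[OF \<theta>] mixing[OF \<theta>] \<rho>])
      (use Rad_bounds[OF \<theta>] in auto)
qed

text \<open>
  One step of the concentration argument ranges over an interval of length \<open>1 + 2 * mix_bias\<close>, which
  is below \<open>1 + 4 * mix_bias = 1 / mix_rate\<close>.
\<close>

lemma block_sum_tail:
  assumes \<theta>: "\<theta> \<in> Par H" and \<rho>: "Rho H \<theta> > 1" and f: "f \<in> borel_measurable seqs" and f01: "\<And>y. f y \<in> {0..1}"
    and dep: "depends_below (Suc p) f" and m: "m \<in> space (prob_algebra borel)" and t: "t > 0"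
  shows "measure (start_law \<theta> m) {\<omega> \<in> space (start_law \<theta> m).
      block_sum (Suc p) f k (snd \<omega>) \<ge> start_mean \<theta> m (block_sum (Suc p) f k) + real k * t}
    \<le> exp (- 2 * real k * (t * mix_rate \<theta>)\<^sup>2)"
proof -
  interpret T: hidden_markov "Ker H \<theta>" "Ref H" "Emi H \<theta>" by (rule hidden_markov_H[OF \<theta>])
  let ?c = "1 + 2 * mix_bias \<theta>"
  have c: "0 < ?c" "?c \<le> 1 / mix_rate \<theta>"
    using mix_bias_pos[OF \<theta> \<rho>] by (auto simp: mix_rate_eq[OF \<theta> \<rho>])
  then have "mix_rate \<theta> \<le> 1 / ?c"
    using mix_rate_pos[OF \<theta> \<rho>] by (simp add: field_simps)
  then have "(t * mix_rate \<theta>)\<^sup>2 \<le> (t * (1 / ?c))\<^sup>2"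
    using t mix_rate_nonneg[OF \<theta>] by (intro power_mono mult_left_mono) auto
  then have "real k * (t * mix_rate \<theta>)\<^sup>2 \<le> real k * (t\<^sup>2 / ?c\<^sup>2)"
    by (intro mult_left_mono) (simp_all add: power_divide)
  then have "exp (- 2 * real k * t\<^sup>2 / ?c\<^sup>2) \<le> exp (- 2 * real k * (t * mix_rate \<theta>)\<^sup>2)"
    by simp
  moreover have "measure (start_law \<theta> m) {\<omega> \<in> space (start_law \<theta> m).
      block_sum (Suc p) f k (snd \<omega>) \<ge> start_mean \<theta> m (block_sum (Suc p) f k) + real k * t}
      \<le> exp (- 2 * real k * t\<^sup>2 / ?c\<^sup>2)"
    by (rule T.block_sum_upper_tail[OF f f01 dep t block_sum_near_obs_mean[OF \<theta> \<rho> f f01] m])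
  ultimately show ?thesis by linarith
qed

lemma block_sum_complement: "block_sum l (\<lambda>y. 1 - f y) k y = real k - block_sum l f k y"
  by (simp add: block_sum_def sum_subtractf)

text \<open>
  Reject if for some centre \<open>t\<close> the frequency of blocks on which \<open>t\<close> is denser than \<open>\<theta>\<^sub>0\<close> exceeds its
  \<open>\<theta>\<^sub>0\<close>-probability by \<open>s / 4\<close>. Let \<open>d\<close> be the distance from \<open>\<theta> \<in> G\<close> to \<open>\<theta>\<^sub>0\<close>. The centre near \<open>\<theta>\<close> gives a
  frequency whose expectation under \<open>\<theta>\<close> exceeds that under \<open>\<theta>\<^sub>0\<close> by at least \<open>d / 2 - s / 12\<close>, up to the
  bias of the starting point. As \<open>s \<le> d\<close>, at least \<open>d / 6\<close> remains above the threshold. Multiplied by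
  the weight of \<open>\<theta>\<close>, this is at least \<open>s / 6\<close>, and the bias per block at most \<open>1 / (4 k)\<close>.
\<close>

theorem separating_test:
  assumes \<theta>0: "\<theta>0 \<in> Par H" and \<rho>0: "Rho H \<theta>0 > 1"
    and T: "finite T" "T \<subseteq> Par H" and G: "G \<subseteq> Par H"
    and cover: "\<And>\<theta>. \<theta> \<in> G \<Longrightarrow> \<exists>t\<in>T. dens_dist H (Suc p) t \<theta> \<le> s / 12"
    and sep: "\<And>\<theta>. \<theta> \<in> G \<Longrightarrow> s \<le> weighted_dist H (Suc p) \<theta>0 \<theta>"
    and s: "s > 0" and ks: "3 < 2 * real k * s"
  obtains R where "R \<in> sets seqs" "depends_below (k * Suc p) (\<lambda>y. y \<in> R)"
    "\<P>(\<omega> in hmm_law H \<theta>0. snd \<omega> \<in> R) \<le>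
      real (card T) * exp (- real k * s\<^sup>2 * (mix_rate \<theta>0)\<^sup>2 / 8)"
    "\<And>\<theta> x. \<theta> \<in> G \<Longrightarrow> miss_prob \<theta> x R \<le>
      exp (- 2 * real k * (s / 6 - 1 / (4 * real k))\<^sup>2)"
proof
  let ?l = "Suc p"
  define h where "h t = denser ?l t \<theta>0" for t
  define E where "E t = {y. real k * (obs_mean \<theta>0 (h t) + s / 4) \<le> block_sum ?l (h t) k y}" for t
  define R where "R = (\<Union>t\<in>T. E t)"
  have k: "real k > 0"
    using ks s by (cases "k = 0") auto
  have h: "h t \<in> borel_measurable seqs" "\<And>y. h t y \<in> {0..1}" "depends_below ?l (h t)" if "t \<in> T" for t
    using that T(2) \<theta>0 unfolding h_def by (auto intro!: measurable_denser depends_below_denser denser_01 simp del: atLeastAtMost_iff)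
  have E_sets: "E t \<in> sets seqs" if "t \<in> T" for t
  proof -
    note [measurable] = h(1)[OF that]
    have "{y \<in> space seqs. real k * (obs_mean \<theta>0 (h t) + s / 4) \<le> block_sum ?l (h t) k y} \<in> sets seqs"
      by measurable
    then show ?thesis by (simp add: E_def)
  qed
  have E_dep: "depends_below (k * ?l) (\<lambda>y. y \<in> E t)" if "t \<in> T" for t
    using depends_below_block_sum[OF h(3)[OF that], of k] unfolding depends_below_def E_def mem_Collect_eq by metis
  show "R \<in> sets seqs"
    unfolding R_def using T(1) E_sets by auto
  show "depends_below (k * ?l) (\<lambda>y. y \<in> R)"
    using E_dep unfolding R_def depends_below_def by blast

  interpret M0: hidden_markov "Ker H \<theta>0" "Ref H" "Emi H \<theta>0" by (rule hidden_markov_H[OF \<theta>0])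
  interpret P0: prob_space "hmm_law H \<theta>0"
    unfolding hmm_law_eq_start_law[OF \<theta>0] by (rule M0.prob_space_law[OF stat_prob[OF \<theta>0]])
  have E0: "{\<omega> \<in> space (hmm_law H \<theta>0). snd \<omega> \<in> E t} \<in> P0.events" if "t \<in> T" for t
    unfolding hmm_law_eq_start_law[OF \<theta>0] by (rule M0.law_event[OF stat_prob[OF \<theta>0] E_sets[OF that]])
  have "\<P>(\<omega> in hmm_law H \<theta>0. snd \<omega> \<in> R) =
      measure (hmm_law H \<theta>0) (\<Union>t\<in>T. {\<omega> \<in> space (hmm_law H \<theta>0). snd \<omega> \<in> E t})"
    unfolding R_def by (intro arg_cong[where f="measure (hmm_law H \<theta>0)"]) auto
  also have "\<dots> \<le> (\<Sum>t\<in>T. \<P>(\<omega> in hmm_law H \<theta>0. snd \<omega> \<in> E t))"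
    using E0 by (intro P0.finite_measure_subadditive_finite T(1)) auto
  also have "\<dots> \<le> (\<Sum>t\<in>T. exp (- real k * s\<^sup>2 * (mix_rate \<theta>0)\<^sup>2 / 8))"
  proof (rule sum_mono)
    fix t assume t: "t \<in> T"
    have "\<P>(\<omega> in hmm_law H \<theta>0. snd \<omega> \<in> E t) \<le> exp (- 2 * real k * (s / 4 * mix_rate \<theta>0)\<^sup>2)"
      using block_sum_tail[OF \<theta>0 \<rho>0 h[OF t] stat_prob[OF \<theta>0], of "s / 4" k] s
      by (simp add: hmm_law_eq_start_law[OF \<theta>0] E_def distrib_left
          M0.mean_block_sum_stationary[OF h(1,2)[OF t] stat_prob[OF \<theta>0] stationary[OF \<theta>0]])
    also have "- 2 * real k * (s / 4 * mix_rate \<theta>0)\<^sup>2 = - real k * s\<^sup>2 * (mix_rate \<theta>0)\<^sup>2 / 8"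
      by (simp add: power_mult_distrib power_divide)
    finally show "\<P>(\<omega> in hmm_law H \<theta>0. snd \<omega> \<in> E t) \<le> exp (- real k * s\<^sup>2 * (mix_rate \<theta>0)\<^sup>2 / 8)" .
  qed
  finally show "\<P>(\<omega> in hmm_law H \<theta>0. snd \<omega> \<in> R) \<le>
      real (card T) * exp (- real k * s\<^sup>2 * (mix_rate \<theta>0)\<^sup>2 / 8)"
    by simp

  fix \<theta> x assume \<theta>G: "\<theta> \<in> G"
  then have \<theta>: "\<theta> \<in> Par H" using G by auto
  obtain t where t: "t \<in> T" "dens_dist H ?l t \<theta> \<le> s / 12"
    using cover[OF \<theta>G] by auto
  then have tP: "t \<in> Par H" using T by auto
  let ?m = "Ker H \<theta> x" and ?d = "dens_dist H ?l \<theta> \<theta>0"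
  \<comment> \<open>the complementary indicator turns the lower tail into an upper tail\<close>
  let ?h' = "\<lambda>y. 1 - h t y" and ?\<kappa> = "mix_rate \<theta>" and ?b = "mix_bias \<theta>"
  have d: "s \<le> ?d * ?\<kappa>"
    using sep[OF \<theta>G] by (simp add: weighted_dist_def mix_rate_def)
  have \<rho>: "Rho H \<theta> > 1"
  proof (rule ccontr)
    assume "\<not> Rho H \<theta> > 1"
    then have "?\<kappa> = 0" using Rho_ge_1[OF \<theta>] by (simp add: mix_rate_def)
    with d s show False by simp
  qed
  note \<kappa> = mix_rate_pos[OF \<theta> \<rho>]
  have ds: "s \<le> ?d"
    using d mult_left_mono[OF mix_rate_le_1[OF \<theta>] dens_dist_nonneg[of ?l \<theta> \<theta>0]] by simp
  interpret M: hidden_markov "Ker H \<theta>" "Ref H" "Emi H \<theta>" by (rule hidden_markov_H[OF \<theta>])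
  have h': "?h' \<in> borel_measurable seqs" "\<And>y. ?h' y \<in> {0..1}" "depends_below ?l ?h'"
  proof -
    show "?h' \<in> borel_measurable seqs"
      using h(1)[OF t(1)] by simp
    show "?h' y \<in> {0..1}" for y
      using h(2)[OF t(1), of y] by simp
    show "depends_below ?l ?h'"
      using h(3)[OF t(1)] unfolding depends_below_def by metis
  qed
  have gap: "?d / 2 - s / 12 \<le> obs_mean \<theta> (h t) - obs_mean \<theta>0 (h t)"
  proof -
    have "obs_mean t (h t) - obs_mean \<theta>0 (h t) = dens_dist H ?l t \<theta>0 / 2"
      unfolding h_def by (rule obs_mean_denser[OF tP \<theta>0])
    moreover have "\<bar>obs_mean t (h t) - obs_mean \<theta> (h t)\<bar> \<le> dens_dist H ?l t \<theta> / 2"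
      by (rule obs_mean_diff_le[OF tP \<theta> h[OF t(1)]])
    moreover have "?d \<le> dens_dist H ?l \<theta> t + dens_dist H ?l t \<theta>0"
      by (rule dens_dist_triangle[OF \<theta> tP \<theta>0])
    ultimately show ?thesis
      using t(2) dens_dist_commute[of ?l \<theta> t] by linarith
  qed
  \<comment> \<open>a lower bound for the deviation per block beyond the threshold\<close>
  define u where "u = (s / 6 - 1 / (4 * real k)) / ?\<kappa>"
  have u: "u > 0" "u * ?\<kappa> = s / 6 - 1 / (4 * real k)"
    using \<kappa> ks k by (simp_all add: u_def field_simps)
  have mean_h': "start_mean \<theta> ?m (block_sum ?l ?h' k) \<le> real k - real k * obs_mean \<theta> (h t) + ?b"
  proof -
    have "start_mean \<theta> ?m (block_sum ?l ?h' k) = real k - start_mean \<theta> ?m (block_sum ?l (h t) k)"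
    proof -
      interpret P: prob_space "start_law \<theta> ?m" by (rule M.prob_space_law[OF M.K_prob])
      have "integrable (start_law \<theta> ?m) (\<lambda>\<omega>. block_sum ?l (h t) k (snd \<omega>))"
        by (rule M.integrable_law_snd[OF M.K_prob measurable_block_sum[OF h(1)[OF t(1)]] block_sum_bounds[OF h(2)[OF t(1)]]])
      then show ?thesis
        unfolding M.mean_def block_sum_complement by (simp add: P.prob_space)
    qed
    then show ?thesis
      using block_sum_near_obs_mean[OF \<theta> \<rho> h(1,2)[OF t(1)], of x p k] by linarith
  qed
  have key: "start_mean \<theta> ?m (block_sum ?l ?h' k) + real k * u \<le> real k - real k * (obs_mean \<theta>0 (h t) + s / 4)"
  proof -
    have "4 * ?b \<le> 1 / ?\<kappa>"
      by (simp add: mix_rate_eq[OF \<theta> \<rho>])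
    moreover have "s / ?\<kappa> \<le> ?d"
      using d \<kappa> by (simp add: field_simps)
    moreover have "u = s / ?\<kappa> / 6 - 1 / ?\<kappa> / (4 * real k)"
      by (simp add: u_def diff_divide_distrib mult.commute)
    moreover have "real k * (s / ?\<kappa> / 6 - 1 / ?\<kappa> / (4 * real k)) = real k * (s / ?\<kappa>) / 6 - 1 / ?\<kappa> / 4"
      using k by (simp add: right_diff_distrib)
    ultimately have ku: "real k * u + ?b \<le> real k * ?d / 6"
      using k mult_left_mono[of "s / ?\<kappa>" ?d "real k"] by simp
    have "?d / 6 \<le> obs_mean \<theta> (h t) - obs_mean \<theta>0 (h t) - s / 4"
      using gap ds by linarith
    then have "real k * (?d / 6) \<le> real k * (obs_mean \<theta> (h t) - obs_mean \<theta>0 (h t) - s / 4)"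
      using k by (intro mult_left_mono) auto
    then show ?thesis
      using ku mean_h' by (simp add: algebra_simps)
  qed
  interpret P: prob_space "start_law \<theta> ?m" by (rule M.prob_space_law[OF M.K_prob])
  have "\<P>(\<omega> in start_law \<theta> ?m. snd \<omega> \<notin> R) \<le>
      measure (start_law \<theta> ?m) {\<omega> \<in> space (start_law \<theta> ?m).
        block_sum ?l ?h' k (snd \<omega>) \<ge> start_mean \<theta> ?m (block_sum ?l ?h' k) + real k * u}"
  proof (rule P.finite_measure_mono)
    show "{\<omega> \<in> space (start_law \<theta> ?m). snd \<omega> \<notin> R} \<subseteq> {\<omega> \<in> space (start_law \<theta> ?m).
        block_sum ?l ?h' k (snd \<omega>) \<ge> start_mean \<theta> ?m (block_sum ?l ?h' k) + real k * u}"
      using key t(1) by (auto simp: R_def E_def block_sum_complement)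
    have "(\<lambda>\<omega>. block_sum ?l ?h' k (snd \<omega>)) \<in> borel_measurable (start_law \<theta> ?m)"
      by (rule M.measurable_law_snd[OF M.K_prob measurable_block_sum[OF h'(1)]])
    then show "{\<omega> \<in> space (start_law \<theta> ?m).
        block_sum ?l ?h' k (snd \<omega>) \<ge> start_mean \<theta> ?m (block_sum ?l ?h' k) + real k * u} \<in> P.events"
      by (rule borel_measurable_le[OF borel_measurable_const])
  qed
  also have "\<dots> \<le> exp (- 2 * real k * (u * ?\<kappa>)\<^sup>2)"
    by (rule block_sum_tail[OF \<theta> \<rho> h' M.K_prob u(1)])
  finally show "\<P>(\<omega> in start_law \<theta> ?m. snd \<omega> \<notin> R) \<le>
      exp (- 2 * real k * (s / 6 - 1 / (4 * real k))\<^sup>2)"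
    by (simp only: u(2))
qed

end

section \<open>Likelihood ratios under the true law\<close>

text \<open>
  Differences of equal infinities are \<open>\<infinity>\<close> in the extended reals, so a finite bound on the difference
  also excludes likelihoods that are 0 or infinite.
\<close>

lemma cond_loglik_close:
  assumes "\<bar>cond_loglik H n \<theta> x y - cond_loglik H n \<theta>' x' y\<bar> \<le> ereal A"
  shows "cond_lik H n \<theta> x y \<le> ennreal (exp A) * cond_lik H n \<theta>' x' y"
    and "cond_lik H n \<theta>' x' y \<noteq> 0" and "cond_lik H n \<theta>' x' y \<noteq> \<infinity>"
proof -
  let ?a = "cond_lik H n \<theta> x y" and ?b = "cond_lik H n \<theta>' x' y"
  have fin: "?a \<noteq> 0" "?a \<noteq> \<infinity>" "?b \<noteq> 0" "?b \<noteq> \<infinity>"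
    using assms by (auto simp: cond_loglik_def split: if_splits)
  then show "?b \<noteq> 0" "?b \<noteq> \<infinity>" by auto
  obtain a b where ab: "?a = ennreal a" "?b = ennreal b" "a \<ge> 0" "b \<ge> 0"
    using fin by (cases ?a; cases ?b) auto
  then have pos: "a > 0" "b > 0"
    using fin by auto
  have "ln a - ln b \<le> A"
    using assms fin ab by (simp add: cond_loglik_def)
  then have "a \<le> exp A * b"
    using pos by (metis diff_le_eq exp_add exp_le_cancel_iff exp_ln)
  then show "?a \<le> ennreal (exp A) * ?b"
    using pos by (simp add: ab ennreal_mult'[symmetric] ennreal_leI)
qed

lemma cond_loglik_diff_le:
  assumes "cond_lik H n \<theta> x y < ennreal (exp (- v)) * cond_lik H n \<theta>' x' y"
    and b: "cond_lik H n \<theta>' x' y \<noteq> 0" "cond_lik H n \<theta>' x' y \<noteq> \<infinity>"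
  shows "cond_loglik H n \<theta> x y - cond_loglik H n \<theta>' x' y \<le> ereal (- v)"
proof (cases "cond_lik H n \<theta> x y = 0")
  case False
  let ?a = "cond_lik H n \<theta> x y" and ?b = "cond_lik H n \<theta>' x' y"
  have "?a \<noteq> \<infinity>"
    using assms(1) by auto
  then obtain a b where ab: "?a = ennreal a" "?b = ennreal b" "a \<ge> 0" "b \<ge> 0"
    using b by (cases ?a; cases ?b) auto
  then have pos: "a > 0" "b > 0"
    using False b by auto
  have "a < exp (- v) * b"
    using assms(1) pos by (simp add: ab ennreal_mult'[symmetric] ennreal_less_iff)
  then have "ln a < ln (exp (- v) * b)"
    using pos by simp
  then have "ln a - ln b \<le> - v"
    using pos by (simp add: ln_mult)
  then show ?thesis
    using \<open>?a \<noteq> \<infinity>\<close> False b ab by (simp add: cond_loglik_def)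
qed (use b in \<open>simp add: cond_loglik_def\<close>)

context hmm_setting
begin

lemma space_Prior: "space (Prior H) = Par H"
  using sets_eq_imp_space_eq[OF sets_Prior] by (simp add: space_restrict_space)

lemma Par_if_full_prior: "z \<in> space (full_prior H) \<Longrightarrow> fst z \<in> Par H"
  by (auto simp: space_pair_measure space_Prior)

lemma prob_space_full_prior: "prob_space (full_prior H)"
  by (rule prob_space_pair[OF prior_prob init_prob])

lemma measurable_cond_lik_full:
  "(\<lambda>p. cond_lik H n (fst (fst p)) (snd (fst p)) (snd p)) \<in> borel_measurable (full_prior H \<Otimes>\<^sub>M seqs)"
proof -
  have "(\<lambda>p. (fst (fst p), snd (fst p), snd p)) \<in> full_prior H \<Otimes>\<^sub>M seqs \<rightarrow>\<^sub>M Prior H \<Otimes>\<^sub>M Init H \<Otimes>\<^sub>M seqs"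
    by measurable
  moreover have eq: "sets (Prior H \<Otimes>\<^sub>M Init H \<Otimes>\<^sub>M seqs) = sets (Prior H \<Otimes>\<^sub>M borel \<Otimes>\<^sub>M seqs)"
    by (intro sets_pair_measure_cong refl sets_Init)
  ultimately have "(\<lambda>p. (fst (fst p), snd (fst p), snd p)) \<in> full_prior H \<Otimes>\<^sub>M seqs \<rightarrow>\<^sub>M Prior H \<Otimes>\<^sub>M borel \<Otimes>\<^sub>M seqs"
    by (simp only: measurable_cong_sets[OF refl eq])
  from measurable_compose[OF this likelihood_measurable[of n]] show ?thesis
    by simp
qed

lemma measurable_cond_lik_prior:
  "(\<lambda>z. cond_lik H n (fst z) (snd z) y) \<in> borel_measurable (full_prior H)"
  using measurable_compose[OF measurable_Pair2'[of y seqs "full_prior H"] measurable_cond_lik_full[of n]] by simp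

lemma
  assumes \<theta>: "\<theta> \<in> Par H"
  shows measurable_cond_lik: "(\<lambda>p. cond_lik H n \<theta> (fst p) (snd p)) \<in> borel_measurable (borel \<Otimes>\<^sub>M seqs)"
    and depends_below_cond_lik: "depends_below n (cond_lik H n \<theta> x)"
    and measurable_cond_lik_snd: "cond_lik H n \<theta> x \<in> borel_measurable seqs"
proof -
  interpret T: hidden_markov "Ker H \<theta>" "Ref H" "Emi H \<theta>" by (rule hidden_markov_H[OF \<theta>])
  show joint: "(\<lambda>p. cond_lik H n \<theta> (fst p) (snd p)) \<in> borel_measurable (borel \<Otimes>\<^sub>M seqs)"
    unfolding cond_lik_def by measurable
  show "cond_lik H n \<theta> x \<in> borel_measurable seqs"
    using measurable_compose[OF measurable_Pair1'[of x borel seqs] joint] by simp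
  show "depends_below n (cond_lik H n \<theta> x)"
    unfolding cond_lik_def[abs_def] by (rule T.depends_below_lik)
qed

text \<open>
  By stationarity the first hidden state may be reached from a stationary state at time 0.
\<close>

lemma obs_lik_mixture:
  assumes \<theta>: "\<theta> \<in> Par H"
  shows "hmm_lik (Ker H \<theta>) (Emi H \<theta>) n (Stat H \<theta>) y = (\<integral>\<^sup>+x. cond_lik H n \<theta> x y \<partial>Stat H \<theta>)"
proof -
  interpret T: hidden_markov "Ker H \<theta>" "Ref H" "Emi H \<theta>" by (rule hidden_markov_H[OF \<theta>])
  interpret S: prob_space "Stat H \<theta>" by (rule T.m_prob[OF stat_prob[OF \<theta>]])
  show ?thesis
  proof (cases n)
    case 0
    then show ?thesis by (simp add: cond_lik_def S.emeasure_space_1)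
  next
    case (Suc p)
    note T.m_sets[OF stat_prob[OF \<theta>], measurable_cong, simp]
    let ?f = "\<lambda>x. ennreal (Emi H \<theta> x (y 0)) * hmm_lik (Ker H \<theta>) (Emi H \<theta>) p (Ker H \<theta> x) (\<lambda>i. y (Suc i))"
    have f: "?f \<in> borel_measurable borel"
      by measurable
    have K: "Ker H \<theta> \<in> Stat H \<theta> \<rightarrow>\<^sub>M subprob_algebra borel"
      by measurable
    have "(\<integral>\<^sup>+x. ?f x \<partial>Stat H \<theta>) = (\<integral>\<^sup>+x. ?f x \<partial>(Stat H \<theta> \<bind> Ker H \<theta>))"
      by (simp add: stationary[OF \<theta>])
    also have "\<dots> = (\<integral>\<^sup>+x. \<integral>\<^sup>+x'. ?f x' \<partial>Ker H \<theta> x \<partial>Stat H \<theta>)"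
      by (rule nn_integral_bind[OF f K])
    finally show ?thesis
      by (simp add: Suc cond_lik_def)
  qed
qed

context
  fixes \<theta>0 :: 'a and x0 :: 'x and A :: real
  assumes \<theta>0: "\<theta>0 \<in> Par H"
    and start: "\<And>x x'. AE \<omega> in hmm_law H \<theta>0. \<forall>n.
        \<bar>cond_loglik H n \<theta>0 x (snd \<omega>) - cond_loglik H n \<theta>0 x' (snd \<omega>)\<bar> \<le> ereal A"
begin

interpretation M0: hidden_markov "Ker H \<theta>0" "Ref H" "Emi H \<theta>0"
  by (rule hidden_markov_H[OF \<theta>0])

abbreviation (input) true_law where "true_law \<equiv> hmm_law H \<theta>0"

lemma prob_space_true: "prob_space true_law"
  unfolding hmm_law_eq_start_law[OF \<theta>0] by (rule M0.prob_space_law[OF stat_prob[OF \<theta>0]])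

lemma sets_true: "sets true_law = sets (seqs \<Otimes>\<^sub>M seqs)"
  unfolding hmm_law_eq_start_law[OF \<theta>0] by (rule M0.sets_law[OF stat_prob[OF \<theta>0]])

interpretation P: prob_space true_law
  by (rule prob_space_true)

lemma measurable_true: "f \<in> seqs \<rightarrow>\<^sub>M N \<Longrightarrow> (\<lambda>\<omega>. f (snd \<omega>)) \<in> true_law \<rightarrow>\<^sub>M N"
  unfolding hmm_law_eq_start_law[OF \<theta>0] by (rule M0.measurable_law_snd[OF stat_prob[OF \<theta>0]])

lemma measurable_cond_lik_true:
  "(\<lambda>p. cond_lik H n (fst (fst p)) (snd (fst p)) (snd (snd p))) \<in> borel_measurable (full_prior H \<Otimes>\<^sub>M true_law)"
proof -
  note sets_true[measurable_cong]
  have "(\<lambda>p. (fst p, snd (snd p))) \<in> full_prior H \<Otimes>\<^sub>M true_law \<rightarrow>\<^sub>M full_prior H \<Otimes>\<^sub>M seqs"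
    by measurable
  from measurable_compose[OF this measurable_cond_lik_full[of n]] show ?thesis
    by simp
qed

abbreviation (input) L0 :: "nat \<Rightarrow> (nat \<Rightarrow> 'y) \<Rightarrow> ennreal" where
  "L0 n y \<equiv> cond_lik H n \<theta>0 x0 y"

lemma AE_L0_regular: "AE \<omega> in true_law. L0 n (snd \<omega>) \<noteq> 0 \<and> L0 n (snd \<omega>) \<noteq> \<infinity>"
  using start[of x0 x0] by eventually_elim (metis cond_loglik_close(2,3))

text \<open>
  For each starting point the likelihoods are comparable almost surely; by Fubini's theorem they are,
  almost surely, comparable for almost all starting points, and averaging over these gives the
  stationary density.
\<close>

lemma AE_obs_lik_le:
  "AE \<omega> in true_law. hmm_lik (Ker H \<theta>0) (Emi H \<theta>0) n (Stat H \<theta>0) (snd \<omega>) \<le> ennreal (exp A) * L0 n (snd \<omega>)"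
proof -
  let ?\<mu> = "Stat H \<theta>0"
  interpret S: prob_space ?\<mu> by (rule M0.m_prob[OF stat_prob[OF \<theta>0]])
  interpret SP: pair_sigma_finite ?\<mu> true_law ..
  note M0.m_sets[OF stat_prob[OF \<theta>0], measurable_cong, simp] sets_true[measurable_cong, simp]
  note [measurable] = measurable_cond_lik[OF \<theta>0, of n] measurable_cond_lik_snd[OF \<theta>0, of n x0]
  have [measurable]: "(\<lambda>p. cond_lik H n \<theta>0 (fst p) (snd (snd p))) \<in> borel_measurable (?\<mu> \<Otimes>\<^sub>M true_law)"
    using measurable_compose[OF _ measurable_cond_lik[OF \<theta>0, of n], of "\<lambda>p. (fst p, snd (snd p))" "?\<mu> \<Otimes>\<^sub>M true_law"]
    by simp
  have "AE x in ?\<mu>. AE \<omega> in true_law. cond_lik H n \<theta>0 x (snd \<omega>) \<le> ennreal (exp A) * L0 n (snd \<omega>)"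
  proof (rule AE_I2)
    fix x
    show "AE \<omega> in true_law. cond_lik H n \<theta>0 x (snd \<omega>) \<le> ennreal (exp A) * L0 n (snd \<omega>)"
      using start[of x x0] by eventually_elim (metis cond_loglik_close(1))
  qed
  then have "AE \<omega> in true_law. AE x in ?\<mu>. cond_lik H n \<theta>0 x (snd \<omega>) \<le> ennreal (exp A) * L0 n (snd \<omega>)"
    by (subst (asm) SP.AE_commute) measurable
  then show ?thesis
  proof eventually_elim
    case (elim \<omega>)
    have "(\<integral>\<^sup>+x. cond_lik H n \<theta>0 x (snd \<omega>) \<partial>?\<mu>) \<le> (\<integral>\<^sup>+x. ennreal (exp A) * L0 n (snd \<omega>) \<partial>?\<mu>)"
      using elim by (rule nn_integral_mono_AE)
    then show ?case
      by (simp add: obs_lik_mixture[OF \<theta>0] S.emeasure_space_1)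
  qed
qed

text \<open>
  The true law has a density that is at most \<open>exp A\<close> times the likelihood in the denominator. So
  dividing by that likelihood changes the true law into the reference measure, up to \<open>exp A\<close>.
\<close>

lemma nn_integral_ratio_le:
  assumes \<Psi> [measurable]: "\<Psi> \<in> borel_measurable seqs" and dep: "depends_below n \<Psi>"
  shows "(\<integral>\<^sup>+\<omega>. \<Psi> (snd \<omega>) / L0 n (snd \<omega>) \<partial>true_law) \<le> ennreal (exp A) * (\<integral>\<^sup>+y. \<Psi> y \<partial>ref_obs n)"
proof -
  let ?f = "\<lambda>y. hmm_lik (Ker H \<theta>0) (Emi H \<theta>0) n (Stat H \<theta>0) y"
  \<comment> \<open>the observations at which the density is finite, nonzero and comparable; almost all of them\<close>
  define G where "G = {y. ?f y \<le> ennreal (exp A) * L0 n y \<and> L0 n y \<noteq> 0 \<and> L0 n y \<noteq> \<infinity>}"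
  note [measurable] = measurable_cond_lik_snd[OF \<theta>0, of n x0]
  have f: "?f \<in> borel_measurable seqs"
    by (rule M0.measurable_lik) (use stat_prob[OF \<theta>0] in simp_all)
  have "{y \<in> space seqs. ?f y \<le> ennreal (exp A) * L0 n y} \<in> sets seqs"
    by (rule borel_measurable_le[OF f]) measurable
  moreover have "{y \<in> space seqs. L0 n y \<noteq> 0} \<in> sets seqs" "{y \<in> space seqs. L0 n y \<noteq> \<infinity>} \<in> sets seqs"
    by measurable
  ultimately have "{y \<in> space seqs. ?f y \<le> ennreal (exp A) * L0 n y} \<inter>
      ({y \<in> space seqs. L0 n y \<noteq> 0} \<inter> {y \<in> space seqs. L0 n y \<noteq> \<infinity>}) \<in> sets seqs"
    by (intro sets.Int)
  then have G [measurable]: "G \<in> sets seqs"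
    by (simp add: G_def Int_def)
  have dep': "depends_below n (\<lambda>y. indicator G y * (\<Psi> y / L0 n y))"
    unfolding depends_below_def
  proof (intro allI impI)
    fix x y :: "nat \<Rightarrow> 'y" assume xy: "\<forall>i<n. x i = y i"
    then have "\<Psi> x = \<Psi> y" "L0 n x = L0 n y" "?f x = ?f y"
      using depends_belowD[OF dep, of x y] depends_belowD[OF depends_below_cond_lik[OF \<theta>0, of n x0], of x y]
        depends_belowD[OF M0.depends_below_lik[of n "Stat H \<theta>0"], of x y] by simp_all
    then show "indicator G x * (\<Psi> x / L0 n x) = indicator G y * (\<Psi> y / L0 n y)"
      by (simp add: G_def indicator_def)
  qed
  have "(\<integral>\<^sup>+\<omega>. \<Psi> (snd \<omega>) / L0 n (snd \<omega>) \<partial>true_law) = (\<integral>\<^sup>+\<omega>. indicator G (snd \<omega>) * (\<Psi> (snd \<omega>) / L0 n (snd \<omega>)) \<partial>true_law)"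
  proof (rule nn_integral_cong_AE)
    show "AE \<omega> in true_law. \<Psi> (snd \<omega>) / L0 n (snd \<omega>) = indicator G (snd \<omega>) * (\<Psi> (snd \<omega>) / L0 n (snd \<omega>))"
      using AE_obs_lik_le[of n] AE_L0_regular[of n] by eventually_elim (simp add: G_def)
  qed
  also have "\<dots> = (\<integral>\<^sup>+y. ?f y * (indicator G y * (\<Psi> y / L0 n y)) \<partial>ref_obs n)"
    unfolding hmm_law_eq_start_law[OF \<theta>0] by (rule M0.nn_integral_law_lik[OF stat_prob[OF \<theta>0] _ dep']) measurable
  also have "\<dots> \<le> (\<integral>\<^sup>+y. ennreal (exp A) * \<Psi> y \<partial>ref_obs n)"
  proof (rule nn_integral_mono)
    fix y
    show "?f y * (indicator G y * (\<Psi> y / L0 n y)) \<le> ennreal (exp A) * \<Psi> y"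
    proof (cases "y \<in> G")
      case True
      then have "?f y * (\<Psi> y / L0 n y) \<le> ennreal (exp A) * L0 n y * (\<Psi> y / L0 n y)"
        by (intro mult_right_mono) (simp_all add: G_def)
      also have "\<dots> = ennreal (exp A) * \<Psi> y"
      proof -
        have "L0 n y * (\<Psi> y / L0 n y) = \<Psi> y * L0 n y / L0 n y"
          by (simp add: ennreal_times_divide mult.commute)
        also have "\<dots> = \<Psi> y"
          using True by (intro mult_divide_eq_ennreal) (simp_all add: G_def)
        finally show ?thesis by (simp add: mult.assoc)
      qed
      finally show ?thesis using True by simp
    qed simp
  qed
  also have "\<dots> = ennreal (exp A) * (\<integral>\<^sup>+y. \<Psi> y \<partial>ref_obs n)"
    by (rule nn_integral_cmult) (rule M0.measurable_obs_ref[OF \<Psi>])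
  finally show ?thesis .
qed

abbreviation (input) marg :: "nat \<Rightarrow> (nat \<Rightarrow> 'y) \<Rightarrow> 'a set \<Rightarrow> ennreal" where
  "marg n y B \<equiv> (\<integral>\<^sup>+z\<in>B \<times> UNIV. cond_lik H n (fst z) (snd z) y \<partial>full_prior H)"

text \<open>
  On the acceptance region of a test, the expected likelihood ratio of \<open>(\<theta>, x)\<close> is controlled by the
  probability of acceptance under \<open>\<theta>\<close> started at \<open>x\<close>; integrate this over the prior.
\<close>

lemma nn_integral_marg_le:
  assumes R [measurable]: "R \<in> sets seqs" and depR: "depends_below n (\<lambda>y. y \<in> R)"
    and B [measurable]: "B \<in> sets (Prior H)"
    and \<beta>: "\<And>\<theta> x. \<theta> \<in> B \<Longrightarrow> miss_prob \<theta> x R \<le> \<beta>"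
  shows "(\<integral>\<^sup>+\<omega>. indicator (- R) (snd \<omega>) * marg n (snd \<omega>) B / L0 n (snd \<omega>) \<partial>true_law) \<le> ennreal (exp A * \<beta> * measure (Prior H) B)"
    and "(\<lambda>\<omega>. indicator (- R) (snd \<omega>) * marg n (snd \<omega>) B / L0 n (snd \<omega>)) \<in> borel_measurable true_law"
proof -
  note sets_true[measurable_cong, simp]
  interpret Pi: prob_space "full_prior H" by (rule prob_space_full_prior)
  interpret PP: pair_sigma_finite "full_prior H" true_law ..
  note L [measurable] = measurable_cond_lik_snd[OF \<theta>0, of n x0]
  note cl [measurable] = measurable_cond_lik_true[of n]
  define w where "w \<omega> = indicator (- R) (snd \<omega>) * inverse (L0 n (snd \<omega>))" for \<omega> :: "(nat \<Rightarrow> 'x) \<times> (nat \<Rightarrow> 'y)"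
  have w [measurable]: "w \<in> borel_measurable true_law"
    unfolding w_def[abs_def] by measurable
  let ?q = "\<lambda>z \<omega>. w \<omega> * (cond_lik H n (fst z) (snd z) (snd \<omega>) * indicator (B \<times> UNIV) z)"
  have BU: "B \<times> UNIV \<in> sets (full_prior H)"
    using sets_eq_imp_space_eq[OF sets_Init] by (auto intro!: pair_measureI simp: sets_Init B)
  note BU [measurable]
  have q [measurable]: "(\<lambda>p. ?q (fst p) (snd p)) \<in> borel_measurable (full_prior H \<Otimes>\<^sub>M true_law)"
    by measurable
  have eq: "indicator (- R) (snd \<omega>) * marg n (snd \<omega>) B / L0 n (snd \<omega>) = (\<integral>\<^sup>+z. ?q z \<omega> \<partial>full_prior H)" for \<omega>
  proof -
    have "(\<integral>\<^sup>+z. ?q z \<omega> \<partial>full_prior H) = w \<omega> * marg n (snd \<omega>) B"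
    proof (rule nn_integral_cmult)
      note measurable_cond_lik_prior [measurable]
      have [measurable]: "(\<lambda>z. indicator (B \<times> UNIV) z :: ennreal) \<in> borel_measurable (full_prior H)"
        using BU by (rule borel_measurable_indicator)
      show "(\<lambda>z. cond_lik H n (fst z) (snd z) (snd \<omega>) * indicator (B \<times> UNIV) z) \<in> borel_measurable (full_prior H)"
        by measurable
    qed
    then show ?thesis
      by (simp add: w_def divide_ennreal_def ac_simps)
  qed
  show "(\<lambda>\<omega>. indicator (- R) (snd \<omega>) * marg n (snd \<omega>) B / L0 n (snd \<omega>)) \<in> borel_measurable true_law"
    unfolding eq by (rule Pi.borel_measurable_nn_integral) (use measurable_compose[OF measurable_pair_swap' q] in \<open>simp add: case_prod_beta\<close>)
  have inner: "(\<integral>\<^sup>+\<omega>. ?q z \<omega> \<partial>true_law) \<le> ennreal (exp A * \<beta>) * indicator (B \<times> UNIV) z" if z: "z \<in> space (full_prior H)" for z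
  proof (cases "fst z \<in> B")
    case True
    obtain \<theta> x where zz: "z = (\<theta>, x)" by (cases z)
    have \<theta>: "\<theta> \<in> Par H"
      using Par_if_full_prior[OF z] by (simp add: zz)
    interpret T: hidden_markov "Ker H \<theta>" "Ref H" "Emi H \<theta>" by (rule hidden_markov_H[OF \<theta>])
    interpret TP: prob_space "start_law \<theta> (Ker H \<theta> x)" by (rule T.prob_space_law[OF T.K_prob])
    note [measurable] = measurable_cond_lik_snd[OF \<theta>, of n x]
    let ?\<Psi> = "\<lambda>y. indicator (- R) y * cond_lik H n \<theta> x y"
    have dep: "depends_below n ?\<Psi>"
      unfolding depends_below_def
    proof (intro allI impI)
      fix u v :: "nat \<Rightarrow> 'y" assume uv: "\<forall>i<n. u i = v i"
      then show "?\<Psi> u = ?\<Psi> v"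
        using depends_belowD[OF depR, of u v] depends_belowD[OF depends_below_cond_lik[OF \<theta>, of n x], of u v]
        by (simp add: indicator_def)
    qed
    have depi: "depends_below n (indicator (- R) :: _ \<Rightarrow> ennreal)"
      using depR unfolding depends_below_def by (simp add: indicator_def) blast
    have "(\<integral>\<^sup>+\<omega>. ?q z \<omega> \<partial>true_law) = (\<integral>\<^sup>+\<omega>. ?\<Psi> (snd \<omega>) / L0 n (snd \<omega>) \<partial>true_law)"
      using True by (intro nn_integral_cong) (simp add: zz w_def divide_ennreal_def ac_simps)
    also have "\<dots> \<le> ennreal (exp A) * (\<integral>\<^sup>+y. ?\<Psi> y \<partial>ref_obs n)"
      by (rule nn_integral_ratio_le[OF _ dep]) measurable
    also have "(\<integral>\<^sup>+y. ?\<Psi> y \<partial>ref_obs n) = (\<integral>\<^sup>+\<omega>. indicator (- R) (snd \<omega>) \<partial>start_law \<theta> (Ker H \<theta> x))"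
      using T.nn_integral_law_lik[OF T.K_prob _ depi, of x] by (simp add: cond_lik_def mult.commute)
    also have "\<dots> = (\<integral>\<^sup>+\<omega>. indicator {\<omega> \<in> space (start_law \<theta> (Ker H \<theta> x)). snd \<omega> \<notin> R} \<omega> \<partial>start_law \<theta> (Ker H \<theta> x))"
      by (intro nn_integral_cong) (simp add: indicator_def)
    also have "\<dots> = ennreal (miss_prob \<theta> x R)"
    proof -
      have "- R \<in> sets seqs"
        using sets.compl_sets[OF R] by (simp add: Compl_eq_Diff_UNIV space_PiM)
      from T.law_event[OF T.K_prob this, of x]
      have "{\<omega> \<in> space (start_law \<theta> (Ker H \<theta> x)). snd \<omega> \<notin> R} \<in> TP.events" by simp
      then show ?thesis by (simp add: TP.emeasure_eq_measure)
    qed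
    also have "ennreal (exp A) * \<dots> \<le> ennreal (exp A) * ennreal \<beta>"
      using \<beta>[of \<theta> x] True by (intro mult_left_mono ennreal_leI) (simp_all add: zz)
    finally show ?thesis
      using True by (simp add: zz ennreal_mult')
  qed (auto simp: indicator_def)
  have "(\<integral>\<^sup>+\<omega>. indicator (- R) (snd \<omega>) * marg n (snd \<omega>) B / L0 n (snd \<omega>) \<partial>true_law) =
      (\<integral>\<^sup>+\<omega>. \<integral>\<^sup>+z. ?q z \<omega> \<partial>full_prior H \<partial>true_law)"
    by (simp only: eq)
  also have "\<dots> = (\<integral>\<^sup>+z. \<integral>\<^sup>+\<omega>. ?q z \<omega> \<partial>true_law \<partial>full_prior H)"
    by (rule PP.Fubini') (use q in \<open>simp add: case_prod_beta\<close>)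
  also have "\<dots> \<le> (\<integral>\<^sup>+z. ennreal (exp A * \<beta>) * indicator (B \<times> UNIV) z \<partial>full_prior H)"
    by (rule nn_integral_mono) (rule inner)
  also have "\<dots> = ennreal (exp A * \<beta>) * emeasure (full_prior H) (B \<times> UNIV)"
    by (rule nn_integral_cmult_indicator[OF BU])
  also have "emeasure (full_prior H) (B \<times> UNIV) = ennreal (measure (Prior H) B)"
  proof -
    interpret I: prob_space "Init H" by (rule init_prob)
    interpret Pr: prob_space "Prior H" by (rule prior_prob)
    have "space (Init H) = UNIV"
      using sets_eq_imp_space_eq[OF sets_Init] by simp
    then have "emeasure (full_prior H) (B \<times> UNIV) = emeasure (Prior H) B * emeasure (Init H) UNIV"
      using sets.top[of "Init H"] by (intro I.emeasure_pair_measure_Times B) simp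
    then show ?thesis
      using I.emeasure_space_1 \<open>space (Init H) = UNIV\<close> by (simp add: Pr.emeasure_eq_measure)
  qed
  finally show "(\<integral>\<^sup>+\<omega>. indicator (- R) (snd \<omega>) * marg n (snd \<omega>) B / L0 n (snd \<omega>) \<partial>true_law) \<le> ennreal (exp A * \<beta> * measure (Prior H) B)"
    by (simp add: ennreal_mult'')
qed

text \<open>
  Call a pair bad if its likelihood is smaller than \<open>exp (- v)\<close> times that of the true parameter. The
  prior mass of the bad pairs in \<open>S\<close> has expectation at most \<open>\<eta>\<close> times the mass of \<open>S\<close>. By Markov's
  inequality it exceeds half the mass of \<open>S\<close> with probability at most \<open>2 * \<eta>\<close>; otherwise the other
  half alone gives the lower bound for the denominator.
\<close>

lemma prob_denominator_small:
  assumes S [measurable]: "S \<in> sets (full_prior H)" and pos: "measure (full_prior H) S > 0"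
    and \<eta>: "\<And>\<theta> x. (\<theta>, x) \<in> S \<Longrightarrow> \<P>(\<omega> in true_law. cond_loglik H n \<theta> x (snd \<omega>) - cond_loglik H n \<theta>0 x0 (snd \<omega>) \<le> ereal (- v)) \<le> \<eta>"
  shows "\<P>(\<omega> in true_law. (\<integral>\<^sup>+z. cond_lik H n (fst z) (snd z) (snd \<omega>) \<partial>full_prior H) < ennreal (measure (full_prior H) S / 2 * exp (- v)) * L0 n (snd \<omega>)) \<le> 2 * \<eta>"
proof -
  note sets_true[measurable_cong, simp]
  interpret Pi: prob_space "full_prior H" by (rule prob_space_full_prior)
  interpret PP: pair_sigma_finite "full_prior H" true_law ..
  note L [measurable] = measurable_cond_lik_snd[OF \<theta>0, of n x0]
  define \<sigma> where "\<sigma> = measure (full_prior H) S"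
  have \<sigma>: "\<sigma> > 0" "emeasure (full_prior H) S = ennreal \<sigma>"
    using pos by (simp_all add: \<sigma>_def Pi.emeasure_eq_measure)
  note cl [measurable] = measurable_cond_lik_true[of n]
  define bad where "bad z y \<longleftrightarrow> cond_lik H n (fst z) (snd z) y < ennreal (exp (- v)) * L0 n y" for z y
  let ?i = "\<lambda>z \<omega>. indicator S z * (indicator {p. bad (fst p) (snd p)} (z, snd \<omega>) :: ennreal)"
  have rhs: "(\<lambda>p. ennreal (exp (- v)) * L0 n (snd (snd p))) \<in> borel_measurable (full_prior H \<Otimes>\<^sub>M true_law)"
    by measurable
  have "{p \<in> space (full_prior H \<Otimes>\<^sub>M true_law). bad (fst p) (snd (snd p))} \<in> sets (full_prior H \<Otimes>\<^sub>M true_law)"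
    unfolding bad_def by (rule borel_measurable_less[OF cl rhs])
  then have "(\<lambda>p. indicator {p \<in> space (full_prior H \<Otimes>\<^sub>M true_law). bad (fst p) (snd (snd p))} p :: ennreal) \<in> borel_measurable (full_prior H \<Otimes>\<^sub>M true_law)"
    by (rule borel_measurable_indicator)
  then have bad_meas: "(\<lambda>p. indicator {p. bad (fst p) (snd p)} (fst p, snd (snd p)) :: ennreal) \<in> borel_measurable (full_prior H \<Otimes>\<^sub>M true_law)"
    by (rule measurable_cong[THEN iffD1, rotated]) (simp add: indicator_def)
  then have i [measurable]: "(\<lambda>p. ?i (fst p) (snd p)) \<in> borel_measurable (full_prior H \<Otimes>\<^sub>M true_law)"
    by measurable
  define Z where "Z \<omega> = (\<integral>\<^sup>+z. ?i z \<omega> \<partial>full_prior H)" for \<omega> :: "(nat \<Rightarrow> 'x) \<times> (nat \<Rightarrow> 'y)"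
  have Z [measurable]: "Z \<in> borel_measurable true_law"
    unfolding Z_def[abs_def] by (rule Pi.borel_measurable_nn_integral) (use measurable_compose[OF measurable_pair_swap' i] in \<open>simp add: case_prod_beta\<close>)
  have inner: "(\<integral>\<^sup>+\<omega>. ?i z \<omega> \<partial>true_law) \<le> ennreal \<eta> * indicator S z" if z: "z \<in> space (full_prior H)" for z
  proof (cases "z \<in> S")
    case True
    obtain \<theta> x where zz: "z = (\<theta>, x)" by (cases z)
    have \<theta>: "\<theta> \<in> Par H"
      using Par_if_full_prior[OF z] by (simp add: zz)
    let ?E = "{\<omega> \<in> space true_law. cond_loglik H n \<theta> x (snd \<omega>) - cond_loglik H n \<theta>0 x0 (snd \<omega>) \<le> ereal (- v)}"
    have cm: "(\<lambda>\<omega>. cond_lik H n \<theta>' x' (snd \<omega>)) \<in> borel_measurable true_law" if "\<theta>' \<in> Par H" for \<theta>' x'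
      by (rule measurable_true[OF measurable_cond_lik_snd[OF that]])
    have lm [measurable]: "(\<lambda>\<omega>. cond_loglik H n \<theta>' x' (snd \<omega>)) \<in> borel_measurable true_law" if "\<theta>' \<in> Par H" for \<theta>' x'
      unfolding cond_loglik_def using cm[OF that, of x'] by measurable
    have "?E \<in> P.events"
      using lm[OF \<theta>, of x] lm[OF \<theta>0, of x0] by measurable
    moreover have "(\<integral>\<^sup>+\<omega>. ?i z \<omega> \<partial>true_law) \<le> (\<integral>\<^sup>+\<omega>. indicator ?E \<omega> \<partial>true_law)"
    proof (rule nn_integral_mono_AE)
      show "AE \<omega> in true_law. ?i z \<omega> \<le> indicator ?E \<omega>"
        using AE_L0_regular[of n] AE_space
        by eventually_elim (use cond_loglik_diff_le[of H n \<theta> x _ v \<theta>0 x0] in \<open>auto simp: indicator_def bad_def zz\<close>)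
    qed
    ultimately have "(\<integral>\<^sup>+\<omega>. ?i z \<omega> \<partial>true_law) \<le> ennreal (measure true_law ?E)"
      by (simp add: P.emeasure_eq_measure)
    also have "\<dots> \<le> ennreal \<eta>"
      using \<eta>[of \<theta> x] True by (intro ennreal_leI) (simp add: zz)
    finally show ?thesis using True by simp
  qed simp
  have EZ: "(\<integral>\<^sup>+\<omega>. Z \<omega> \<partial>true_law) \<le> ennreal \<eta> * ennreal \<sigma>"
  proof -
    have "(\<integral>\<^sup>+\<omega>. Z \<omega> \<partial>true_law) = (\<integral>\<^sup>+z. \<integral>\<^sup>+\<omega>. ?i z \<omega> \<partial>true_law \<partial>full_prior H)"
      unfolding Z_def by (rule PP.Fubini') (use i in \<open>simp add: case_prod_beta\<close>)
    also have "\<dots> \<le> (\<integral>\<^sup>+z. ennreal \<eta> * indicator S z \<partial>full_prior H)"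
      by (rule nn_integral_mono) (rule inner)
    also have "\<dots> = ennreal \<eta> * ennreal \<sigma>"
      by (simp add: nn_integral_cmult_indicator[OF S] \<sigma>)
    finally show ?thesis .
  qed
  let ?D = "\<lambda>\<omega>. \<integral>\<^sup>+z. cond_lik H n (fst z) (snd z) (snd \<omega>) \<partial>full_prior H"
  let ?M = "{\<omega> \<in> space true_law. 1 \<le> ennreal (2 / \<sigma>) * Z \<omega>}"
  have Mset: "?M \<in> P.events"
    by measurable
  have "\<P>(\<omega> in true_law. ?D \<omega> < ennreal (\<sigma> / 2 * exp (- v)) * L0 n (snd \<omega>)) \<le> measure true_law ?M"
  proof (rule P.finite_measure_mono_AE[OF _ Mset])
    show "AE \<omega> in true_law. \<omega> \<in> {\<omega> \<in> space true_law. ?D \<omega> < ennreal (\<sigma> / 2 * exp (- v)) * L0 n (snd \<omega>)} \<longrightarrow> \<omega> \<in> ?M"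
    proof (rule AE_I2, intro impI)
      fix \<omega> assume \<omega>: "\<omega> \<in> space true_law" and "\<omega> \<in> {\<omega> \<in> space true_law. ?D \<omega> < ennreal (\<sigma> / 2 * exp (- v)) * L0 n (snd \<omega>)}"
      then have D: "?D \<omega> < ennreal (\<sigma> / 2 * exp (- v)) * L0 n (snd \<omega>)" by simp
      let ?g = "\<lambda>z. indicator S z * (1 - indicator {p. bad (fst p) (snd p)} (z, snd \<omega>) :: ennreal)"
      have bz: "(\<lambda>z. indicator {p. bad (fst p) (snd p)} (z, snd \<omega>) :: ennreal) \<in> borel_measurable (full_prior H)"
        using measurable_compose[OF measurable_Pair2'[OF \<omega>, of "full_prior H"] bad_meas] by simp
      have g [measurable]: "?g \<in> borel_measurable (full_prior H)" and iz [measurable]: "(\<lambda>z. ?i z \<omega>) \<in> borel_measurable (full_prior H)"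
        using bz by measurable
      let ?W = "\<integral>\<^sup>+z. ?g z \<partial>full_prior H"
      have "?W + Z \<omega> = (\<integral>\<^sup>+z. ?g z + ?i z \<omega> \<partial>full_prior H)"
        unfolding Z_def by (rule nn_integral_add[symmetric]) (rule g iz)+
      also have "\<dots> = (\<integral>\<^sup>+z. indicator S z \<partial>full_prior H)"
        by (intro nn_integral_cong) (simp add: indicator_def)
      finally have sum: "?W + Z \<omega> = ennreal \<sigma>"
        by (simp add: \<sigma>)
      have "ennreal (exp (- v)) * L0 n (snd \<omega>) * ?W = (\<integral>\<^sup>+z. ennreal (exp (- v)) * L0 n (snd \<omega>) * ?g z \<partial>full_prior H)"
        by (rule nn_integral_cmult[symmetric, OF g])
      also have "\<dots> \<le> ?D \<omega>"
        by (intro nn_integral_mono) (auto simp: indicator_def bad_def not_less)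
      finally have W_le: "ennreal (exp (- v)) * L0 n (snd \<omega>) * ?W \<le> ?D \<omega>" .
      have W: "ennreal (exp (- v)) * L0 n (snd \<omega>) * ?W < ennreal (exp (- v)) * L0 n (snd \<omega>) * ennreal (\<sigma> / 2)"
      proof -
        have "ennreal (\<sigma> / 2 * exp (- v)) * L0 n (snd \<omega>) = ennreal (exp (- v)) * L0 n (snd \<omega>) * ennreal (\<sigma> / 2)"
          using \<sigma>(1) by (subst ennreal_mult) (simp_all add: ac_simps)
        from le_less_trans[OF W_le D[unfolded this]] show ?thesis .
      qed
      have "?W < ennreal (\<sigma> / 2)"
      proof (rule ccontr)
        assume "\<not> ?W < ennreal (\<sigma> / 2)"
        then have "ennreal (exp (- v)) * L0 n (snd \<omega>) * ennreal (\<sigma> / 2) \<le> ennreal (exp (- v)) * L0 n (snd \<omega>) * ?W"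
          by (intro mult_left_mono) auto
        with W show False by simp
      qed
      then obtain a where a: "?W = ennreal a" "0 \<le> a" "a < \<sigma> / 2"
        by (cases ?W) (auto simp: ennreal_less_iff)
      have "Z \<omega> \<noteq> \<infinity>"
        using sum by auto
      then obtain b where b: "Z \<omega> = ennreal b" "0 \<le> b"
        by (cases "Z \<omega>") auto
      have "a + b = \<sigma>"
        using sum a b \<sigma>(1) by (simp add: ennreal_plus[symmetric] del: ennreal_plus)
      then have "1 \<le> 2 / \<sigma> * b"
        using a \<sigma>(1) by (simp add: field_simps)
      then show "\<omega> \<in> ?M"
        using \<omega> \<sigma>(1) b by (simp add: ennreal_mult'[symmetric])
    qed
  qed
  also have "measure true_law ?M \<le> 2 * \<eta>"
  proof -
    have "emeasure true_law ?M \<le> ennreal (2 / \<sigma>) * (\<integral>\<^sup>+\<omega>. Z \<omega> * indicator (space true_law) \<omega> \<partial>true_law)"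
      by (rule nn_integral_Markov_inequality) measurable
    also have "(\<integral>\<^sup>+\<omega>. Z \<omega> * indicator (space true_law) \<omega> \<partial>true_law) = (\<integral>\<^sup>+\<omega>. Z \<omega> \<partial>true_law)"
      by (intro nn_integral_cong) simp
    also have "ennreal (2 / \<sigma>) * \<dots> \<le> ennreal (2 / \<sigma>) * (ennreal \<eta> * ennreal \<sigma>)"
      by (intro mult_left_mono EZ) simp
    also have "\<dots> = ennreal (2 * \<eta>)"
      using \<sigma>(1) by (simp add: ennreal_mult'[symmetric] ennreal_mult''[symmetric])
    finally have "ennreal (measure true_law ?M) \<le> ennreal (2 * \<eta>)"
      by (simp add: P.emeasure_eq_measure)
    moreover have "\<eta> \<ge> 0"
    proof -
      have "S \<noteq> {}" using pos by auto
      then obtain \<theta> x where "(\<theta>, x) \<in> S" by auto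
      from order_trans[OF measure_nonneg \<eta>[OF this]] show ?thesis .
    qed
    ultimately show ?thesis
      by (simp add: ennreal_le_iff)
  qed
  finally show ?thesis
    by (simp add: \<sigma>_def)
qed

end

end

section \<open>Bounds on the posterior probability at a fixed time\<close>

lemma covering_number_le_obtain:
  assumes "ereal_of_enat (covering_number d \<delta> F) \<le> ereal B"
  obtains T where "finite T" "T \<subseteq> F" "\<And>\<theta>. \<theta> \<in> F \<Longrightarrow> \<exists>t\<in>T. d t \<theta> \<le> \<delta>" "real (card T) \<le> B"
proof -
  let ?X = "{enat (card T) | T. finite T \<and> T \<subseteq> F \<and> (\<forall>\<theta>\<in>F. \<exists>t\<in>T. d t \<theta> \<le> \<delta>)}"
  have "?X \<noteq> {}"
  proof
    assume "?X = {}"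
    then have "covering_number d \<delta> F = \<infinity>"
      unfolding covering_number_def by (metis Inf_empty top_enat_def)
    with assms show False by simp
  qed
  then obtain z where "z \<in> ?X" by blast
  then have "covering_number d \<delta> F \<in> ?X"
    unfolding covering_number_def by (rule wellorder_InfI)
  then obtain T where T: "finite T" "T \<subseteq> F" "\<forall>\<theta>\<in>F. \<exists>t\<in>T. d t \<theta> \<le> \<delta>" "covering_number d \<delta> F = enat (card T)"
    by blast
  show thesis
    by (rule that[of T]) (use T assms in auto)
qed

lemma real_div_ge:
  fixes n l :: nat
  assumes "l \<ge> 1"
  shows "real n / real l - 1 \<le> real (n div l)"
proof -
  have "real n = real (n div l) * real l + real (n mod l)"
    by (metis div_mult_mod_eq of_nat_add of_nat_mult)
  moreover have "real (n mod l) \<le> real l"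
    using assms by (simp add: less_imp_le)
  ultimately show ?thesis
    using assms by (simp add: field_simps)
qed

text \<open>
  The entropy and the error exponent of the test combine. Rounding \<open>n / l\<close> down costs only a constant,
  as \<open>s\<close> and \<open>\<kappa>\<close> are bounded.
\<close>

lemma type_I_exponent:
  fixes s \<kappa> :: real and n l :: nat
  assumes l: "l \<ge> 1" and s: "0 < s" "s \<le> 2" and \<kappa>: "0 \<le> \<kappa>" "\<kappa> \<le> 1"
  shows "real n * s\<^sup>2 * \<kappa>\<^sup>2 / (16 * real l) - real (n div l) * s\<^sup>2 * \<kappa>\<^sup>2 / 8 \<le> 1 / 2 - real n * s\<^sup>2 * \<kappa>\<^sup>2 / (16 * real l)"
proof -
  have "s\<^sup>2 \<le> 2\<^sup>2" "\<kappa>\<^sup>2 \<le> 1\<^sup>2"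
    using s \<kappa> by (intro power_mono; simp)+
  then have w: "s\<^sup>2 * \<kappa>\<^sup>2 \<le> 4 * 1"
    by (intro mult_mono) auto
  define X Y where "X = real n / real l * (s\<^sup>2 * \<kappa>\<^sup>2)" and "Y = real (n div l) * (s\<^sup>2 * \<kappa>\<^sup>2)"
  have "(real n / real l - 1) * (s\<^sup>2 * \<kappa>\<^sup>2) \<le> Y"
    unfolding Y_def by (intro mult_right_mono real_div_ge[OF l]) simp
  then have "X - s\<^sup>2 * \<kappa>\<^sup>2 \<le> Y"
    by (simp add: X_def left_diff_distrib)
  moreover have eqs: "real n * s\<^sup>2 * \<kappa>\<^sup>2 / (16 * real l) = X / 16" "real (n div l) * s\<^sup>2 * \<kappa>\<^sup>2 / 8 = Y / 8"
    by (simp_all add: X_def Y_def)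
  ultimately show ?thesis
    unfolding eqs using w by linarith
qed

text \<open>
  Both the rounding of \<open>n / l\<close> and the bias \<open>1 / (4 k)\<close> of the starting point cost only a constant.
\<close>

lemma type_II_exponent:
  fixes s :: real and n l :: nat
  assumes l: "l \<ge> 1" and s: "0 < s" "s \<le> 2" and k: "n div l > 0"
  shows "- 2 * real (n div l) * (s / 6 - 1 / (4 * real (n div l)))\<^sup>2 \<le> 1 - real n * s\<^sup>2 / (18 * real l)"
proof -
  let ?k = "real (n div l)"
  have k': "?k > 0" using k by simp
  define X Y where "X = real n / real l * s\<^sup>2" and "Y = ?k * s\<^sup>2"
  define z where "z = 1 / (8 * ?k)"
  have sq: "- 2 * ?k * (s / 6 - 1 / (4 * ?k))\<^sup>2 = - (Y / 18) + s / 6 - z"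
    using k' by (simp add: Y_def z_def power2_eq_square field_simps)
  have X: "real n * s\<^sup>2 / (18 * real l) = X / 18"
    by (simp add: X_def)
  have "(real n / real l - 1) * s\<^sup>2 \<le> Y"
    unfolding Y_def by (intro mult_right_mono real_div_ge[OF l]) simp
  then have "X - s\<^sup>2 \<le> Y"
    by (simp add: X_def left_diff_distrib)
  moreover have "s\<^sup>2 \<le> 2\<^sup>2"
    using s by (intro power_mono) auto
  moreover have "z \<ge> 0"
    using k' by (simp add: z_def)
  ultimately show ?thesis
    unfolding sq X using s by simp
qed

context hmm_setting
begin

text \<open>
  A large posterior probability requires a rejection by the test, a small denominator, or a large
  normalised numerator on the acceptance region. The last event is bounded by Markov's inequality,
  piece by piece over the sets \<open>B i\<close>.
\<close>

lemma posterior_exceeds_bound: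
  assumes \<theta>0: "\<theta>0 \<in> Par H"
    and start: "\<And>x x'. AE \<omega> in hmm_law H \<theta>0. \<forall>n.
        \<bar>cond_loglik H n \<theta>0 x (snd \<omega>) - cond_loglik H n \<theta>0 x' (snd \<omega>)\<bar> \<le> ereal A"
    and S: "S \<in> sets (full_prior H)" and pos: "measure (full_prior H) S > 0"
    and \<eta>: "\<And>\<theta> x. (\<theta>, x) \<in> S \<Longrightarrow>
      \<P>(\<omega> in hmm_law H \<theta>0. cond_loglik H n \<theta> x (snd \<omega>) - cond_loglik H n \<theta>0 x0 (snd \<omega>) \<le> ereal (- v)) \<le> \<eta>"
    and R: "R \<in> sets seqs" and depR: "depends_below n (\<lambda>y. y \<in> R)"
    and I: "finite I" and B: "\<And>i. i \<in> I \<Longrightarrow> B i \<in> sets (Prior H)" and W: "W \<subseteq> (\<Union>i\<in>I. B i)"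
    and \<beta>: "\<And>i \<theta> x. i \<in> I \<Longrightarrow> \<theta> \<in> B i \<Longrightarrow>
      miss_prob \<theta> x R \<le> \<beta> i"
    and \<beta>0: "\<And>i. i \<in> I \<Longrightarrow> 0 \<le> \<beta> i"
    and e: "e > 0"
  shows "\<P>(\<omega> in hmm_law H \<theta>0. e < \<bar>posterior H n (snd \<omega>) W\<bar>) \<le>
    \<P>(\<omega> in hmm_law H \<theta>0. snd \<omega> \<in> R) + 2 * \<eta> +
    exp A * (2 / e) * (exp v / measure (full_prior H) S * (\<Sum>i\<in>I. \<beta> i * measure (Prior H) (B i)))"
proof -
  let ?P = "hmm_law H \<theta>0"
  interpret P: prob_space ?P by (rule prob_space_true[OF \<theta>0 start])
  interpret Pi: prob_space "full_prior H" by (rule prob_space_full_prior)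
  note sets_true[OF \<theta>0 start, measurable_cong, simp]
  note start' = \<theta>0 start
  define \<delta> where "\<delta> = measure (full_prior H) S / 2 * exp (- v)"
  have \<delta>: "\<delta> > 0" using pos by (simp add: \<delta>_def)
  let ?L = "\<lambda>\<omega>. cond_lik H n \<theta>0 x0 (snd \<omega>)"
  let ?N = "\<lambda>\<omega> B. \<integral>\<^sup>+z\<in>B \<times> UNIV. cond_lik H n (fst z) (snd z) (snd \<omega>) \<partial>full_prior H"
  let ?D = "\<lambda>\<omega>. \<integral>\<^sup>+z. cond_lik H n (fst z) (snd z) (snd \<omega>) \<partial>full_prior H"
  define Q where "Q \<omega> = (\<Sum>i\<in>I. indicator (- R) (snd \<omega>) * ?N \<omega> (B i) / ?L \<omega>)" for \<omega> :: "(nat \<Rightarrow> 'x) \<times> (nat \<Rightarrow> 'y)"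
  have marg_le: "(\<integral>\<^sup>+\<omega>. indicator (- R) (snd \<omega>) * ?N \<omega> (B i) / ?L \<omega> \<partial>?P) \<le> ennreal (exp A * \<beta> i * measure (Prior H) (B i))"
    "(\<lambda>\<omega>. indicator (- R) (snd \<omega>) * ?N \<omega> (B i) / ?L \<omega>) \<in> borel_measurable ?P" if "i \<in> I" for i
    using nn_integral_marg_le[OF \<theta>0 start R depR B[OF that] \<beta>[OF that]] by blast+
  have Q [measurable]: "Q \<in> borel_measurable ?P"
    unfolding Q_def[abs_def] by (rule borel_measurable_sum) (rule marg_le(2))
  have EQ: "(\<integral>\<^sup>+\<omega>. Q \<omega> \<partial>?P) \<le> ennreal (exp A * (\<Sum>i\<in>I. \<beta> i * measure (Prior H) (B i)))"
  proof -
    have "(\<integral>\<^sup>+\<omega>. Q \<omega> \<partial>?P) = (\<Sum>i\<in>I. \<integral>\<^sup>+\<omega>. indicator (- R) (snd \<omega>) * ?N \<omega> (B i) / ?L \<omega> \<partial>?P)"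
      unfolding Q_def by (rule nn_integral_sum) (rule marg_le(2))
    also have "\<dots> \<le> (\<Sum>i\<in>I. ennreal (exp A * \<beta> i * measure (Prior H) (B i)))"
      by (rule sum_mono) (rule marg_le(1))
    also have "\<dots> = ennreal (exp A * (\<Sum>i\<in>I. \<beta> i * measure (Prior H) (B i)))"
      using \<beta>0 by (subst sum_ennreal) (auto simp: sum_distrib_left mult.assoc)
    finally show ?thesis .
  qed
  let ?E = "{\<omega> \<in> space ?P. e < \<bar>posterior H n (snd \<omega>) W\<bar>}"
  let ?ER = "{\<omega> \<in> space ?P. snd \<omega> \<in> R}"
  let ?ED = "{\<omega> \<in> space ?P. ?D \<omega> < ennreal \<delta> * ?L \<omega>}"
  let ?EQ = "{\<omega> \<in> space ?P. 1 \<le> ennreal (1 / (e * \<delta>)) * Q \<omega>}"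
  have L: "?L \<in> borel_measurable ?P"
    by (rule measurable_true[OF \<theta>0 start measurable_cond_lik_snd[OF \<theta>0]])
  have D: "?D \<in> borel_measurable ?P"
  proof -
    have "(\<lambda>p. (snd p, snd (fst p))) \<in> ?P \<Otimes>\<^sub>M full_prior H \<rightarrow>\<^sub>M full_prior H \<Otimes>\<^sub>M seqs"
      by measurable
    from measurable_compose[OF this measurable_cond_lik_full[of n]]
    have "(\<lambda>(\<omega>, z). cond_lik H n (fst z) (snd z) (snd \<omega>)) \<in> borel_measurable (?P \<Otimes>\<^sub>M full_prior H)"
      by (simp add: case_prod_beta)
    then show ?thesis by (rule Pi.borel_measurable_nn_integral)
  qed
  have sets: "?ER \<in> P.events" "?ED \<in> P.events" "?EQ \<in> P.events"
  proof -
    show "?ER \<in> P.events"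
      using measurable_sets[OF measurable_true[OF \<theta>0 start measurable_ident] R] by (simp add: vimage_def Int_def conj_commute)
    have "(\<lambda>\<omega>. ennreal \<delta> * ?L \<omega>) \<in> borel_measurable ?P"
      using L by (intro borel_measurable_const measurable_compose[OF L]) measurable
    then show "?ED \<in> P.events"
      by (rule borel_measurable_less[OF D])
    show "?EQ \<in> P.events" by measurable
  qed
  have "measure ?P ?E \<le> measure ?P (?ER \<union> ?ED \<union> ?EQ)"
  proof (rule P.finite_measure_mono_AE)
    show "?ER \<union> ?ED \<union> ?EQ \<in> P.events"
      using sets by auto
    show "AE \<omega> in ?P. \<omega> \<in> ?E \<longrightarrow> \<omega> \<in> ?ER \<union> ?ED \<union> ?EQ"
      using AE_L0_regular[OF \<theta>0 start, of n x0]
    proof eventually_elim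
      case (elim \<omega>)
      show ?case
      proof (rule impI, rule ccontr)
        assume \<omega>E: "\<omega> \<in> ?E" and "\<omega> \<notin> ?ER \<union> ?ED \<union> ?EQ"
        then have \<omega>: "snd \<omega> \<notin> R" "ennreal \<delta> * ?L \<omega> \<le> ?D \<omega>" "ennreal (1 / (e * \<delta>)) * Q \<omega> < 1"
          by (auto simp: not_le not_less)
        have "posterior H n (snd \<omega>) W \<ge> 0"
          by (simp add: posterior_def)
        then have "e < enn2real (?N \<omega> W / ?D \<omega>)"
          using \<omega>E by (simp add: posterior_def)
        then have ratio: "ennreal e < ?N \<omega> W / ?D \<omega>"
          using e by (cases "?N \<omega> W / ?D \<omega>") (auto simp: ennreal_less_iff)
        have NW: "?N \<omega> W \<le> (\<Sum>i\<in>I. ?N \<omega> (B i))"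
        proof -
          have BU: "(\<lambda>z. indicator (B i \<times> UNIV) z :: ennreal) \<in> borel_measurable (full_prior H)" if "i \<in> I" for i
          proof (rule borel_measurable_indicator)
            show "B i \<times> UNIV \<in> sets (full_prior H)"
              using B[OF that] by (auto intro!: pair_measureI simp: sets_Init)
          qed
          have "?N \<omega> W \<le> (\<integral>\<^sup>+z. (\<Sum>i\<in>I. cond_lik H n (fst z) (snd z) (snd \<omega>) * indicator (B i \<times> UNIV) z) \<partial>full_prior H)"
          proof (rule nn_integral_mono)
            fix z :: "'a \<times> 'x"
            show "cond_lik H n (fst z) (snd z) (snd \<omega>) * indicator (W \<times> UNIV) z \<le>
                (\<Sum>i\<in>I. cond_lik H n (fst z) (snd z) (snd \<omega>) * indicator (B i \<times> UNIV) z)"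
            proof (cases "fst z \<in> W")
              case True
              then obtain i where i: "i \<in> I" "fst z \<in> B i"
                using W by auto
              have "cond_lik H n (fst z) (snd z) (snd \<omega>) * indicator (B i \<times> UNIV) z \<le>
                  (\<Sum>i\<in>I. cond_lik H n (fst z) (snd z) (snd \<omega>) * indicator (B i \<times> UNIV) z)"
                using i I by (intro member_le_sum) auto
              then show ?thesis
                using i True by (simp add: indicator_def mem_Times_iff)
            qed (simp add: indicator_def mem_Times_iff)
          qed
          also have "\<dots> = (\<Sum>i\<in>I. ?N \<omega> (B i))"
            by (rule nn_integral_sum) (use BU measurable_cond_lik_prior in measurable)
          finally show ?thesis .
        qed
        have L0: "?L \<omega> \<noteq> 0" "?L \<omega> \<noteq> \<infinity>"
          using elim by auto
        have Q_eq: "Q \<omega> = (\<Sum>i\<in>I. ?N \<omega> (B i)) / ?L \<omega>"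
          using \<omega>(1) by (simp add: Q_def divide_ennreal_def sum_distrib_right)
        have "?D \<omega> \<noteq> 0"
          using \<omega>(2) L0 \<delta> by auto
        have "?D \<omega> \<noteq> \<infinity>"
          using ratio by auto
        have "ennreal e * ?D \<omega> < ?N \<omega> W"
        proof (rule ccontr)
          assume "\<not> ennreal e * ?D \<omega> < ?N \<omega> W"
          then have "?N \<omega> W / ?D \<omega> \<le> ennreal e * ?D \<omega> / ?D \<omega>"
            by (intro divide_right_mono_ennreal) simp
          also have "\<dots> = ennreal e"
            using \<open>?D \<omega> \<noteq> 0\<close> \<open>?D \<omega> \<noteq> \<infinity>\<close> by (intro mult_divide_eq_ennreal) auto
          finally show False using ratio by simp
        qed
        then have NB: "ennreal e * ?D \<omega> < (\<Sum>i\<in>I. ?N \<omega> (B i))"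
          using NW by (rule less_le_trans)
        have "ennreal e * (ennreal \<delta> * ?L \<omega>) \<le> ennreal e * ?D \<omega>"
          using \<omega>(2) by (rule mult_left_mono) simp
        then have "ennreal (e * \<delta>) * ?L \<omega> \<le> ennreal e * ?D \<omega>"
          using e \<delta> by (simp add: ennreal_mult mult.assoc)
        then have lt: "ennreal (e * \<delta>) * ?L \<omega> < (\<Sum>i\<in>I. ?N \<omega> (B i))"
          using NB by (rule le_less_trans)
        have "ennreal (e * \<delta>) \<le> Q \<omega>"
        proof (rule ccontr)
          assume "\<not> ennreal (e * \<delta>) \<le> Q \<omega>"
          then have "(\<Sum>i\<in>I. ?N \<omega> (B i)) / ?L \<omega> < ennreal (e * \<delta>)"
            by (simp add: Q_eq)
          then have "(\<Sum>i\<in>I. ?N \<omega> (B i)) < ennreal (e * \<delta>) * ?L \<omega>"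
            using L0 by (subst (asm) divide_less_ennreal) (simp_all add: less_top)
          with lt show False by simp
        qed
        then have "ennreal (1 / (e * \<delta>)) * ennreal (e * \<delta>) \<le> ennreal (1 / (e * \<delta>)) * Q \<omega>"
          by (rule mult_left_mono) simp
        moreover have "ennreal (1 / (e * \<delta>)) * ennreal (e * \<delta>) = 1"
          using e \<delta> by (simp add: ennreal_mult'[symmetric])
        ultimately show False
          using \<omega>(3) by simp
      qed
    qed
  qed
  also have "\<dots> \<le> measure ?P ?ER + measure ?P ?ED + measure ?P ?EQ"
    using measure_Un_le[OF sets.Un[OF sets(1,2)] sets(3)] measure_Un_le[OF sets(1,2)] by linarith
  also have "measure ?P ?ED \<le> 2 * \<eta>"
    unfolding \<delta>_def by (rule prob_denominator_small[OF \<theta>0 start S pos \<eta>])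
  also have "measure ?P ?EQ \<le> exp A * (2 / e) * (exp v / measure (full_prior H) S * (\<Sum>i\<in>I. \<beta> i * measure (Prior H) (B i)))"
  proof -
    let ?b = "\<Sum>i\<in>I. \<beta> i * measure (Prior H) (B i)"
    have b: "?b \<ge> 0" using \<beta>0 by (intro sum_nonneg) auto
    have "emeasure ?P ?EQ \<le> ennreal (1 / (e * \<delta>)) * (\<integral>\<^sup>+\<omega>. Q \<omega> * indicator (space ?P) \<omega> \<partial>?P)"
      by (rule nn_integral_Markov_inequality) measurable
    also have "(\<integral>\<^sup>+\<omega>. Q \<omega> * indicator (space ?P) \<omega> \<partial>?P) = (\<integral>\<^sup>+\<omega>. Q \<omega> \<partial>?P)"
      by (intro nn_integral_cong) simp
    also have "ennreal (1 / (e * \<delta>)) * \<dots> \<le> ennreal (1 / (e * \<delta>)) * ennreal (exp A * ?b)"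
      by (intro mult_left_mono EQ) simp
    also have "\<dots> = ennreal (1 / (e * \<delta>) * (exp A * ?b))"
      using e \<delta> b by (subst ennreal_mult) auto
    finally have "measure ?P ?EQ \<le> 1 / (e * \<delta>) * (exp A * ?b)"
      using e \<delta> b by (simp add: P.emeasure_eq_measure ennreal_le_iff)
    also have "\<dots> = exp A * (2 / e) * (exp v / measure (full_prior H) S * ?b)"
      using e pos by (simp add: \<delta>_def exp_minus field_simps)
    finally show ?thesis .
  qed
  finally show ?thesis by simp
qed

text \<open>
  The rejection region is the union of those for the shells; it is determined by the first
  \<open>(n div l) * l\<close> observations. On the complement of \<open>F\<close>, where there is no test, only the small
  prior mass helps.
\<close>

lemma posterior_bound_shells:
  fixes n p :: nat and \<epsilon> :: real and G :: "nat \<Rightarrow> 'a set" and T :: "nat \<Rightarrow> 'a set"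
  defines "l \<equiv> Suc p"
  assumes \<theta>0: "\<theta>0 \<in> Par H" and \<rho>0: "Rho H \<theta>0 > 1"
    and start: "\<And>x x'. AE \<omega> in hmm_law H \<theta>0. \<forall>n.
        \<bar>cond_loglik H n \<theta>0 x (snd \<omega>) - cond_loglik H n \<theta>0 x' (snd \<omega>)\<bar> \<le> ereal A"
    and S: "S \<in> sets (full_prior H)" and pos: "measure (full_prior H) S > 0"
    and \<eta>: "\<And>\<theta> x. (\<theta>, x) \<in> S \<Longrightarrow>
      \<P>(\<omega> in hmm_law H \<theta>0. cond_loglik H n \<theta> x (snd \<omega>) - cond_loglik H n \<theta>0 x0 (snd \<omega>) \<le> ereal (- v)) \<le> \<eta>"
    and \<epsilon>: "\<epsilon> > 0" and k\<epsilon>: "3 < 2 * real (n div l) * \<epsilon>"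
    and J: "finite J" "\<And>m. m \<in> J \<Longrightarrow> 1 \<le> m" "\<And>m. m \<in> J \<Longrightarrow> real m * \<epsilon> \<le> 2"
    and F: "F \<in> sets (Prior H)" and G: "\<And>m. m \<in> J \<Longrightarrow> G m \<in> sets (Prior H)"
    and sep: "\<And>m \<theta>. m \<in> J \<Longrightarrow> \<theta> \<in> G m \<Longrightarrow> real m * \<epsilon> \<le> weighted_dist H l \<theta>0 \<theta>"
    and T: "\<And>m. m \<in> J \<Longrightarrow> finite (T m)" "\<And>m. m \<in> J \<Longrightarrow> T m \<subseteq> Par H"
      "\<And>m \<theta>. m \<in> J \<Longrightarrow> \<theta> \<in> G m \<Longrightarrow> \<exists>t\<in>T m. dens_dist H l t \<theta> \<le> real m * \<epsilon> / 12"
      "\<And>m. m \<in> J \<Longrightarrow> real (card (T m)) \<le> exp (real n * (real m * \<epsilon>)\<^sup>2 * (mix_rate \<theta>0)\<^sup>2 / (16 * real l))"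
    and W: "W \<subseteq> (Par H - F) \<union> (\<Union>m\<in>J. G m)"
    and e: "e > 0"
  shows "\<P>(\<omega> in hmm_law H \<theta>0. e < \<bar>posterior H n (snd \<omega>) W\<bar>) \<le>
    exp (1 / 2) * (\<Sum>m\<in>J. exp (- (real n * (real m * \<epsilon>)\<^sup>2 * (mix_rate \<theta>0)\<^sup>2 / (16 * real l)))) + 2 * \<eta> +
    exp A * (2 / e) * (exp v / measure (full_prior H) S *
      (measure (Prior H) (Par H - F) + exp 1 * (\<Sum>m\<in>J. exp (- (real n * (real m * \<epsilon>)\<^sup>2 / (18 * real l))) * measure (Prior H) (G m))))"
proof -
  let ?P = "hmm_law H \<theta>0"
  let ?k = "n div l"
  interpret P: prob_space ?P by (rule prob_space_true[OF \<theta>0 start])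
  have l: "l \<ge> 1" by (simp add: l_def)
  have k: "?k > 0" using k\<epsilon> by (cases "?k = 0") auto
  have s: "0 < real m * \<epsilon>" "3 < 2 * real ?k * (real m * \<epsilon>)" if "m \<in> J" for m
  proof -
    have m: "1 \<le> real m" using J(2)[OF that] by simp
    then show "0 < real m * \<epsilon>" using \<epsilon> by simp
    have "2 * real ?k * \<epsilon> * 1 \<le> 2 * real ?k * \<epsilon> * real m"
      using m \<epsilon> by (intro mult_left_mono) auto
    then show "3 < 2 * real ?k * (real m * \<epsilon>)"
      using k\<epsilon> by (simp add: mult_ac)
  qed
  define good where "good m R \<longleftrightarrow> R \<in> sets seqs \<and> depends_below (?k * l) (\<lambda>y. y \<in> R) \<and>
    \<P>(\<omega> in ?P. snd \<omega> \<in> R) \<le> real (card (T m)) * exp (- real ?k * (real m * \<epsilon>)\<^sup>2 * (mix_rate \<theta>0)\<^sup>2 / 8) \<and>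
    (\<forall>\<theta>\<in>G m. \<forall>x. miss_prob \<theta> x R \<le> exp (- 2 * real ?k * (real m * \<epsilon> / 6 - 1 / (4 * real ?k))\<^sup>2))" for m R
  have "\<exists>R. good m R" if m: "m \<in> J" for m
  proof -
    have "G m \<subseteq> Par H"
      using sets.sets_into_space[OF G[OF m]] by (simp add: space_Prior)
    show ?thesis
    proof (rule separating_test[OF \<theta>0 \<rho>0 T(1,2)[OF m] \<open>G m \<subseteq> Par H\<close> T(3)[OF m, unfolded l_def] sep[OF m, unfolded l_def] s(1,2)[OF m]], goal_cases)
      case (3 R)
      then show ?case unfolding good_def l_def by blast
    qed simp_all
  qed
  then obtain Rm where good: "\<And>m. m \<in> J \<Longrightarrow> good m (Rm m)"
    by metis
  note Rm = good[unfolded good_def, THEN conjunct1] good[unfolded good_def, THEN conjunct2, THEN conjunct1]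
    good[unfolded good_def, THEN conjunct2, THEN conjunct2, THEN conjunct1]
    good[unfolded good_def, THEN conjunct2, THEN conjunct2, THEN conjunct2, rule_format]
  define R where "R = (\<Union>m\<in>J. Rm m)"
  have R: "R \<in> sets seqs"
    unfolding R_def using J(1) Rm(1) by auto
  have "?k * l \<le> n" by simp
  then have depR: "depends_below n (\<lambda>y. y \<in> R)"
    unfolding depends_below_def R_def
  proof (intro allI impI)
    fix x y :: "nat \<Rightarrow> 'y" assume "\<forall>i<n. x i = y i"
    then have "x \<in> Rm m \<longleftrightarrow> y \<in> Rm m" if "m \<in> J" for m
      using depends_belowD[OF Rm(2)[OF that], of x y] \<open>?k * l \<le> n\<close> by simp
    then show "(x \<in> \<Union> (Rm ` J)) = (y \<in> \<Union> (Rm ` J))" by auto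
  qed
  have PR: "\<P>(\<omega> in ?P. snd \<omega> \<in> R) \<le>
      exp (1 / 2) * (\<Sum>m\<in>J. exp (- (real n * (real m * \<epsilon>)\<^sup>2 * (mix_rate \<theta>0)\<^sup>2 / (16 * real l))))"
  proof -
    interpret M0: hidden_markov "Ker H \<theta>0" "Ref H" "Emi H \<theta>0" by (rule hidden_markov_H[OF \<theta>0])
    have ev: "{\<omega> \<in> space ?P. snd \<omega> \<in> Rm m} \<in> P.events" if "m \<in> J" for m
      unfolding hmm_law_eq_start_law[OF \<theta>0] by (rule M0.law_event[OF stat_prob[OF \<theta>0] Rm(1)[OF that]])
    have "{\<omega> \<in> space ?P. snd \<omega> \<in> R} = (\<Union>m\<in>J. {\<omega> \<in> space ?P. snd \<omega> \<in> Rm m})"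
      by (auto simp: R_def)
    then have "\<P>(\<omega> in ?P. snd \<omega> \<in> R) \<le> (\<Sum>m\<in>J. \<P>(\<omega> in ?P. snd \<omega> \<in> Rm m))"
      using ev by (simp only:) (intro P.finite_measure_subadditive_finite J(1); auto)
    also have "\<dots> \<le> (\<Sum>m\<in>J. exp (1 / 2) * exp (- (real n * (real m * \<epsilon>)\<^sup>2 * (mix_rate \<theta>0)\<^sup>2 / (16 * real l))))"
    proof (rule sum_mono)
      fix m assume m: "m \<in> J"
      let ?a = "real n * (real m * \<epsilon>)\<^sup>2 * (mix_rate \<theta>0)\<^sup>2 / (16 * real l)"
      let ?b = "real ?k * (real m * \<epsilon>)\<^sup>2 * (mix_rate \<theta>0)\<^sup>2 / 8"
      have "\<P>(\<omega> in ?P. snd \<omega> \<in> Rm m) \<le> exp ?a * exp (- ?b)"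
      proof -
        have "- real ?k * (real m * \<epsilon>)\<^sup>2 * (mix_rate \<theta>0)\<^sup>2 / 8 = - ?b" by simp
        from order_trans[OF Rm(3)[OF m, unfolded this] mult_right_mono[OF T(4)[OF m]]] show ?thesis by simp
      qed
      also have "\<dots> = exp (?a - ?b)"
        unfolding mult_exp_exp by simp
      also have "\<dots> \<le> exp (1 / 2 - ?a)"
        using type_I_exponent[OF l s(1)[OF m] J(3)[OF m] mix_rate_nonneg[OF \<theta>0] mix_rate_le_1[OF \<theta>0], of n] by simp
      also have "\<dots> = exp (1 / 2) * exp (- ?a)"
        unfolding mult_exp_exp by simp
      finally show "\<P>(\<omega> in ?P. snd \<omega> \<in> Rm m) \<le> exp (1 / 2) * exp (- ?a)" .
    qed
    finally show ?thesis by (simp add: sum_distrib_left)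
  qed
  have J0: "0 \<notin> J" using J(2) by fastforce
  \<comment> \<open>index 0 is free because shells are numbered from 1; it stands for the complement of \<open>F\<close>\<close>
  define B where "B i = (if i = 0 then Par H - F else G i)" for i
  define \<beta> where "\<beta> i = (if i = 0 then 1 else exp 1 * exp (- (real n * (real i * \<epsilon>)\<^sup>2 / (18 * real l))))" for i
  have "\<P>(\<omega> in ?P. e < \<bar>posterior H n (snd \<omega>) W\<bar>) \<le>
    \<P>(\<omega> in ?P. snd \<omega> \<in> R) + 2 * \<eta> +
    exp A * (2 / e) * (exp v / measure (full_prior H) S * (\<Sum>i\<in>insert 0 J. \<beta> i * measure (Prior H) (B i)))"
  proof (rule posterior_exceeds_bound[OF \<theta>0 start S pos \<eta> R depR])
    show "finite (insert 0 J)" using J(1) by simp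
    show "W \<subseteq> (\<Union>i\<in>insert 0 J. B i)"
    proof -
      have "(\<Union>i\<in>J. B i) = (\<Union>m\<in>J. G m)"
        by (rule SUP_cong) (use J0 in \<open>auto simp: B_def\<close>)
      moreover have "B 0 = Par H - F"
        by (simp add: B_def)
      ultimately show ?thesis
        using W by (simp only: UN_insert)
    qed
    show "B i \<in> sets (Prior H)" if "i \<in> insert 0 J" for i
      using that G F J0 sets.compl_sets[OF F] by (auto simp: B_def space_Prior)
    show "0 \<le> \<beta> i" for i by (simp add: \<beta>_def)
    fix i \<theta> x assume i: "i \<in> insert 0 J" and \<theta>B: "\<theta> \<in> B i"
    have \<theta>: "\<theta> \<in> Par H"
      using sets.sets_into_space[OF G] i \<theta>B by (auto simp: B_def space_Prior split: if_splits)
    interpret T: hidden_markov "Ker H \<theta>" "Ref H" "Emi H \<theta>" by (rule hidden_markov_H[OF \<theta>])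
    interpret TP: prob_space "start_law \<theta> (Ker H \<theta> x)" by (rule T.prob_space_law[OF T.K_prob])
    show "miss_prob \<theta> x R \<le> \<beta> i"
    proof (cases "i = 0")
      case False
      then have m: "i \<in> J" and \<theta>G: "\<theta> \<in> G i" using i \<theta>B by (auto simp: B_def)
      have "miss_prob \<theta> x R \<le>
          miss_prob \<theta> x (Rm i)"
      proof (rule TP.finite_measure_mono)
        show "{\<omega> \<in> space (start_law \<theta> (Ker H \<theta> x)). snd \<omega> \<notin> R} \<subseteq> {\<omega> \<in> space (start_law \<theta> (Ker H \<theta> x)). snd \<omega> \<notin> Rm i}"
          using m by (auto simp: R_def)
        have "- Rm i \<in> sets seqs"
          using sets.compl_sets[OF Rm(1)[OF m]] by (simp add: Compl_eq_Diff_UNIV space_PiM)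
        from T.law_event[OF T.K_prob this, of x]
        show "{\<omega> \<in> space (start_law \<theta> (Ker H \<theta> x)). snd \<omega> \<notin> Rm i} \<in> TP.events" by simp
      qed
      also have "\<dots> \<le> exp (- 2 * real ?k * (real i * \<epsilon> / 6 - 1 / (4 * real ?k))\<^sup>2)"
        by (rule Rm(4)[OF m \<theta>G])
      also have "\<dots> \<le> exp (1 - real n * (real i * \<epsilon>)\<^sup>2 / (18 * real l))"
        using type_II_exponent[OF l s(1)[OF m] J(3)[OF m] k] by simp
      also have "\<dots> = \<beta> i"
        using False by (simp add: \<beta>_def exp_diff exp_minus field_simps)
      finally show ?thesis .
    qed (simp add: \<beta>_def)
  qed (assumption | rule e)+
  also have "(\<Sum>i\<in>insert 0 J. \<beta> i * measure (Prior H) (B i)) =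
      measure (Prior H) (Par H - F) + exp 1 * (\<Sum>m\<in>J. exp (- (real n * (real m * \<epsilon>)\<^sup>2 / (18 * real l))) * measure (Prior H) (G m))"
  proof -
    have "(\<Sum>i\<in>J. \<beta> i * measure (Prior H) (B i)) = (\<Sum>m\<in>J. exp 1 * (exp (- (real n * (real m * \<epsilon>)\<^sup>2 / (18 * real l))) * measure (Prior H) (G m)))"
      by (rule sum.cong) (use J0 in \<open>auto simp: \<beta>_def B_def\<close>)
    then show ?thesis
      using J(1) J0 by (simp add: sum_distrib_left \<beta>_def B_def)
  qed
  finally show ?thesis
    using PR by linarith
qed

end

section \<open>Contraction of the posterior\<close>

lemma exp_neg_tendsto_0:
  fixes f :: "nat \<Rightarrow> real"
  assumes "filterlim f at_top sequentially" "a > 0"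
  shows "(\<lambda>n. exp (- (a * f n))) \<longlonglongrightarrow> 0"
proof -
  have "filterlim (\<lambda>n. a * f n) at_top sequentially"
    by (rule filterlim_tendsto_pos_mult_at_top[OF tendsto_const assms(2,1)])
  then have "filterlim (\<lambda>n. - (a * f n)) at_bot sequentially"
    by (simp add: filterlim_uminus_at_top)
  then show ?thesis
    by (rule filterlim_compose[OF exp_at_bot])
qed

text \<open>
  As \<open>m \<le> m\<^sup>2\<close>, the sum is dominated by a geometric series.
\<close>

lemma sum_exp_squares_le:
  fixes c :: real
  assumes J: "finite J" "\<And>m. m \<in> J \<Longrightarrow> 1 \<le> m" and c: "c \<ge> 0" and q: "exp (- c) \<le> 1 / 2"
  shows "(\<Sum>m\<in>J. exp (- (c * (real m)\<^sup>2))) \<le> 2 * exp (- c)"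
proof -
  obtain M where M: "J \<subseteq> {..<M}"
    using J(1) finite_nat_iff_bounded by auto
  let ?q = "exp (- c)"
  have "(\<Sum>m\<in>J. exp (- (c * (real m)\<^sup>2))) \<le> (\<Sum>m\<in>J. ?q ^ m)"
  proof (rule sum_mono)
    fix m assume "m \<in> J"
    then have "1 \<le> real m" using J(2) by simp
    then have "real m \<le> (real m)\<^sup>2"
      by (simp add: power2_eq_square)
    then have "c * real m \<le> c * (real m)\<^sup>2"
      using c by (rule mult_left_mono)
    then have "exp (- (c * (real m)\<^sup>2)) \<le> exp (real m * - c)"
      by (simp add: mult.commute)
    then show "exp (- (c * (real m)\<^sup>2)) \<le> ?q ^ m"
      by (simp only: exp_of_nat_mult)
  qed
  also have "\<dots> \<le> (\<Sum>m\<in>{1..<Suc M}. ?q ^ m)"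
    using M J by (intro sum_mono2) (auto simp: subset_eq less_Suc_eq)
  also have "\<dots> = ?q * (\<Sum>m<M. ?q ^ m)"
    by (simp only: sum_distrib_left power_Suc[symmetric] lessThan_atLeast0 One_nat_def sum.shift_bounds_Suc_ivl)
  also have "\<dots> \<le> ?q * 2"
  proof (rule mult_left_mono)
    have "(1 - ?q) * (\<Sum>m<M. ?q ^ m) \<le> 1"
      by (simp flip: one_diff_power_eq)
    moreover have "1 / 2 * (\<Sum>m<M. ?q ^ m) \<le> (1 - ?q) * (\<Sum>m<M. ?q ^ m)"
      using q by (intro mult_right_mono sum_nonneg) auto
    ultimately show "(\<Sum>m<M. ?q ^ m) \<le> 2" by linarith
  qed simp
  finally show ?thesis by simp
qed

context hmm_setting
begin

lemma weighted_dist_bounds: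
  assumes "\<theta> \<in> Par H" "\<theta>0 \<in> Par H"
  shows "weighted_dist H l \<theta>0 \<theta> \<in> {0..2}"
proof -
  have "dens_dist H l \<theta> \<theta>0 * mix_rate \<theta> \<le> 2 * 1"
    using dens_dist_le_2[OF assms] mix_rate_le_1[OF assms(1)] mix_rate_nonneg[OF assms(1)] by (intro mult_mono) auto
  moreover have "0 \<le> dens_dist H l \<theta> \<theta>0 * mix_rate \<theta>"
    using dens_dist_nonneg mix_rate_nonneg[OF assms(1)] by (intro mult_nonneg_nonneg) auto
  ultimately show ?thesis
    by (simp add: weighted_dist_def mix_rate_def)
qed

text \<open>
  The common part of the two sets of conditions: the region of interest is covered, up to the complement
  of \<open>F n\<close>, by finitely many shells with controlled entropy, and the prior masses of the shells, weighted
  by the second error of the tests, are negligible against the lower bound of the denominator.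
\<close>

lemma posterior_tendsto_0:
  fixes S :: "nat \<Rightarrow> ('a \<times> 'x) set" and F :: "nat \<Rightarrow> 'a set" and C r \<epsilon> :: "nat \<Rightarrow> real"
    and J :: "nat \<Rightarrow> nat set" and G :: "nat \<Rightarrow> nat \<Rightarrow> 'a set" and p :: nat
  defines "l \<equiv> Suc p"
  assumes \<theta>0: "\<theta>0 \<in> Par H" and \<rho>0: "Rho H \<theta>0 > 1"
    and C1: "cond_C1 H \<theta>0 x0 S C r" and C2: "cond_C2 H F C r"
    and r\<epsilon>: "\<And>n. 1 \<le> n \<Longrightarrow> r n \<le> \<epsilon> n" and \<epsilon>0: "\<epsilon> \<longlonglongrightarrow> 0"
    and J: "eventually (\<lambda>n. finite (J n) \<and> (\<forall>m\<in>J n. 1 \<le> m \<and> real m * \<epsilon> n \<le> 2)) sequentially"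
    and G: "eventually (\<lambda>n. \<forall>m\<in>J n. G n m \<in> sets (Prior H) \<and> (\<forall>\<theta>\<in>G n m. real m * \<epsilon> n \<le> weighted_dist H l \<theta>0 \<theta>)) sequentially"
    and T: "eventually (\<lambda>n. \<forall>m\<in>J n. \<exists>T. finite T \<and> T \<subseteq> Par H \<and>
      (\<forall>\<theta>\<in>G n m. \<exists>t\<in>T. dens_dist H l t \<theta> \<le> real m * \<epsilon> n / 12) \<and>
      real (card T) \<le> exp (real n * (real m * \<epsilon> n)\<^sup>2 * (mix_rate \<theta>0)\<^sup>2 / (16 * real l))) sequentially"
    and cover: "eventually (\<lambda>n. {\<theta> \<in> Par H. \<epsilon> n \<le> weighted_dist H l \<theta>0 \<theta>} \<subseteq> (Par H - F n) \<union> (\<Union>m\<in>J n. G n m)) sequentially"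
    and Y: "(\<lambda>n. exp (real n * (r n)\<^sup>2) / measure (full_prior H) (S n) *
      (\<Sum>m\<in>J n. exp (- (real n * (real m * \<epsilon> n)\<^sup>2 / (18 * real l))) * measure (Prior H) (G n m))) \<longlonglongrightarrow> 0"
  shows "tendsto_0_in_prob (hmm_law H \<theta>0)
           (\<lambda>n \<omega>. posterior H n (snd \<omega>) {\<theta> \<in> Par H. weighted_dist H l \<theta>0 \<theta> \<ge> \<epsilon> n})"
  unfolding tendsto_0_in_prob_def
proof (intro allI impI)
  fix e :: real assume e: "e > 0"
  let ?P = "hmm_law H \<theta>0"
  define \<eta> where "\<eta> n = (SUP (\<theta>, x)\<in>S n. \<P>(\<omega> in ?P.
        cond_loglik H n \<theta> x (snd \<omega>) - cond_loglik H n \<theta>0 x0 (snd \<omega>) \<le> ereal (- (real n * (r n)\<^sup>2))))" for n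
  obtain A where A: "A > 0" "\<And>x x'. AE \<omega> in ?P. \<forall>n.
        \<bar>cond_loglik H n \<theta>0 x (snd \<omega>) - cond_loglik H n \<theta>0 x' (snd \<omega>)\<bar> \<le> ereal A"
    using C1 unfolding cond_C1_def by blast
  obtain c where c: "c > 0" "\<And>n. 1 \<le> n \<Longrightarrow> measure (full_prior H) (S n) \<ge> c * exp (- (C n * real n * (r n)\<^sup>2))"
    using C1 unfolding cond_C1_def by blast
  have S: "S n \<in> sets (full_prior H)" and r: "r n > 0" if "1 \<le> n" for n
    using C1 that unfolding cond_C1_def by auto
  have \<eta>0: "\<eta> \<longlonglongrightarrow> 0"
    using C1 unfolding cond_C1_def \<eta>_def[abs_def] by blast
  have nr: "filterlim (\<lambda>n. real n * (r n)\<^sup>2) at_top sequentially"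
    using C1 unfolding cond_C1_def by blast
  define v \<sigma> where "v n = real n * (r n)\<^sup>2" and "\<sigma> n = measure (full_prior H) (S n)" for n
  interpret P: prob_space ?P by (rule prob_space_true[OF \<theta>0 A(2)])
  have \<eta>: "\<P>(\<omega> in ?P. cond_loglik H n \<theta> x (snd \<omega>) - cond_loglik H n \<theta>0 x0 (snd \<omega>) \<le> ereal (- v n)) \<le> \<eta> n"
    if "(\<theta>, x) \<in> S n" for n \<theta> x
  proof -
    have "bdd_above ((\<lambda>(\<theta>, x). \<P>(\<omega> in ?P. cond_loglik H n \<theta> x (snd \<omega>) - cond_loglik H n \<theta>0 x0 (snd \<omega>) \<le> ereal (- v n))) ` S n)"
      by (rule bdd_aboveI2[of _ _ 1]) (auto intro: P.prob_le_1)
    from cSUP_upper[OF that this] show ?thesis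
      by (simp add: \<eta>_def v_def)
  qed
  have \<sigma>: "\<sigma> n > 0" "exp (v n) / \<sigma> n \<le> exp (v n * (1 + C n)) / c" if "1 \<le> n" for n
  proof -
    have lb: "c * exp (- (C n * v n)) \<le> \<sigma> n"
      using c(2)[OF that] by (simp add: \<sigma>_def v_def mult.assoc)
    then show "\<sigma> n > 0"
      using c(1) by (meson exp_gt_zero less_le_trans mult_pos_pos)
    have "exp (v n) / \<sigma> n \<le> exp (v n) / (c * exp (- (C n * v n)))"
      using lb c(1) \<open>\<sigma> n > 0\<close> by (intro divide_left_mono) auto
    also have "\<dots> = exp (v n * (1 + C n)) / c"
      by (simp add: exp_minus exp_add field_simps)
    finally show "exp (v n) / \<sigma> n \<le> exp (v n * (1 + C n)) / c" .
  qed
  have \<epsilon>pos: "\<epsilon> n > 0" if "1 \<le> n" for n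
    using r[OF that] r\<epsilon>[OF that] by linarith
  have n\<epsilon>: "filterlim (\<lambda>n. real n * (\<epsilon> n)\<^sup>2) at_top sequentially"
  proof (rule filterlim_at_top_mono[OF nr])
    show "eventually (\<lambda>n. real n * (r n)\<^sup>2 \<le> real n * (\<epsilon> n)\<^sup>2) sequentially"
      using eventually_ge_at_top[of 1]
    proof eventually_elim
      case (elim n)
      show ?case
        using r[OF elim] r\<epsilon>[OF elim] by (intro mult_left_mono power_mono) auto
    qed
  qed
  let ?a = "(mix_rate \<theta>0)\<^sup>2 / (16 * real l)"
  have a: "?a > 0"
    using mix_rate_pos[OF \<theta>0 \<rho>0] by (simp add: l_def)
  define q where "q n = exp (- (?a * (real n * (\<epsilon> n)\<^sup>2)))" for n
  have q: "q \<longlonglongrightarrow> 0"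
    unfolding q_def[abs_def] by (rule exp_neg_tendsto_0[OF n\<epsilon> a])
  \<comment> \<open>the test needs more than \<open>3 / (2 \<epsilon>)\<close> blocks; there are about \<open>n / l\<close>, and \<open>n \<epsilon>\<^sup>2\<close> is unbounded\<close>
  have k\<epsilon>: "eventually (\<lambda>n. 3 < 2 * real (n div l) * \<epsilon> n) sequentially"
  proof -
    have "eventually (\<lambda>n. \<epsilon> n < 1) sequentially"
      using \<epsilon>0 by (rule order_tendstoD) simp
    moreover have "eventually (\<lambda>n. real n * (\<epsilon> n)\<^sup>2 \<ge> 3 * real l) sequentially"
      using n\<epsilon> unfolding filterlim_at_top by blast
    ultimately show ?thesis
      using eventually_ge_at_top[of 1]
    proof eventually_elim
      case (elim n)
      have \<epsilon>n: "0 < \<epsilon> n" by (rule \<epsilon>pos[OF elim(3)])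
      have l: "real l > 0" "l \<ge> 1" by (simp_all add: l_def)
      have "(\<epsilon> n)\<^sup>2 \<le> \<epsilon> n"
        using elim(1) \<epsilon>n by (simp add: power2_eq_square mult_left_le)
      then have "real n * (\<epsilon> n)\<^sup>2 \<le> real n * \<epsilon> n"
        by (intro mult_left_mono) auto
      then have "3 * real l \<le> real n * \<epsilon> n" using elim(2) by linarith
      then have "3 \<le> real n / real l * \<epsilon> n"
        using l by (simp add: field_simps)
      moreover have "(real n / real l - 1) * \<epsilon> n \<le> real (n div l) * \<epsilon> n"
        using \<epsilon>n by (intro mult_right_mono real_div_ge[OF l(2)]) simp
      ultimately show ?case
        using elim(1) by (simp add: left_diff_distrib)
    qed
  qed
  define X where "X n = exp (v n) / \<sigma> n * measure (Prior H) (Par H - F n)" for n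
  define Z where "Z n = exp (v n) / \<sigma> n *
      (\<Sum>m\<in>J n. exp (- (real n * (real m * \<epsilon> n)\<^sup>2 / (18 * real l))) * measure (Prior H) (G n m))" for n
  have F: "F n \<in> sets (Prior H)" if "1 \<le> n" for n
    using C2 that unfolding cond_C2_def by blast
  have X0: "X \<longlonglongrightarrow> 0"
  proof (rule tendsto_sandwich[OF _ _ tendsto_const])
    have "(\<lambda>n. measure (Prior H) (Par H - F n)) \<in> o(\<lambda>n. exp (- (real n * (r n)\<^sup>2 * (1 + C n))))"
      using C2 unfolding cond_C2_def by blast
    then have "(\<lambda>n. measure (Prior H) (Par H - F n) / exp (- (real n * (r n)\<^sup>2 * (1 + C n)))) \<longlonglongrightarrow> 0"
      by (rule smalloD_tendsto)
    then show "(\<lambda>n. 1 / c * (measure (Prior H) (Par H - F n) / exp (- (v n * (1 + C n))))) \<longlonglongrightarrow> 0"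
      unfolding v_def by (rule tendsto_mult_right_zero)
    show "eventually (\<lambda>n. 0 \<le> X n) sequentially"
      by (simp add: X_def \<sigma>_def)
    show "eventually (\<lambda>n. X n \<le> 1 / c * (measure (Prior H) (Par H - F n) / exp (- (v n * (1 + C n))))) sequentially"
      using eventually_ge_at_top[of 1]
    proof eventually_elim
      case (elim n)
      have "X n \<le> exp (v n * (1 + C n)) / c * measure (Prior H) (Par H - F n)"
        unfolding X_def by (intro mult_right_mono \<sigma>(2)[OF elim]) simp
      then show ?case unfolding exp_minus by (simp add: divide_inverse mult_ac)
    qed
  qed
  let ?B = "\<lambda>n. exp (1 / 2) * (2 * q n) + 2 * \<eta> n + exp A * (2 / e) * (X n + exp 1 * Z n)"
  have B0: "?B \<longlonglongrightarrow> 0"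
  proof -
    have Z0: "Z \<longlonglongrightarrow> 0"
      using Y by (simp add: Z_def[abs_def] v_def \<sigma>_def)
    have "?B \<longlonglongrightarrow> exp (1 / 2) * (2 * 0) + 2 * 0 + exp A * (2 / e) * (0 + exp 1 * 0)"
      by (intro tendsto_intros q \<eta>0 X0 Z0)
    then show ?thesis by simp
  qed
  show "(\<lambda>n. \<P>(\<omega> in ?P. e < \<bar>posterior H n (snd \<omega>) {\<theta> \<in> Par H. weighted_dist H l \<theta>0 \<theta> \<ge> \<epsilon> n}\<bar>)) \<longlonglongrightarrow> 0"
  proof (rule tendsto_sandwich[OF _ _ tendsto_const B0])
    show "eventually (\<lambda>n. 0 \<le> \<P>(\<omega> in ?P. e < \<bar>posterior H n (snd \<omega>) {\<theta> \<in> Par H. weighted_dist H l \<theta>0 \<theta> \<ge> \<epsilon> n}\<bar>)) sequentially"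
      by simp
    have "eventually (\<lambda>n. q n < 1 / 2) sequentially"
      using q by (rule order_tendstoD) simp
    then show "eventually (\<lambda>n. \<P>(\<omega> in ?P. e < \<bar>posterior H n (snd \<omega>) {\<theta> \<in> Par H. weighted_dist H l \<theta>0 \<theta> \<ge> \<epsilon> n}\<bar>) \<le> ?B n) sequentially"
      using J G T cover k\<epsilon> eventually_ge_at_top[of 1]
    proof eventually_elim
      case (elim n)
      let ?W = "{\<theta> \<in> Par H. weighted_dist H l \<theta>0 \<theta> \<ge> \<epsilon> n}"
      have J: "finite (J n)" "\<And>m. m \<in> J n \<Longrightarrow> 1 \<le> m" "\<And>m. m \<in> J n \<Longrightarrow> real m * \<epsilon> n \<le> 2"
        using elim(2) by auto
      have G: "\<And>m. m \<in> J n \<Longrightarrow> G n m \<in> sets (Prior H)"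
        "\<And>m \<theta>. m \<in> J n \<Longrightarrow> \<theta> \<in> G n m \<Longrightarrow> real m * \<epsilon> n \<le> weighted_dist H l \<theta>0 \<theta>"
        using elim(3) by auto
      obtain T where T: "\<And>m. m \<in> J n \<Longrightarrow> finite (T m)" "\<And>m. m \<in> J n \<Longrightarrow> T m \<subseteq> Par H"
        "\<And>m \<theta>. m \<in> J n \<Longrightarrow> \<theta> \<in> G n m \<Longrightarrow> \<exists>t\<in>T m. dens_dist H l t \<theta> \<le> real m * \<epsilon> n / 12"
        "\<And>m. m \<in> J n \<Longrightarrow> real (card (T m)) \<le> exp (real n * (real m * \<epsilon> n)\<^sup>2 * (mix_rate \<theta>0)\<^sup>2 / (16 * real l))"
        using bchoice[OF elim(4)] by blast
      have n: "1 \<le> n" by (rule elim(7))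
      have "\<P>(\<omega> in ?P. e < \<bar>posterior H n (snd \<omega>) ?W\<bar>) \<le>
        exp (1 / 2) * (\<Sum>m\<in>J n. exp (- (real n * (real m * \<epsilon> n)\<^sup>2 * (mix_rate \<theta>0)\<^sup>2 / (16 * real l)))) + 2 * \<eta> n +
        exp A * (2 / e) * (exp (v n) / measure (full_prior H) (S n) *
          (measure (Prior H) (Par H - F n) + exp 1 * (\<Sum>m\<in>J n. exp (- (real n * (real m * \<epsilon> n)\<^sup>2 / (18 * real l))) * measure (Prior H) (G n m))))"
        unfolding l_def
        by (rule posterior_bound_shells[OF \<theta>0 \<rho>0 A(2) S[OF n] \<sigma>(1)[OF n, unfolded \<sigma>_def] \<eta> \<epsilon>pos[OF n] elim(6)[unfolded l_def]
            J F[OF n] G[unfolded l_def] T[unfolded l_def] elim(5)[unfolded l_def] e])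
      also have "(\<Sum>m\<in>J n. exp (- (real n * (real m * \<epsilon> n)\<^sup>2 * (mix_rate \<theta>0)\<^sup>2 / (16 * real l)))) \<le> 2 * q n"
      proof -
        have sq: "exp (- (real n * (real m * \<epsilon> n)\<^sup>2 * (mix_rate \<theta>0)\<^sup>2 / (16 * real l))) =
            exp (- (?a * (real n * (\<epsilon> n)\<^sup>2) * (real m)\<^sup>2))" for m
          by (simp add: power_mult_distrib mult_ac)
        show ?thesis
          unfolding sq q_def
        proof (rule sum_exp_squares_le[OF J(1,2)])
          show "0 \<le> ?a * (real n * (\<epsilon> n)\<^sup>2)"
            using a by simp
          show "exp (- (?a * (real n * (\<epsilon> n)\<^sup>2))) \<le> 1 / 2"
            using elim(1) unfolding q_def by (rule less_imp_le)
        qed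
      qed
      also have "exp (v n) / measure (full_prior H) (S n) *
          (measure (Prior H) (Par H - F n) + exp 1 * (\<Sum>m\<in>J n. exp (- (real n * (real m * \<epsilon> n)\<^sup>2 / (18 * real l))) * measure (Prior H) (G n m)))
          = X n + exp 1 * Z n"
        by (simp add: X_def Z_def \<sigma>_def distrib_left mult_ac)
      finally show ?case by simp
    qed
  qed
qed

end

theorem theorem4:
  fixes H :: "('a::euclidean_space, 'x::polish_space, 'y::polish_space) hmm"
    and \<theta>0 :: 'a and x0 :: 'x and l :: nat
    and S :: "nat \<Rightarrow> ('a \<times> 'x) set" and F :: "nat \<Rightarrow> 'a set"
    and C r \<epsilon> :: "nat \<Rightarrow> real"
  assumes "hmm_setting H"
    and "\<theta>0 \<in> Par H"
    and "1 \<le> l"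
    and "(\<lambda>\<theta>. weighted_dist H l \<theta>0 \<theta>) \<in> borel_measurable (Prior H)"
    and "Rho H \<theta>0 > 1"
    and "cond_C1 H \<theta>0 x0 S C r"
    and "cond_C2 H F C r"
    and "cond_C3 H \<theta>0 l F C r \<epsilon> \<or> cond_C3bis H \<theta>0 l S F r \<epsilon>"
  shows "tendsto_0_in_prob (hmm_law H \<theta>0)
           (\<lambda>n \<omega>. posterior H n (snd \<omega>) {\<theta> \<in> Par H. weighted_dist H l \<theta>0 \<theta> \<ge> \<epsilon> n})"
proof -
  interpret hmm_setting H by (rule assms(1))
  interpret Pr: prob_space "Prior H" by (rule prior_prob)
  note \<theta>0 = assms(2) and \<rho>0 = assms(5) and C1 = assms(6) and C2 = assms(7)
  obtain p where l: "l = Suc p"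
    using assms(3) by (cases l) auto
  let ?wd = "\<lambda>\<theta>. weighted_dist H l \<theta>0 \<theta>"
  note wd [measurable] = assms(4)
  have F: "F n \<in> sets (Prior H)" "F n \<subseteq> Par H" if "1 \<le> n" for n
    using C2 that sets.sets_into_space[of "F n" "Prior H"] unfolding cond_C2_def by (auto simp: space_Prior)
  have r: "r n > 0" and S_pos: "measure (full_prior H) (S n) > 0" if n: "1 \<le> n" for n
  proof -
    show "r n > 0" using C1 n unfolding cond_C1_def by auto
    obtain c where "c > 0" "measure (full_prior H) (S n) \<ge> c * exp (- (C n * real n * (r n)\<^sup>2))"
      using C1 n unfolding cond_C1_def by blast
    then show "measure (full_prior H) (S n) > 0"
      by (meson exp_gt_zero less_le_trans mult_pos_pos)
  qed
  have nr: "filterlim (\<lambda>n. real n * (r n)\<^sup>2) at_top sequentially"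
    using C1 unfolding cond_C1_def by blast
  from assms(8) show ?thesis
  proof
    assume C3: "cond_C3 H \<theta>0 l F C r \<epsilon>"
    have r\<epsilon>: "r n \<le> \<epsilon> n" if "1 \<le> n" for n
      using C3 that unfolding cond_C3_def by auto
    have \<epsilon>0: "\<epsilon> \<longlonglongrightarrow> 0"
      using C3 unfolding cond_C3_def by blast
    have ratio: "(\<lambda>n. (real n * (r n)\<^sup>2 * (1 + C n)) / (real n * (\<epsilon> n)\<^sup>2)) \<longlonglongrightarrow> 0"
      using C3 unfolding cond_C3_def by blast
    obtain c where c: "c > 0" "\<And>n. 1 \<le> n \<Longrightarrow> measure (full_prior H) (S n) \<ge> c * exp (- (C n * real n * (r n)\<^sup>2))"
      using C1 unfolding cond_C1_def by blast
    have n\<epsilon>: "filterlim (\<lambda>n. real n * (\<epsilon> n)\<^sup>2) at_top sequentially"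
    proof (rule filterlim_at_top_mono[OF nr])
      show "eventually (\<lambda>n. real n * (r n)\<^sup>2 \<le> real n * (\<epsilon> n)\<^sup>2) sequentially"
        using eventually_ge_at_top[of 1]
      proof eventually_elim
        case (elim n)
        show ?case
          using r[OF elim] r\<epsilon>[OF elim] by (intro mult_left_mono power_mono) auto
      qed
    qed
    \<comment> \<open>a single shell, at scale \<open>\<epsilon>\<^sub>n\<close>, contains all distant parameters of \<open>F n\<close>\<close>
    let ?G = "\<lambda>n. F n \<inter> {\<theta>. \<epsilon> n \<le> ?wd \<theta>}"
    show ?thesis
    proof (rule posterior_tendsto_0[where p=p, unfolded l[symmetric], OF \<theta>0 \<rho>0 C1 C2 r\<epsilon> \<epsilon>0, where J="\<lambda>n. {1}" and G="\<lambda>n m. ?G n"])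
      have "eventually (\<lambda>n. \<epsilon> n < 2) sequentially"
        using \<epsilon>0 by (rule order_tendstoD) simp
      then show "\<forall>\<^sub>F n in sequentially. finite {1::nat} \<and> (\<forall>m\<in>{1}. 1 \<le> m \<and> real m * \<epsilon> n \<le> 2)"
        by eventually_elim simp
      show "\<forall>\<^sub>F n in sequentially. \<forall>m\<in>{1}. ?G n \<in> sets (Prior H) \<and> (\<forall>\<theta>\<in>?G n. real m * \<epsilon> n \<le> ?wd \<theta>)"
        using eventually_ge_at_top[of 1]
      proof eventually_elim
        case (elim n)
        have "F n \<inter> {\<theta> \<in> space (Prior H). \<epsilon> n \<le> ?wd \<theta>} \<in> sets (Prior H)"
          using F(1)[OF elim] by measurable
        also have "F n \<inter> {\<theta> \<in> space (Prior H). \<epsilon> n \<le> ?wd \<theta>} = ?G n"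
          using F(2)[OF elim] by (auto simp: space_Prior)
        finally show ?case by simp
      qed
      show "\<forall>\<^sub>F n in sequentially. \<forall>m\<in>{1}. \<exists>T. finite T \<and> T \<subseteq> Par H \<and>
          (\<forall>\<theta>\<in>?G n. \<exists>t\<in>T. dens_dist H l t \<theta> \<le> real m * \<epsilon> n / 12) \<and>
          real (card T) \<le> exp (real n * (real m * \<epsilon> n)\<^sup>2 * (mix_rate \<theta>0)\<^sup>2 / (16 * real l))"
        using eventually_ge_at_top[of 1]
      proof eventually_elim
        case (elim n)
        have "ereal_of_enat (covering_number (dens_dist H l) (\<epsilon> n / 12) (F n)) \<le>
          ereal (exp ((real n * (\<epsilon> n)\<^sup>2 * (Rho H \<theta>0 - 1)\<^sup>2) / (16 * real l * (2 * Rad H \<theta>0 + Rho H \<theta>0 - 1)\<^sup>2)))"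
          using C3 elim unfolding cond_C3_def by blast
        then obtain T where "finite T" "T \<subseteq> F n" "\<And>\<theta>. \<theta> \<in> F n \<Longrightarrow> \<exists>t\<in>T. dens_dist H l t \<theta> \<le> \<epsilon> n / 12"
          "real (card T) \<le> exp ((real n * (\<epsilon> n)\<^sup>2 * (Rho H \<theta>0 - 1)\<^sup>2) / (16 * real l * (2 * Rad H \<theta>0 + Rho H \<theta>0 - 1)\<^sup>2))"
          by (rule covering_number_le_obtain) blast
        then show ?case
          using F(2)[OF elim] by (auto simp: mix_rate_def power_divide mult.commute intro!: exI[of _ T])
      qed
      show "\<forall>\<^sub>F n in sequentially. {\<theta> \<in> Par H. \<epsilon> n \<le> ?wd \<theta>} \<subseteq> (Par H - F n) \<union> (\<Union>m\<in>{1::nat}. ?G n)"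
        by (intro always_eventually) auto
      let ?Y = "\<lambda>n. exp (real n * (r n)\<^sup>2) / measure (full_prior H) (S n) *
        (\<Sum>m\<in>{1::nat}. exp (- (real n * (real m * \<epsilon> n)\<^sup>2 / (18 * real l))) * measure (Prior H) (?G n))"
      show "?Y \<longlonglongrightarrow> 0"
      proof (rule tendsto_sandwich[OF _ _ tendsto_const])
        show "(\<lambda>n. 1 / c * exp (- (1 / (36 * real l) * (real n * (\<epsilon> n)\<^sup>2)))) \<longlonglongrightarrow> 0"
          by (rule tendsto_mult_right_zero[OF exp_neg_tendsto_0[OF n\<epsilon>]]) (simp add: l)
        show "eventually (\<lambda>n. 0 \<le> ?Y n) sequentially"
          by simp
        \<comment> \<open>half of the exponent \<open>n \<epsilon>\<^sup>2 / (18 l)\<close> absorbs the lower bound of the denominator\<close>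
        have "eventually (\<lambda>n. (real n * (r n)\<^sup>2 * (1 + C n)) / (real n * (\<epsilon> n)\<^sup>2) < 1 / (36 * real l)) sequentially"
          using ratio by (rule order_tendstoD) (simp add: l)
        then show "eventually (\<lambda>n. ?Y n \<le> 1 / c * exp (- (1 / (36 * real l) * (real n * (\<epsilon> n)\<^sup>2)))) sequentially"
          using eventually_ge_at_top[of 1]
        proof eventually_elim
          case (elim n)
          let ?v = "real n * (r n)\<^sup>2" and ?w = "real n * (\<epsilon> n)\<^sup>2" and ?s = "measure (full_prior H) (S n)"
          have w: "?w > 0"
            using r[OF elim(2)] r\<epsilon>[OF elim(2)] elim(2) by simp
          have vw: "?v * (1 + C n) \<le> 1 / (36 * real l) * ?w"
            using less_imp_le[OF elim(1)] unfolding pos_divide_le_eq[OF w] .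
          have "?s \<ge> c * exp (- (C n * ?v))"
            using c(2)[OF elim(2)] by (simp add: mult.assoc)
          then have "exp ?v / ?s \<le> exp ?v / (c * exp (- (C n * ?v)))"
            using c(1) S_pos[OF elim(2)] by (intro divide_left_mono) auto
          also have "\<dots> = exp (?v * (1 + C n)) / c"
            by (simp add: exp_minus exp_add field_simps)
          also have "\<dots> \<le> exp (1 / (36 * real l) * ?w) / c"
            using vw c(1) by (intro divide_right_mono) auto
          finally have 1: "exp ?v / ?s \<le> exp (1 / (36 * real l) * ?w) / c" .
          have "?Y n = exp ?v / ?s * (exp (- (?w / (18 * real l))) * measure (Prior H) (?G n))"
            by simp
          also have "\<dots> \<le> exp (1 / (36 * real l) * ?w) / c * (exp (- (?w / (18 * real l))) * 1)"
            using c(1) by (intro mult_mono 1 Pr.prob_le_1) auto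
          also have "\<dots> = 1 / c * exp (1 / (36 * real l) * ?w + - (?w / (18 * real l)))"
            unfolding exp_add by simp
          also have "1 / (36 * real l) * ?w + - (?w / (18 * real l)) = - (1 / (36 * real l) * ?w)"
          proof -
            have "?w / (18 * real l) = 2 * (1 / (36 * real l) * ?w)" by simp
            then show ?thesis by linarith
          qed
          finally show ?case .
        qed
      qed
    qed
  next
    assume C3: "cond_C3bis H \<theta>0 l S F r \<epsilon>"
    have r\<epsilon>: "r n \<le> \<epsilon> n" if "1 \<le> n" for n
      using C3 that unfolding cond_C3bis_def by auto
    have \<epsilon>0: "\<epsilon> \<longlonglongrightarrow> 0"
      using C3 unfolding cond_C3bis_def by blast
    have \<epsilon>: "\<epsilon> n > 0" if "1 \<le> n" for n
      using r[OF that] r\<epsilon>[OF that] by linarith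
    let ?G = "\<lambda>n m. shell H \<theta>0 l F n m (\<epsilon> n)"
    \<comment> \<open>weighted distances are at most 2, so all later shells are empty\<close>
    let ?J = "\<lambda>n. {m. 1 \<le> m \<and> real m * \<epsilon> n \<le> 2}"
    have J: "finite (?J n)" if "1 \<le> n" for n
    proof (rule finite_subset)
      show "?J n \<subseteq> {..nat \<lceil>2 / \<epsilon> n\<rceil>}"
      proof
        fix m assume "m \<in> ?J n"
        then have "real m \<le> 2 / \<epsilon> n"
          using \<epsilon>[OF that] by (simp add: field_simps)
        then show "m \<in> {..nat \<lceil>2 / \<epsilon> n\<rceil>}" by simp linarith
      qed
    qed simp
    have GP: "?G n m \<subseteq> Par H" if "1 \<le> n" for n m
      using F(2)[OF that] by (auto simp: shell_def)
    show ?thesis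
    proof (rule posterior_tendsto_0[where p=p, unfolded l[symmetric], OF \<theta>0 \<rho>0 C1 C2 r\<epsilon> \<epsilon>0, where J="?J" and G="?G"])
      show "\<forall>\<^sub>F n in sequentially. finite (?J n) \<and> (\<forall>m\<in>?J n. 1 \<le> m \<and> real m * \<epsilon> n \<le> 2)"
        using eventually_ge_at_top[of 1] by eventually_elim (use J in auto)
      show "\<forall>\<^sub>F n in sequentially. \<forall>m\<in>?J n. ?G n m \<in> sets (Prior H) \<and> (\<forall>\<theta>\<in>?G n m. real m * \<epsilon> n \<le> ?wd \<theta>)"
        using eventually_ge_at_top[of 1]
      proof eventually_elim
        case (elim n)
        have "?G n m \<in> sets (Prior H)" for m
        proof -
          have "F n \<inter> {\<theta> \<in> space (Prior H). real m * \<epsilon> n \<le> ?wd \<theta> \<and> ?wd \<theta> \<le> (real m + 1) * \<epsilon> n} \<in> sets (Prior H)"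
            using F(1)[OF elim] by measurable
          also have "F n \<inter> {\<theta> \<in> space (Prior H). real m * \<epsilon> n \<le> ?wd \<theta> \<and> ?wd \<theta> \<le> (real m + 1) * \<epsilon> n} = ?G n m"
            using F(2)[OF elim] by (auto simp: space_Prior shell_def)
          finally show ?thesis .
        qed
        then show ?case by (auto simp: shell_def)
      qed
      show "\<forall>\<^sub>F n in sequentially. \<forall>m\<in>?J n. \<exists>T. finite T \<and> T \<subseteq> Par H \<and>
          (\<forall>\<theta>\<in>?G n m. \<exists>t\<in>T. dens_dist H l t \<theta> \<le> real m * \<epsilon> n / 12) \<and>
          real (card T) \<le> exp (real n * (real m * \<epsilon> n)\<^sup>2 * (mix_rate \<theta>0)\<^sup>2 / (16 * real l))"
        using eventually_ge_at_top[of 1]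
      proof (eventually_elim, intro ballI)
        fix n m assume n: "1 \<le> n" and m: "m \<in> ?J n"
        have "ereal_of_enat (covering_number (dens_dist H l) (real m * \<epsilon> n / 12) (?G n m)) \<le>
          ereal (exp ((real n * (real m)\<^sup>2 * (\<epsilon> n)\<^sup>2 * (Rho H \<theta>0 - 1)\<^sup>2) / (16 * real l * (2 * Rad H \<theta>0 + Rho H \<theta>0 - 1)\<^sup>2)))"
          using C3 n m unfolding cond_C3bis_def by blast
        then obtain T where "finite T" "T \<subseteq> ?G n m" "\<And>\<theta>. \<theta> \<in> ?G n m \<Longrightarrow> \<exists>t\<in>T. dens_dist H l t \<theta> \<le> real m * \<epsilon> n / 12"
          "real (card T) \<le> exp ((real n * (real m)\<^sup>2 * (\<epsilon> n)\<^sup>2 * (Rho H \<theta>0 - 1)\<^sup>2) / (16 * real l * (2 * Rad H \<theta>0 + Rho H \<theta>0 - 1)\<^sup>2))"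
          by (rule covering_number_le_obtain) blast
        then show "\<exists>T. finite T \<and> T \<subseteq> Par H \<and>
          (\<forall>\<theta>\<in>?G n m. \<exists>t\<in>T. dens_dist H l t \<theta> \<le> real m * \<epsilon> n / 12) \<and>
          real (card T) \<le> exp (real n * (real m * \<epsilon> n)\<^sup>2 * (mix_rate \<theta>0)\<^sup>2 / (16 * real l))"
          using GP[OF n, of m] by (intro exI[of _ T]) (auto simp: mix_rate_def power_divide power_mult_distrib mult_ac)
      qed
      show "\<forall>\<^sub>F n in sequentially. {\<theta> \<in> Par H. \<epsilon> n \<le> ?wd \<theta>} \<subseteq> (Par H - F n) \<union> (\<Union>m\<in>?J n. ?G n m)"
        using eventually_ge_at_top[of 1]
      proof eventually_elim
        case (elim n)
        show ?case
        proof
          fix \<theta> assume "\<theta> \<in> {\<theta> \<in> Par H. \<epsilon> n \<le> ?wd \<theta>}"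
          then have \<theta>: "\<theta> \<in> Par H" "\<epsilon> n \<le> ?wd \<theta>" by auto
          define m where "m = nat \<lfloor>?wd \<theta> / \<epsilon> n\<rfloor>"
          note \<epsilon>n = \<epsilon>[OF elim]
          have "1 \<le> ?wd \<theta> / \<epsilon> n"
            using \<theta>(2) \<epsilon>n by simp
          then have "1 \<le> m" "real m \<le> ?wd \<theta> / \<epsilon> n" "?wd \<theta> / \<epsilon> n \<le> real m + 1"
            unfolding m_def by linarith+
          then have "1 \<le> m" "real m * \<epsilon> n \<le> ?wd \<theta>" "?wd \<theta> \<le> (real m + 1) * \<epsilon> n"
            using \<epsilon>n by (simp_all add: field_simps)
          then show "\<theta> \<in> (Par H - F n) \<union> (\<Union>m\<in>?J n. ?G n m)"
            using \<theta>(1) weighted_dist_bounds[OF \<theta>(1) \<theta>0, of l] by (auto simp: shell_def intro!: exI[of _ m])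
        qed
      qed
      let ?t = "\<lambda>n m. measure (Prior H) (?G n m) / measure (full_prior H) (S n) *
        exp (- (real n * (real m)\<^sup>2 * (\<epsilon> n)\<^sup>2 / (32 * real l)))"
      let ?Y = "\<lambda>n. exp (real n * (r n)\<^sup>2) / measure (full_prior H) (S n) *
        (\<Sum>m\<in>?J n. exp (- (real n * (real m * \<epsilon> n)\<^sup>2 / (18 * real l))) * measure (Prior H) (?G n m))"
      show "?Y \<longlonglongrightarrow> 0"
      proof (rule tendsto_sandwich[OF _ _ tendsto_const])
        show "(\<lambda>n. (\<Sum>k. ?t n (Suc k)) / exp (- (real n * (r n)\<^sup>2))) \<longlonglongrightarrow> 0"
        proof (rule smalloD_tendsto)
          show "(\<lambda>n. \<Sum>k. ?t n (Suc k)) \<in> o(\<lambda>n. exp (- (real n * (r n)\<^sup>2)))"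
            using C3 unfolding cond_C3bis_def by blast
        qed
        show "eventually (\<lambda>n. 0 \<le> ?Y n) sequentially"
          by (intro always_eventually allI mult_nonneg_nonneg divide_nonneg_nonneg sum_nonneg) auto
        show "eventually (\<lambda>n. ?Y n \<le> (\<Sum>k. ?t n (Suc k)) / exp (- (real n * (r n)\<^sup>2))) sequentially"
          using eventually_ge_at_top[of 1]
        proof eventually_elim
          case (elim n)
          note \<epsilon>n = \<epsilon>[OF elim] and Jn = J[OF elim]
          have t0: "?t n m \<ge> 0" for m by simp
          have empty: "?t n m = 0" if "1 \<le> m" "m \<notin> ?J n" for m
          proof -
            have "?G n m = {}"
            proof (rule equals0I)
              fix \<theta> assume \<theta>: "\<theta> \<in> ?G n m"
              then have "real m * \<epsilon> n \<le> 2"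
                using GP[OF elim, of m] weighted_dist_bounds[OF _ \<theta>0, of \<theta> l] by (auto simp: shell_def)
              with that show False by simp
            qed
            then show ?thesis by simp
          qed
          have summable: "summable (\<lambda>k. ?t n (Suc k))"
          proof (rule summable_finite)
            show "finite ((\<lambda>m. m - 1) ` ?J n)" using Jn by simp
            fix k assume k: "k \<notin> (\<lambda>m. m - 1) ` ?J n"
            then have "Suc k \<notin> ?J n" by force
            then show "?t n (Suc k) = 0" by (intro empty) auto
          qed
          have "(\<Sum>m\<in>?J n. ?t n m) = (\<Sum>k\<in>(\<lambda>m. m - 1) ` ?J n. ?t n (Suc k))"
            by (subst sum.reindex) (auto simp: inj_on_def intro!: sum.cong)
          also have "\<dots> \<le> (\<Sum>k. ?t n (Suc k))"
            using Jn t0 by (intro sum_le_suminf summable) auto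
          finally have le: "(\<Sum>m\<in>?J n. ?t n m) \<le> (\<Sum>k. ?t n (Suc k))" .
          have "?Y n = exp (real n * (r n)\<^sup>2) * (\<Sum>m\<in>?J n. measure (Prior H) (?G n m) / measure (full_prior H) (S n) *
              exp (- (real n * (real m * \<epsilon> n)\<^sup>2 / (18 * real l))))"
            by (simp add: sum_distrib_left sum_divide_distrib mult_ac)
          also have "\<dots> \<le> exp (real n * (r n)\<^sup>2) * (\<Sum>m\<in>?J n. ?t n m)"
          proof (intro mult_left_mono sum_mono)
            fix m
            have "real n * (real m * \<epsilon> n)\<^sup>2 / (32 * real l) \<le> real n * (real m * \<epsilon> n)\<^sup>2 / (18 * real l)"
              by (intro divide_left_mono) (auto simp: l)
            then show "exp (- (real n * (real m * \<epsilon> n)\<^sup>2 / (18 * real l))) \<le> exp (- (real n * (real m)\<^sup>2 * (\<epsilon> n)\<^sup>2 / (32 * real l)))"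
              by (simp add: power_mult_distrib mult.assoc)
          qed auto
          also have "\<dots> \<le> exp (real n * (r n)\<^sup>2) * (\<Sum>k. ?t n (Suc k))"
            by (intro mult_left_mono le) simp
          also have "exp u * s = s / exp (- u)" for u s :: real
            by (simp add: exp_minus divide_inverse)
          finally show ?case .
        qed
      qed
    qed
  qed
qed

end
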